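(* Let $\mathcal A$ and $U$ be linear, uniformly closed, $C_{ub}$-invariant subsets of $L^1_{loc}(\mathbb J,X)$, let $\mathcal A$ satisfy $(L_U)$, and let $S\in\mathcal D'_{L^\infty}(\mathbb R,X)$ with $sp_{\mathcal A,\mathcal D_{L^1}}S$ at most countable. Assume that for all $\omega\in sp_{\mathcal A,\mathcal D_{L^1}}S$ one has $\gamma_\omega\mathcal A\subset\mathcal A$, $\gamma_{-\omega}\mathcal A\subset\mathcal A$ and $(\gamma_{-\omega}S)|\,\mathbb J\in\mathcal D'_U$. Then $S|\,\mathbb J\in\mathcal D'_{\mathcal A}$.
   Context: $X$ is a complex Banach space; $\mathbb J$ is an interval of the form $\mathbb R$, $(\alpha,\infty)$ or $[\alpha,\infty)$, $\alpha\in\mathbb R$. $\gamma_\omega(t)=e^{i\omega t}$. $C_{ub}$: bounded uniformly continuous functions. $f_a(t)=f(t+a)$, $\Delta_hf=f_h-f$. A class $\mathcal A\subset L^1_{loc}(\mathbb J,X)$ is uniformly closed if $(\phi_n)\subset\mathcal A$, $\phi_n\to\phi$ uniformly on $\mathbb J$ implies $\phi\in\mathcal A$; it is $C_{ub}$-invariant if for each $f\in C_{ub}(\mathbb R,X)$ with $f|\,\mathbb J\in\mathcal A$ one has $f_a|\,\mathbb J\in\mathcal A$ for all $a\in\mathbb R$. $(L_U)$ for $\mathcal A$: if $\psi\in U$ and $\Delta_h\psi\in\mathcal A$ for all $h>0$, then $\psi\in\mathcal A$. $\mathcal D(\mathbb R,\mathbb C)$: Schwartz test functions; $\mathcal D'(\mathbb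 R,X)$: linear continuous maps $\mathcal D(\mathbb R,\mathbb C)\to X$; $(T*\varphi)(x)=T(y\mapsto\varphi(x-y))$; $(\gamma_\omega T)(\varphi)=T(\gamma_\omega\varphi)$. $\mathcal D'_{L^\infty}(\mathbb R,X)=\{T\in\mathcal D'(\mathbb R,X):T*\varphi\in L^\infty(\mathbb R,X)\ \forall\varphi\in\mathcal D(\mathbb R,\mathbb C)\}$. For $T\in\mathcal D'(\mathbb R,X)$ and $V\subset L^1_{loc}(\mathbb J,X)$, "$T|\,\mathbb J\in\mathcal D'_V$" means $(T*\varphi)|\,\mathbb J\in V$ for all $\varphi\in\mathcal D(\mathbb R,\mathbb C)$. $\mathcal D_{L^1}(\mathbb R,\mathbb C)$: all $\varphi\in C^\infty(\mathbb R,\mathbb C)$ with $\varphi^{(j)}\in L^1$ for all $j\ge0$, where $\varphi_k\to0$ means $\varphi_k^{(j)}\to0$ in $L^1$ for each $j$. Each $S\in\mathcal D'_{L^\infty}(\mathbb R,X)$ extends uniquely to a linear continuous map $\mathcal D_{L^1}(\mathbb R,\mathbb C)\to X$, again denoted $S$; for $\varphi\in\mathcal D_{L^1}(\mathbb R,\mathbb C)$, $(S*\varphi)(x)=S(y\mapsto\varphi(x-y))$, and $sp_{\mathcal A,\mathcal D_{L^1}}S=\{\omega\in\mathbb R:$ for every $\varphi\in\mathcal D_{L^1}(\mathbb R,\mathbb C)$ with $(S*\varphi)|\,\mathbb J\in\mathcal A$ one has $\hat\varphi(\omega)=0\}$, where $\hat\varphi(\omega)=\int_{\mathbb R}e^{-i\omega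 t}\varphi(t)\,dt$. *)

theory Defs
  imports "HOL-Analysis.Analysis"
begin

section \<open>Complex Banach spaces\<close>

class complex_banach = banach +
  fixes scaleC :: "complex \<Rightarrow> 'a \<Rightarrow> 'a" (infixr "*\<^sub>C" 75)
  assumes scaleC_add_right: "c *\<^sub>C (x + y) = c *\<^sub>C x + c *\<^sub>C y"
    and scaleC_add_left: "(c + d) *\<^sub>C x = c *\<^sub>C x + d *\<^sub>C x"
    and scaleC_scaleC: "c *\<^sub>C (d *\<^sub>C x) = (c * d) *\<^sub>C x"
    and scaleR_eq_scaleC: "r *\<^sub>R x = complex_of_real r *\<^sub>C x"
    and norm_scaleC: "norm (c *\<^sub>C x) = cmod c * norm x"

definition admissible_interval :: "real set \<Rightarrow> bool" where
  "admissible_interval J \<longleftrightarrow> J = UNIV \<or> (\<exists>\<alpha>. J = {\<alpha><..} \<or> J = {\<alpha>..})"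

section \<open>Classes of locally integrable functions\<close>

text \<open>The Banach space need not be separable, so the Bochner integral of the library, which is
  restricted to second countable spaces, does not apply. Measurability in the sense of Bochner is
  almost everywhere approximability by simple functions.\<close>

definition strongly_measurable_on :: "real set \<Rightarrow> (real \<Rightarrow> 'a::real_normed_vector) \<Rightarrow> bool" where
  "strongly_measurable_on J f \<longleftrightarrow>
     (\<exists>s. (\<forall>n::nat. simple_function (lebesgue_on J) (s n)) \<and>
          (AE t in lebesgue_on J. (\<lambda>n. s n t) \<longlonglongrightarrow> f t))"

definition L1loc :: "real set \<Rightarrow> (real \<Rightarrow> 'a::real_normed_vector) set" where
  "L1loc J = {f. strongly_measurable_on J f \<and>
     (\<forall>K. compact K \<and> K \<subseteq> J \<longrightarrow> set_integrable lebesgue K (\<lambda>t. norm (f t)))}"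

definition Linfty :: "(real \<Rightarrow> 'a::real_normed_vector) set" where
  "Linfty = {f. strongly_measurable_on UNIV f \<and> (\<exists>C. AE t in lebesgue. norm (f t) \<le> C)}"

text \<open>Elements of the space of locally integrable functions are classes of functions modulo
  equality almost everywhere on \<open>J\<close>. A set of such classes is encoded as a set of representatives
  defined on the whole line and closed under this equivalence. In particular the values of a
  representative outside \<open>J\<close> are irrelevant, so that \<open>f \<in> A\<close> says that the restriction of
  \<open>f\<close> to \<open>J\<close> belongs to the given class.\<close>

definition L1loc_class :: "real set \<Rightarrow> (real \<Rightarrow> 'a::real_normed_vector) set \<Rightarrow> bool" where
  "L1loc_class J A \<longleftrightarrow> A \<subseteq> L1loc J \<and>
     (\<forall>f\<in>A. \<forall>g. (AE t in lebesgue_on J. g t = f t) \<longrightarrow> g \<in> A)"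

definition linear_class :: "(real \<Rightarrow> 'a::complex_banach) set \<Rightarrow> bool" where
  "linear_class A \<longleftrightarrow> (\<lambda>_. 0) \<in> A \<and> (\<forall>f\<in>A. \<forall>g\<in>A. (\<lambda>t. f t + g t) \<in> A) \<and>
     (\<forall>c. \<forall>f\<in>A. (\<lambda>t. c *\<^sub>C f t) \<in> A)"

definition uniformly_closed :: "real set \<Rightarrow> (real \<Rightarrow> 'a::real_normed_vector) set \<Rightarrow> bool" where
  "uniformly_closed J A \<longleftrightarrow>
     (\<forall>\<phi> f. (\<forall>n::nat. \<phi> n \<in> A) \<and> uniform_limit J \<phi> f sequentially \<longrightarrow> f \<in> A)"

definition translate :: "real \<Rightarrow> (real \<Rightarrow> 'a) \<Rightarrow> real \<Rightarrow> 'a" where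
  "translate a f = (\<lambda>t. f (t + a))"

definition difference :: "real \<Rightarrow> (real \<Rightarrow> 'a::real_normed_vector) \<Rightarrow> real \<Rightarrow> 'a" where
  "difference h f = (\<lambda>t. translate h f t - f t)"

definition Cub :: "(real \<Rightarrow> 'a::real_normed_vector) set" where
  "Cub = {f. bounded (range f) \<and> uniformly_continuous_on UNIV f}"

definition Cub_invariant :: "(real \<Rightarrow> 'a::real_normed_vector) set \<Rightarrow> bool" where
  "Cub_invariant A \<longleftrightarrow> (\<forall>f\<in>Cub. f \<in> A \<longrightarrow> (\<forall>a. translate a f \<in> A))"

definition satisfies_L ::
    "(real \<Rightarrow> 'a::real_normed_vector) set \<Rightarrow> (real \<Rightarrow> 'a) set \<Rightarrow> bool" where
  "satisfies_L U A \<longleftrightarrow> (\<forall>\<psi>\<in>U. (\<forall>h>0. difference h \<psi> \<in> A) \<longrightarrow> \<psi> \<in> A)"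

definition character :: "real \<Rightarrow> real \<Rightarrow> complex" where
  "character \<omega> t = cis (\<omega> * t)"

definition mult_character :: "real \<Rightarrow> (real \<Rightarrow> 'a::complex_banach) \<Rightarrow> real \<Rightarrow> 'a" where
  "mult_character \<omega> f = (\<lambda>t. character \<omega> t *\<^sub>C f t)"

section \<open>Test functions and distributions\<close>

definition nderiv :: "nat \<Rightarrow> (real \<Rightarrow> complex) \<Rightarrow> real \<Rightarrow> complex" where
  "nderiv j \<phi> = ((\<lambda>g t. vector_derivative g (at t)) ^^ j) \<phi>"

definition smooth :: "(real \<Rightarrow> complex) \<Rightarrow> bool" where
  "smooth \<phi> \<longleftrightarrow> (\<forall>j t. nderiv j \<phi> differentiable (at t))"

definition test_functions :: "(real \<Rightarrow> complex) set" where
  "test_functions = {\<phi>. smooth \<phi> \<and> (\<exists>K. compact K \<and> (\<forall>t. t \<notin> K \<longrightarrow> \<phi> t = 0))}"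

definition test_null :: "(nat \<Rightarrow> real \<Rightarrow> complex) \<Rightarrow> bool" where
  "test_null \<Phi> \<longleftrightarrow> (\<exists>K. compact K \<and> (\<forall>k t. t \<notin> K \<longrightarrow> \<Phi> k t = 0)) \<and>
     (\<forall>j. uniform_limit UNIV (\<lambda>k. nderiv j (\<Phi> k)) (\<lambda>_. 0) sequentially)"

definition DL1 :: "(real \<Rightarrow> complex) set" where
  "DL1 = {\<phi>. smooth \<phi> \<and> (\<forall>j. integrable lborel (nderiv j \<phi>))}"

definition DL1_null :: "(nat \<Rightarrow> real \<Rightarrow> complex) \<Rightarrow> bool" where
  "DL1_null \<Phi> \<longleftrightarrow> (\<forall>j. (\<lambda>k. LINT t|lborel. cmod (nderiv j (\<Phi> k) t)) \<longlonglongrightarrow> 0)"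

text \<open>Complex linear and sequentially continuous on the space \<open>V\<close>, with \<open>null\<close> describing the
  sequences of \<open>V\<close> that converge to zero. For the usual inductive limit topology on the test
  functions and for the Frechet topology on \<open>DL1\<close>, sequential continuity of a linear map is
  continuity. Values outside \<open>V\<close> are irrelevant.\<close>

definition linear_continuous_on ::
    "(real \<Rightarrow> complex) set \<Rightarrow> ((nat \<Rightarrow> real \<Rightarrow> complex) \<Rightarrow> bool) \<Rightarrow>
     ((real \<Rightarrow> complex) \<Rightarrow> 'a::complex_banach) \<Rightarrow> bool" where
  "linear_continuous_on V null T \<longleftrightarrow>
     (\<forall>\<phi>\<in>V. \<forall>\<psi>\<in>V. T (\<lambda>t. \<phi> t + \<psi> t) = T \<phi> + T \<psi>) \<and>
     (\<forall>c. \<forall>\<phi>\<in>V. T (\<lambda>t. c * \<phi> t) = c *\<^sub>C T \<phi>) \<and>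
     (\<forall>\<Phi>. (\<forall>k. \<Phi> k \<in> V) \<and> null \<Phi> \<longrightarrow> (\<lambda>k. T (\<Phi> k)) \<longlonglongrightarrow> 0)"

definition distributions :: "((real \<Rightarrow> complex) \<Rightarrow> 'a::complex_banach) set" where
  "distributions = {T. linear_continuous_on test_functions test_null T}"

definition convolve :: "((real \<Rightarrow> complex) \<Rightarrow> 'a) \<Rightarrow> (real \<Rightarrow> complex) \<Rightarrow> real \<Rightarrow> 'a" where
  "convolve T \<phi> = (\<lambda>x. T (\<lambda>y. \<phi> (x - y)))"

definition modulate :: "real \<Rightarrow> ((real \<Rightarrow> complex) \<Rightarrow> 'a) \<Rightarrow> (real \<Rightarrow> complex) \<Rightarrow> 'a" where
  "modulate \<omega> T = (\<lambda>\<phi>. T (\<lambda>t. character \<omega> t * \<phi> t))"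

definition bounded_distributions :: "((real \<Rightarrow> complex) \<Rightarrow> 'a::complex_banach) set" where
  "bounded_distributions = {T \<in> distributions. \<forall>\<phi>\<in>test_functions. convolve T \<phi> \<in> Linfty}"

definition in_distr_class ::
    "((real \<Rightarrow> complex) \<Rightarrow> 'a::complex_banach) \<Rightarrow> (real \<Rightarrow> 'a) set \<Rightarrow> bool" where
  "in_distr_class T V \<longleftrightarrow> (\<forall>\<phi>\<in>test_functions. convolve T \<phi> \<in> V)"

text \<open>The extension of a bounded distribution to \<open>DL1\<close>. It exists, and it is unique as a map on
  \<open>DL1\<close>; the choice operator only leaves the irrelevant values outside \<open>DL1\<close> unspecified.\<close>

definition DL1_extension ::
    "((real \<Rightarrow> complex) \<Rightarrow> 'a::complex_banach) \<Rightarrow> (real \<Rightarrow> complex) \<Rightarrow> 'a" where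
  "DL1_extension S = (SOME S'. linear_continuous_on DL1 DL1_null S' \<and>
     (\<forall>\<phi>\<in>test_functions. S' \<phi> = S \<phi>))"

definition fourier :: "(real \<Rightarrow> complex) \<Rightarrow> real \<Rightarrow> complex" where
  "fourier \<phi> \<omega> = (LINT t|lborel. cis (- (\<omega> * t)) * \<phi> t)"

definition sp_DL1 ::
    "(real \<Rightarrow> 'a::complex_banach) set \<Rightarrow> ((real \<Rightarrow> complex) \<Rightarrow> 'a) \<Rightarrow> real set" where
  "sp_DL1 A S = {\<omega>. \<forall>\<phi>\<in>DL1. convolve (DL1_extension S) \<phi> \<in> A \<longrightarrow> fourier \<phi> \<omega> = 0}"

end

theory Submission
  imports Defs "HOL-Probability.Sinc_Integral" "HOL-Probability.Characteristic_Functions"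
begin

text \<open>The functions \<open>f\<close> of \<open>DL1\<close> with \<open>S * f\<close> in \<open>A\<close> form a closed translation
  invariant subspace, hence an ideal for convolution with integrable functions, and the spectrum is
  the set of common zeros of its Fourier transforms. By Wiener's lemma and a partition of the frequency
  axis, every \<open>f\<close> whose Fourier transform has compact support off the spectrum lies in this ideal. If
  the spectrum were nonempty, it would, being closed and countable, have an isolated point \<open>w\<close>. Take
  \<open>\<eta>\<close> whose Fourier transform lives near \<open>w\<close> and does not vanish at \<open>w\<close>, and let \<open>\<psi>\<close> be
  \<open>S * \<eta>\<close> multiplied by the character of frequency \<open>- w\<close>. The Fourier transforms
  belonging to the differences of \<open>\<psi>\<close> vanish at \<open>w\<close>, so these differences lie in \<open>A\<close>, and the
  condition on \<open>U\<close> gives that \<open>\<psi>\<close>, hence \<open>S * \<eta>\<close>, lies in \<open>A\<close>. This contradicts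
  \<open>w\<close> being in the spectrum. So the spectrum is empty and the ideal contains every function whose
  Fourier transform has compact support, hence by approximation all of \<open>DL1\<close>.\<close>

subsection \<open>Smooth functions\<close>

text \<open>The hypothesis on \<open>U\<close> concerns test functions, but a nonzero
  \<open>\<eta>\<close> with compactly supported Fourier transform is never one. Hence a second
  ideal, attached to \<open>U\<close> and the frequency \<open>- w\<close>: it contains the test
  functions, thus also their convolutions with integrable kernels, and \<open>\<eta>\<close> is one
  of those. Vanishing of a transform at \<open>w\<close> has to be upgraded to approximability by
  functions whose transforms vanish near \<open>w\<close>. This rests on scaling: a kernel whose
  transform is 1 within distance \<open>e\<close> of \<open>w\<close> changes under a shift by
  \<open>x\<close>, corrected by a phase, only by an amount depending on \<open>e * x\<close>, which
  tends to 0 with \<open>e\<close>. The same estimate makes the Neumann series in Wiener's lemma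
  converge. Convergence in \<open>DL1\<close> involves all derivatives, yet in a convolution they
  can all be put on the factor from \<open>DL1\<close>. So kernels need only be integrable, and
  differences of Fejer kernels, with piecewise linear transforms, suffice. The extension of
  \<open>S\<close> is a choice, so its existence has to be proved: a bound of finite order, uniform
  over translates, is summed over a smooth partition of the line.\<close>

lemma nderiv_0 [simp]: "nderiv 0 f = f"
  by (simp add: nderiv_def)

lemma nderiv_Suc: "nderiv (Suc j) f = (\<lambda>t. vector_derivative (nderiv j f) (at t))"
  by (simp add: nderiv_def)

lemma nderiv_nderiv: "nderiv i (nderiv j f) = nderiv (i + j) f"
  by (simp add: nderiv_def funpow_add)

lemma smooth_nderiv: "smooth f \<Longrightarrow> smooth (nderiv j f)"
  by (simp add: smooth_def nderiv_nderiv)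

lemma smooth_has_vector_derivative:
  "smooth f \<Longrightarrow> (nderiv j f has_vector_derivative nderiv (Suc j) f t) (at t)"
  by (simp add: smooth_def nderiv_Suc vector_derivative_works[symmetric])

lemma smooth_has_vector_derivative_1:
  "smooth f \<Longrightarrow> (f has_vector_derivative nderiv 1 f t) (at t)"
  using smooth_has_vector_derivative[of f 0 t] by simp

lemma smooth_continuous_on: "smooth f \<Longrightarrow> continuous_on A (nderiv j f)"
  by (rule continuous_at_imp_continuous_on)
    (blast intro: has_vector_derivative_continuous smooth_has_vector_derivative)

lemma smooth_isCont: "smooth f \<Longrightarrow> isCont (nderiv j f) t"
  by (blast intro: has_vector_derivative_continuous smooth_has_vector_derivative)

lemma smooth_borel_measurable: "smooth f \<Longrightarrow> nderiv j f \<in> borel_measurable borel"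
  by (intro borel_measurable_continuous_onI smooth_continuous_on)

text \<open>Iterated derivatives need not be computed one by one: the closure rules below exhibit a
  candidate family, and a single differentiation step identifies every
  \<open>nderiv j\<close>.\<close>

lemma nderiv_family:
  assumes "\<And>j t. (F j has_vector_derivative F (Suc j) t) (at t)"
  shows "nderiv j (F 0) = F j"
proof (induction j)
  case (Suc j)
  have "vector_derivative (F j) (at t) = F (Suc j) t" for t
    using assms vector_derivative_at by blast
  then show ?case by (simp add: nderiv_Suc Suc)
qed simp

lemma smooth_family:
  assumes "\<And>j t. (F j has_vector_derivative F (Suc j) t) (at t)"
  shows "smooth (F 0)"
  unfolding smooth_def nderiv_family[of F, OF assms]
  using assms differentiableI_vector by blast

text \<open>Meant for functions whose higher derivatives have no handy formula, such as products and
  \<open>exp_step\<close>: an invariant class takes the place of the formula.\<close>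

lemma smooth_coinduct:
  assumes "P f" and step: "\<And>f. P f \<Longrightarrow> \<exists>g. P g \<and> (\<forall>t. (f has_vector_derivative g t) (at t))"
  shows "smooth f"
proof -
  have P: "P (nderiv j f)" for j
  proof (induction j)
    case (Suc j)
    from step[OF this] obtain g
      where g: "P g" "\<And>t. (nderiv j f has_vector_derivative g t) (at t)" by blast
    then have "nderiv (Suc j) f = g"
      by (auto simp: nderiv_Suc intro: vector_derivative_at)
    with g show ?case by simp
  qed (simp add: assms)
  show ?thesis
    unfolding smooth_def using step[OF P] differentiableI_vector by blast
qed

lemma
  assumes "smooth f" "smooth g"
  shows smooth_add: "smooth (\<lambda>t. f t + g t)"
    and nderiv_add: "nderiv j (\<lambda>t. f t + g t) = (\<lambda>t. nderiv j f t + nderiv j g t)"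
proof -
  define F where "F = (\<lambda>j t. nderiv j f t + nderiv j g t)"
  have F: "(F j has_vector_derivative F (Suc j) t) (at t)" for j t
    unfolding F_def
    by (intro has_vector_derivative_add smooth_has_vector_derivative assms)
  from smooth_family[of F, OF F] nderiv_family[of F, OF F]
  show "smooth (\<lambda>t. f t + g t)" "nderiv j (\<lambda>t. f t + g t) = (\<lambda>t. nderiv j f t + nderiv j g t)"
    by (simp_all add: F_def)
qed

lemma
  assumes "smooth f"
  shows smooth_cmult: "smooth (\<lambda>t. c * f t)"
    and nderiv_cmult: "nderiv j (\<lambda>t. c * f t) = (\<lambda>t. c * nderiv j f t)"
proof -
  define F where "F = (\<lambda>j t. c * nderiv j f t)"
  have F: "(F j has_vector_derivative F (Suc j) t) (at t)" for j t
    unfolding F_def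
    by (intro has_vector_derivative_mult_right smooth_has_vector_derivative assms)
  from smooth_family[of F, OF F] nderiv_family[of F, OF F]
  show "smooth (\<lambda>t. c * f t)" "nderiv j (\<lambda>t. c * f t) = (\<lambda>t. c * nderiv j f t)"
    by (simp_all add: F_def)
qed

lemma
  assumes "smooth f"
  shows smooth_affine: "smooth (\<lambda>t. f (c * t + a))"
    and nderiv_affine: "nderiv j (\<lambda>t. f (c * t + a)) = (\<lambda>t. of_real (c ^ j) * nderiv j f (c * t + a))"
proof -
  define F where "F = (\<lambda>j t. of_real (c ^ j) * nderiv j f (c * t + a))"
  have F: "(F j has_vector_derivative F (Suc j) t) (at t)" for j t
  proof -
    have "((\<lambda>t. c * t + a) has_vector_derivative c) (at t)"
      by (auto intro!: derivative_eq_intros)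
    from vector_diff_chain_at[OF this smooth_has_vector_derivative[OF assms]]
    have "((\<lambda>t. nderiv j f (c * t + a)) has_vector_derivative c *\<^sub>R nderiv (Suc j) f (c * t + a)) (at t)"
      by (simp add: o_def)
    from has_vector_derivative_mult_right[OF this, of "of_real (c ^ j)"]
    show ?thesis by (simp add: F_def scaleR_conv_of_real mult_ac)
  qed
  from smooth_family[of F, OF F] nderiv_family[of F, OF F]
  show "smooth (\<lambda>t. f (c * t + a))"
    "nderiv j (\<lambda>t. f (c * t + a)) = (\<lambda>t. of_real (c ^ j) * nderiv j f (c * t + a))"
    by (simp_all add: F_def)
qed

lemma
  assumes "smooth f"
  shows smooth_shift: "smooth (\<lambda>t. f (t + a))"
    and nderiv_shift: "nderiv j (\<lambda>t. f (t + a)) = (\<lambda>t. nderiv j f (t + a))"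
    and smooth_reflect: "smooth (\<lambda>t. f (a - t))"
    and nderiv_reflect: "nderiv j (\<lambda>t. f (a - t)) = (\<lambda>t. (- 1) ^ j * nderiv j f (a - t))"
  using smooth_affine[OF assms, of 1 a] nderiv_affine[OF assms, of j 1 a]
    smooth_affine[OF assms, of "- 1" a] nderiv_affine[OF assms, of j "- 1" a]
  by simp_all

lemma
  assumes "smooth f" "smooth g"
  shows smooth_diff: "smooth (\<lambda>t. f t - g t)"
    and nderiv_diff: "nderiv j (\<lambda>t. f t - g t) = (\<lambda>t. nderiv j f t - nderiv j g t)"
proof -
  note minus = smooth_cmult[OF assms(2), of "- 1"]
  show "smooth (\<lambda>t. f t - g t)"
    using smooth_add[OF assms(1) minus] by simp
  show "nderiv j (\<lambda>t. f t - g t) = (\<lambda>t. nderiv j f t - nderiv j g t)"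
    using nderiv_add[OF assms(1) minus, of j] nderiv_cmult[OF assms(2), of j "- 1"] by simp
qed

lemma
  shows smooth_zero: "smooth (\<lambda>_. 0)" and nderiv_zero: "nderiv j (\<lambda>_. 0) = (\<lambda>_. 0)"
  using smooth_family[of "\<lambda>_ _. 0"] nderiv_family[of "\<lambda>_ _. 0"] by (auto intro!: derivative_eq_intros)

lemma
  assumes "finite I" "\<And>i. i \<in> I \<Longrightarrow> smooth (f i)"
  shows smooth_sum: "smooth (\<lambda>t. \<Sum>i\<in>I. f i t)"
    and nderiv_sum: "nderiv j (\<lambda>t. \<Sum>i\<in>I. f i t) = (\<lambda>t. \<Sum>i\<in>I. nderiv j (f i) t)"
proof -
  have "smooth (\<lambda>t. \<Sum>i\<in>I. f i t) \<and> nderiv j (\<lambda>t. \<Sum>i\<in>I. f i t) = (\<lambda>t. \<Sum>i\<in>I. nderiv j (f i) t)"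
    using assms
    by (induction I) (auto simp: smooth_zero nderiv_zero nderiv_add intro: smooth_add)
  then show "smooth (\<lambda>t. \<Sum>i\<in>I. f i t)"
    "nderiv j (\<lambda>t. \<Sum>i\<in>I. f i t) = (\<lambda>t. \<Sum>i\<in>I. nderiv j (f i) t)" by auto
qed

text \<open>Sums of products of smooth functions are closed under differentiation, which makes them an
  invariant for \<open>smooth_coinduct\<close>.\<close>

inductive product_sum :: "(real \<Rightarrow> complex) \<Rightarrow> bool" where
  mult: "smooth f \<Longrightarrow> smooth g \<Longrightarrow> product_sum (\<lambda>t. f t * g t)"
| add: "product_sum f \<Longrightarrow> product_sum g \<Longrightarrow> product_sum (\<lambda>t. f t + g t)"

lemma
  assumes "smooth f" "smooth g"
  shows smooth_mult: "smooth (\<lambda>t. f t * g t)"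
    and nderiv_Suc_mult: "nderiv (Suc j) (\<lambda>t. f t * g t) =
      (\<lambda>t. nderiv j (\<lambda>t. f t * nderiv 1 g t) t + nderiv j (\<lambda>t. nderiv 1 f t * g t) t)"
proof -
  have D: "((\<lambda>t. f t * g t) has_vector_derivative f t * nderiv 1 g t + nderiv 1 f t * g t) (at t)"
    if "smooth f" "smooth g" for f g t
    by (intro has_vector_derivative_mult smooth_has_vector_derivative_1 that)
  have smooth: "smooth (\<lambda>t. f t * g t)" if "smooth f" "smooth g" for f g
  proof (rule smooth_coinduct[of product_sum])
    show "product_sum (\<lambda>t. f t * g t)" using that by (rule product_sum.mult)
    fix f assume "product_sum f"
    then show "\<exists>g. product_sum g \<and> (\<forall>t. (f has_vector_derivative g t) (at t))"
    proof induction
      case (mult f g)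
      with D[OF mult] show ?case
        by (intro exI[of _ "\<lambda>t. f t * nderiv 1 g t + nderiv 1 f t * g t"])
          (auto intro!: product_sum.intros smooth_nderiv)
    next
      case (add f g)
      then show ?case by (blast intro: product_sum.add has_vector_derivative_add)
    qed
  qed
  show "smooth (\<lambda>t. f t * g t)" by (rule smooth[OF assms])
  have "nderiv 1 (\<lambda>t. f t * g t) = (\<lambda>t. f t * nderiv 1 g t + nderiv 1 f t * g t)"
    using D[OF assms] by (auto simp: nderiv_Suc intro: vector_derivative_at)
  then have "nderiv (Suc j) (\<lambda>t. f t * g t) = nderiv j (\<lambda>t. f t * nderiv 1 g t + nderiv 1 f t * g t)"
    using nderiv_nderiv[of j 1 "\<lambda>t. f t * g t"] by simp
  then show "nderiv (Suc j) (\<lambda>t. f t * g t) =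
      (\<lambda>t. nderiv j (\<lambda>t. f t * nderiv 1 g t) t + nderiv j (\<lambda>t. nderiv 1 f t * g t) t)"
    by (simp add: nderiv_add smooth smooth_nderiv assms)
qed

text \<open>A Leibniz estimate with the binomial coefficients absorbed into \<open>C\<close>. The
  induction has to vary \<open>g\<close>, because \<open>nderiv_Suc_mult\<close> moves one
  derivative onto either factor.\<close>

lemma nderiv_mult_bound:
  assumes "smooth g" and "\<And>i. \<exists>C. \<forall>t. cmod (nderiv i g t) \<le> C"
  shows "\<exists>C\<ge>0. \<forall>f t. smooth f \<longrightarrow>
    cmod (nderiv j (\<lambda>t. f t * g t) t) \<le> C * (\<Sum>i\<le>j. cmod (nderiv i f t))"
  using assms
proof (induction j arbitrary: g)
  case 0
  then obtain C where "\<And>t. cmod (g t) \<le> C" by (metis nderiv_0)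
  then show ?case
    by (intro exI[of _ "\<bar>C\<bar>"])
      (auto simp: norm_mult mult.commute[of "\<bar>C\<bar>"] intro!: mult_left_mono order_trans[OF _ abs_ge_self])
next
  case (Suc j)
  obtain C1 where C1: "C1 \<ge> 0" "\<And>f t. smooth f \<Longrightarrow>
      cmod (nderiv j (\<lambda>t. f t * g t) t) \<le> C1 * (\<Sum>i\<le>j. cmod (nderiv i f t))"
    using Suc.IH[OF Suc.prems] by blast
  have "smooth (nderiv 1 g)" "\<And>i. \<exists>C. \<forall>t. cmod (nderiv i (nderiv 1 g) t) \<le> C"
    using Suc.prems by (auto simp: smooth_nderiv nderiv_nderiv)
  from Suc.IH[OF this] obtain C2 where C2: "C2 \<ge> 0" "\<And>f t. smooth f \<Longrightarrow>
      cmod (nderiv j (\<lambda>t. f t * nderiv 1 g t) t) \<le> C2 * (\<Sum>i\<le>j. cmod (nderiv i f t))"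
    by blast
  show ?case
  proof (intro exI[of _ "C1 + C2"] conjI allI impI)
    fix f t assume f: "smooth f"
    let ?s = "\<Sum>i\<le>Suc j. cmod (nderiv i f t)"
    have "cmod (nderiv (Suc j) (\<lambda>t. f t * g t) t) \<le>
      cmod (nderiv j (\<lambda>t. f t * nderiv 1 g t) t) + cmod (nderiv j (\<lambda>t. nderiv 1 f t * g t) t)"
      unfolding nderiv_Suc_mult[OF f Suc.prems(1)] by (rule norm_triangle_ineq)
    also have "\<dots> \<le> C2 * (\<Sum>i\<le>j. cmod (nderiv i f t)) + C1 * (\<Sum>i\<le>j. cmod (nderiv i (nderiv 1 f) t))"
      by (intro add_mono C1 C2 f smooth_nderiv)
    also have "\<dots> \<le> C2 * ?s + C1 * ?s"
    proof (intro add_mono mult_left_mono C1 C2)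
      show "(\<Sum>i\<le>j. cmod (nderiv i (nderiv 1 f) t)) \<le> ?s"
        by (subst sum.atMost_Suc_shift) (simp add: nderiv_nderiv)
    qed simp
    finally show "cmod (nderiv (Suc j) (\<lambda>t. f t * g t) t) \<le> (C1 + C2) * ?s"
      by (simp add: algebra_simps)
  qed (use C1 C2 in simp)
qed

lemma nderiv_eq_0:
  assumes "smooth f" "closed K" "\<And>t. t \<notin> K \<Longrightarrow> f t = 0" "t \<notin> K"
  shows "nderiv j f t = 0"
  using assms(4)
proof (induction j arbitrary: t)
  case (Suc j)
  have "(nderiv j f has_vector_derivative 0) (at t)"
    by (rule has_vector_derivative_transform_within_open[of "\<lambda>_. 0" _ _ "- K"])
      (use Suc assms(2) in auto)
  then show ?case
    using smooth_has_vector_derivative[OF assms(1)] vector_derivative_unique_at by blast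
qed (simp add: assms)

text \<open>The majorant \<open>c l\<close> is required only for orders up to \<open>l\<close>. For
  a fixed order \<open>j\<close> this misses finitely many terms, which do not affect convergence,
  and it is exactly what the gliding hump argument provides.\<close>

lemma
  assumes f: "\<And>l. smooth (f l)" and c: "summable c"
    and le: "\<And>l j t. j \<le> l \<Longrightarrow> cmod (nderiv j (f l) t) \<le> c l"
  shows smooth_suminf: "smooth (\<lambda>t. \<Sum>l. f l t)"
    and uniform_limit_nderiv_suminf: "uniform_limit UNIV (\<lambda>n. nderiv j (\<lambda>t. \<Sum>l<n. f l t))
      (nderiv j (\<lambda>t. \<Sum>l. f l t)) sequentially"
proof -
  define F where "F = (\<lambda>j t. \<Sum>l. nderiv j (f l) t)"
  have lim: "uniform_limit UNIV (\<lambda>n t. \<Sum>l<n. nderiv j (f l) t) (F j) sequentially" for j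
    unfolding F_def
    by (rule Weierstrass_m_test_ev[OF _ c]) (use le in \<open>auto intro!: eventually_sequentiallyI[of j]\<close>)
  have F: "(F j has_vector_derivative F (Suc j) t) (at t)" for j t
  proof -
    have "\<exists>g. \<forall>x\<in>UNIV. (\<lambda>n. \<Sum>l<n. nderiv j (f l) x) \<longlonglongrightarrow> g x \<and>
        (g has_derivative (\<lambda>h. h *\<^sub>R F (Suc j) x)) (at x within UNIV)"
    proof (rule has_derivative_sequence[where ?x0.0 = 0])
      show "((\<lambda>t. \<Sum>l<n. nderiv j (f l) t) has_derivative
          (\<lambda>h. h *\<^sub>R (\<Sum>l<n. nderiv (Suc j) (f l) x))) (at x within UNIV)" for n x
        using has_vector_derivative_sum[of "{..<n}" "\<lambda>l. nderiv j (f l)" "\<lambda>l. nderiv (Suc j) (f l) x"]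
          smooth_has_vector_derivative[OF f]
        by (simp add: has_vector_derivative_def)
      show "\<forall>\<^sub>F n in sequentially. \<forall>x\<in>UNIV. \<forall>h. norm (h *\<^sub>R (\<Sum>l<n. nderiv (Suc j) (f l) x)
          - h *\<^sub>R F (Suc j) x) \<le> e * norm h" if "e > 0" for e
        using uniform_limitD[OF lim that, of "Suc j"]
      proof eventually_elim
        case (elim n)
        show ?case
        proof (intro ballI allI)
          fix x h :: real
          have "norm (h *\<^sub>R (\<Sum>l<n. nderiv (Suc j) (f l) x) - h *\<^sub>R F (Suc j) x)
              = dist (\<Sum>l<n. nderiv (Suc j) (f l) x) (F (Suc j) x) * norm h"
            unfolding scaleR_diff_right[symmetric] norm_scaleR dist_norm real_norm_def
            by (rule mult.commute)
          also have "\<dots> \<le> e * norm h"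
          proof (rule mult_right_mono)
            have "dist (\<Sum>l<n. nderiv (Suc j) (f l) x) (F (Suc j) x) < e"
              using elim by blast
            then show "dist (\<Sum>l<n. nderiv (Suc j) (f l) x) (F (Suc j) x) \<le> e" by linarith
          qed (rule norm_ge_zero)
          finally show "norm (h *\<^sub>R (\<Sum>l<n. nderiv (Suc j) (f l) x) - h *\<^sub>R F (Suc j) x) \<le> e * norm h" .
        qed
      qed
      show "(\<lambda>n. \<Sum>l<n. nderiv j (f l) 0) \<longlonglongrightarrow> F j 0"
        by (rule tendsto_uniform_limitI[OF lim]) simp
    qed simp_all
    then obtain g where g: "\<And>x. (\<lambda>n. \<Sum>l<n. nderiv j (f l) x) \<longlonglongrightarrow> g x"
      "\<And>x. (g has_derivative (\<lambda>h. h *\<^sub>R F (Suc j) x)) (at x)" by blast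
    have "g x = F j x" for x
      by (rule LIMSEQ_unique[OF g(1) tendsto_uniform_limitI[OF lim]]) simp
    then have "g = F j" by (rule ext)
    with g(2) show ?thesis by (simp add: has_vector_derivative_def)
  qed
  from smooth_family[of F, OF F] show "smooth (\<lambda>t. \<Sum>l. f l t)"
    by (simp add: F_def)
  have eq: "nderiv j (\<lambda>t. \<Sum>l. f l t) = F j"
    using nderiv_family[of F, OF F] by (simp add: F_def)
  show "uniform_limit UNIV (\<lambda>n. nderiv j (\<lambda>t. \<Sum>l<n. f l t)) (nderiv j (\<lambda>t. \<Sum>l. f l t)) sequentially"
    unfolding eq using lim[of j] by (simp add: nderiv_sum f)
qed

section \<open>Characters, a bump function and a smooth step\<close>

lemma has_vector_derivative_cis:
  "((\<lambda>t. cis (w * t)) has_vector_derivative (\<i> * of_real w) * cis (w * t)) (at t)"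
proof -
  have "((\<lambda>t. exp (\<i> * (of_real w * t))) has_field_derivative
      (\<i> * of_real w) * exp (\<i> * (of_real w * of_real t))) (at (of_real t))"
    by (auto intro!: derivative_eq_intros)
  from has_vector_derivative_real_field[OF this] show ?thesis
    by (simp add: cis_conv_exp)
qed

lemma smooth_character: "smooth (\<lambda>t. cis (w * t))"
proof -
  define F where "F = (\<lambda>j t. (\<i> * of_real w) ^ j * cis (w * t))"
  have F: "(F j has_vector_derivative F (Suc j) t) (at t)" for j t
    using has_vector_derivative_mult_right[OF has_vector_derivative_cis, of "(\<i> * of_real w) ^ j" w t]
    by (simp add: F_def mult_ac)
  from smooth_family[of F, OF F] show ?thesis by (simp add: F_def)
qed

text \<open>The flat function exp(-1/t), multiplied by a polynomial in 1/t so that the family is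
  closed under differentiation: a derivative replaces \<open>p\<close> by
  \<open>(p - pderiv p) * [:0, 0, 1:]\<close>.\<close>

definition exp_step :: "real poly \<Rightarrow> real \<Rightarrow> real" where
  "exp_step p t = (if t > 0 then poly p (1 / t) * exp (- 1 / t) else 0)"

lemma tendsto_exp_step: "(exp_step p \<longlongrightarrow> 0) (at 0)"
proof -
  have "((\<lambda>t. poly p (inverse t) * exp (- inverse t)) \<longlongrightarrow> 0) (at_right 0)"
  proof (rule filterlim_compose[OF _ filterlim_inverse_at_top_right, of "\<lambda>s. poly p s * exp (- s)"])
    have "((\<lambda>s. \<Sum>i\<le>degree p. coeff p i * (s ^ i / exp s)) \<longlongrightarrow> (\<Sum>i\<le>degree p. coeff p i * 0)) at_top"
      by (intro tendsto_sum tendsto_mult tendsto_const tendsto_power_div_exp_0)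
    then show "((\<lambda>s. poly p s * exp (- s)) \<longlongrightarrow> 0) at_top"
      by (simp add: poly_altdef exp_minus sum_distrib_right divide_inverse mult.assoc)
  qed
  then have right: "(exp_step p \<longlongrightarrow> 0) (at_right 0)"
    by (rule Lim_transform_eventually)
      (auto simp: eventually_at_filter exp_step_def divide_inverse)
  have left: "(exp_step p \<longlongrightarrow> 0) (at_left 0)"
    by (rule Lim_transform_eventually[OF tendsto_const])
      (auto simp: eventually_at_filter exp_step_def)
  from left right show ?thesis by (rule filterlim_split_at)
qed

lemma has_real_derivative_exp_step:
  "(exp_step p has_real_derivative exp_step ((p - pderiv p) * [:0, 0, 1:]) t) (at t)"
proof -
  consider "t > 0" | "t < 0" | "t = 0" by linarith
  then show ?thesis
  proof cases
    case 1
    have "((\<lambda>t. poly p (1 / t) * exp (- 1 / t)) has_real_derivative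
       exp_step ((p - pderiv p) * [:0, 0, 1:]) t) (at t)"
      using 1 by (auto intro!: derivative_eq_intros simp: exp_step_def field_simps)
    then show ?thesis
      by (rule has_field_derivative_transform_within_open[of _ _ _ "{0<..}"])
        (use 1 in \<open>auto simp: exp_step_def\<close>)
  next
    case 2
    have "((\<lambda>t. 0) has_real_derivative exp_step ((p - pderiv p) * [:0, 0, 1:]) t) (at t)"
      using 2 by (auto simp: exp_step_def)
    then show ?thesis
      by (rule has_field_derivative_transform_within_open[of _ _ _ "{..<0}"])
        (use 2 in \<open>auto simp: exp_step_def\<close>)
  next
    case 3
    \<comment> \<open>The difference quotient at 0 belongs to the family again, with one more factor
      1/t, so the common limit 0 of all members settles the derivative there. At
      \<open>t = 0\<close> both sides are 0, division by 0 being 0.\<close>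
    have "(\<lambda>t. (exp_step p t - exp_step p 0) / (t - 0)) = exp_step (p * [:0, 1:])"
      by (auto simp: exp_step_def)
    with tendsto_exp_step[of "p * [:0, 1:]"] 3 show ?thesis
      by (simp add: has_field_derivative_iff exp_step_def)
  qed
qed

lemma smooth_exp_step: "smooth (\<lambda>t. of_real (exp_step p t))"
proof (rule smooth_coinduct[of "\<lambda>f. \<exists>p. f = (\<lambda>t. of_real (exp_step p t))"])
  fix f :: "real \<Rightarrow> complex" assume "\<exists>p. f = (\<lambda>t. of_real (exp_step p t))"
  then obtain p where p: "f = (\<lambda>t. of_real (exp_step p t))" by blast
  have "((\<lambda>t. of_real (exp_step p t) :: complex) has_vector_derivative
      of_real (exp_step ((p - pderiv p) * [:0, 0, 1:]) t)) (at t)" for t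
    by (rule has_vector_derivative_of_real)
      (rule has_real_derivative_exp_step)
  with p show "\<exists>g. (\<exists>p. g = (\<lambda>t. of_real (exp_step p t))) \<and> (\<forall>t. (f has_vector_derivative g t) (at t))"
    by blast
qed blast

definition bump :: "real \<Rightarrow> real" where
  "bump t = exp_step 1 t * exp_step 1 (1 - t)"

lemma smooth_bump: "smooth (\<lambda>t. of_real (bump t))"
  using smooth_mult[OF smooth_exp_step smooth_reflect[OF smooth_exp_step, of 1], of 1 1]
  by (simp add: bump_def)

lemma bump_nonneg: "0 \<le> bump t"
  and bump_pos: "0 < t \<Longrightarrow> t < 1 \<Longrightarrow> 0 < bump t"
  and bump_eq_0: "t \<notin> {0<..<1} \<Longrightarrow> bump t = 0"
  by (auto simp: bump_def exp_step_def)

lemma continuous_on_bump: "continuous_on A bump"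
proof -
  have "continuous_on A (\<lambda>t. Re (of_real (bump t)))"
    using smooth_continuous_on[OF smooth_bump, of A 0] by (intro continuous_on_Re) simp
  then show ?thesis by simp
qed

lemma integral_bump_pos: "integral {0..1} bump > 0"
proof -
  have "integral {0..1} bump \<noteq> 0"
  proof
    assume "integral {0..1} bump = 0"
    moreover have "bump integrable_on {0..1}"
      by (rule integrable_continuous_real[OF continuous_on_bump])
    ultimately have "(bump has_integral 0) (cbox 0 1)"
      by (metis has_integral_integral box_real(2))
    from has_integral_0_cbox_imp_0[OF continuous_on_bump _ this, of "1/2"] bump_pos[of "1/2"]
    show False by (auto simp: bump_nonneg)
  qed
  moreover have "integral {0..1} bump \<ge> 0"
    by (intro integral_nonneg integrable_continuous_real continuous_on_bump bump_nonneg)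
  ultimately show ?thesis by simp
qed

lemma ex_smooth_step:
  "\<exists>\<theta>. smooth \<theta> \<and> (\<forall>t\<le>0. \<theta> t = 0) \<and> (\<forall>t\<ge>1. \<theta> t = 1)"
proof -
  define B where "B = integral {0..1} bump"
  \<comment> \<open>The lower limit lies to the left of both \<open>t\<close> and 0; as
    \<open>bump\<close> vanishes on the negative axis, one formula gives the normalised primitive
    for every real \<open>t\<close>.\<close>
  define \<theta> where "\<theta> t = complex_of_real (integral {- \<bar>t\<bar> - 1..t} bump / B)" for t
  have int: "bump integrable_on {a..b}" for a b
    by (rule integrable_continuous_real[OF continuous_on_bump])
  have int0: "integral {a..b} bump = 0" if "b \<le> 0 \<or> 1 \<le> a" for a b
  proof -
    have "integral {a..b} bump = integral {a..b} (\<lambda>_. 0)"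
      by (rule Henstock_Kurzweil_Integration.integral_cong) (use that in \<open>auto intro!: bump_eq_0\<close>)
    then show ?thesis by simp
  qed
  have \<theta>: "\<theta> t = of_real (integral {a..t} bump / B)" if "a \<le> t" "a \<le> 0" for a t
  proof -
    have *: "integral {c..t} bump = integral {min 0 t..t} bump" if "c \<le> t" "c \<le> 0" for c
    proof -
      have "integral {c..min 0 t} bump = 0" by (rule int0) simp
      moreover have "integral {c..min 0 t} bump + integral {min 0 t..t} bump = integral {c..t} bump"
        by (rule Henstock_Kurzweil_Integration.integral_combine) (use that int in auto)
      ultimately show ?thesis by linarith
    qed
    have "integral {a..t} bump = integral {min 0 t..t} bump"
      by (rule *) (use that in auto)
    also have "\<dots> = integral {- \<bar>t\<bar> - 1..t} bump"
      by (rule *[symmetric]) auto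
    finally have "integral {a..t} bump = integral {- \<bar>t\<bar> - 1..t} bump" .
    then show ?thesis
      unfolding \<theta>_def by (simp only:)
  qed
  \<comment> \<open>Only the passage from index 0 to index 1 needs the fundamental theorem of
    calculus; from there on the members are derivatives of the normalised bump.\<close>
  define F where "F = (\<lambda>j. case j of 0 \<Rightarrow> \<theta> | Suc i \<Rightarrow> nderiv i (\<lambda>t. of_real (1 / B) * of_real (bump t)))"
  have sm: "smooth (\<lambda>t. of_real (1 / B) * of_real (bump t))"
    by (intro smooth_cmult smooth_bump)
  have F: "(F j has_vector_derivative F (Suc j) t) (at t)" for j t
  proof (cases j)
    case 0
    let ?a = "- \<bar>t\<bar> - 1"
    have "((\<lambda>u. integral {?a..u} bump) has_vector_derivative bump t) (at t within {?a..t + 1})"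
      by (rule integral_has_vector_derivative[OF continuous_on_bump]) auto
    then have "((\<lambda>u. integral {?a..u} bump) has_vector_derivative bump t) (at t)"
      by (subst (asm) at_within_interior) auto
    then have "((\<lambda>u. integral {?a..u} bump / B) has_real_derivative bump t / B) (at t)"
      unfolding has_real_derivative_iff_has_vector_derivative divide_inverse
      by (rule has_vector_derivative_mult_left)
    from has_vector_derivative_of_real[OF this]
    moreover have "F 1 t = of_real (bump t / B)" by (simp add: F_def)
    ultimately have "((\<lambda>u. of_real (integral {?a..u} bump / B)) has_vector_derivative F 1 t) (at t)"
      by (simp only:)
    then have "(\<theta> has_vector_derivative F 1 t) (at t)"
      by (rule has_vector_derivative_transform_within_open[of _ _ _ "{?a<..}"])
        (use \<theta>[symmetric, of ?a] in auto)
    with 0 show ?thesis by (simp add: F_def)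
  qed (use smooth_has_vector_derivative[OF sm] in \<open>simp add: F_def\<close>)
  have "F 0 = \<theta>" by (simp add: F_def)
  with smooth_family[of F, OF F] have "smooth \<theta>" by (simp only:)
  moreover have "\<theta> t = 0" if "t \<le> 0" for t
    using \<theta>[of t t] that int0[of t t] by simp
  moreover have "\<theta> t = 1" if "t \<ge> 1" for t
  proof -
    have "integral {0..1} bump + integral {1..t} bump = integral {0..t} bump"
      by (rule Henstock_Kurzweil_Integration.integral_combine) (use that int in auto)
    moreover have "integral {1..t} bump = 0" by (rule int0) simp
    ultimately have "integral {0..t} bump = B" unfolding B_def by linarith
    moreover have "B \<noteq> 0" using integral_bump_pos unfolding B_def by linarith
    moreover have "\<theta> t = of_real (integral {0..t} bump / B)" by (rule \<theta>) (use that in auto)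
    ultimately show ?thesis by simp
  qed
  ultimately show ?thesis by (intro exI[of _ \<theta>]) auto
qed

subsection \<open>Integrable functions on the line\<close>

definition N1 :: "(real \<Rightarrow> complex) \<Rightarrow> real" where
  "N1 f = (LINT t|lborel. cmod (f t))"

definition conv :: "(real \<Rightarrow> complex) \<Rightarrow> (real \<Rightarrow> complex) \<Rightarrow> real \<Rightarrow> complex" where
  "conv f g t = (LINT r|lborel. f (t - r) * g r)"

lemma N1_nonneg: "0 \<le> N1 f"
  by (simp add: N1_def)

lemma
  fixes f :: "real \<Rightarrow> 'b::{banach, second_countable_topology}"
  assumes "integrable lborel f"
  shows integrable_shift: "integrable lborel (\<lambda>t. f (t + a))"
    and integrable_reflect: "integrable lborel (\<lambda>t. f (a - t))"
  using lborel_integrable_real_affine[OF assms, of 1 a] lborel_integrable_real_affine[OF assms, of "- 1" a]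
  by (simp_all add: add.commute)

lemma
  fixes f :: "real \<Rightarrow> 'b::{banach, second_countable_topology}"
  shows integral_shift: "(LINT t|lborel. f (t + a)) = (LINT t|lborel. f t)"
    and integral_reflect: "(LINT t|lborel. f (a - t)) = (LINT t|lborel. f t)"
  using lborel_integral_real_affine[of 1 f a] lborel_integral_real_affine[of "- 1" f a]
  by (simp_all add: add.commute)

lemma N1_shift [simp]: "N1 (\<lambda>t. f (t + a)) = N1 f"
  and N1_shift_minus [simp]: "N1 (\<lambda>t. f (t - a)) = N1 f"
  and N1_reflect [simp]: "N1 (\<lambda>t. f (a - t)) = N1 f"
  using integral_shift[of "\<lambda>t. cmod (f t)" a] integral_shift[of "\<lambda>t. cmod (f t)" "- a"]
    integral_reflect[of "\<lambda>t. cmod (f t)" a]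
  by (simp_all add: N1_def)

lemma N1_cmult [simp]: "N1 (\<lambda>t. c * f t) = cmod c * N1 f"
  by (simp add: N1_def norm_mult)

lemma N1_diff:
  assumes "integrable lborel f" "integrable lborel g"
  shows "N1 (\<lambda>t. f t - g t) \<le> N1 f + N1 g"
proof -
  have "N1 (\<lambda>t. f t - g t) \<le> (LINT t|lborel. cmod (f t) + cmod (g t))"
    unfolding N1_def using assms by (intro integral_mono norm_triangle_ineq4) auto
  then show ?thesis using assms by (simp add: N1_def)
qed

text \<open>Minkowski's inequality for integrals, with the Fubini exchange behind it. Dominating the
  L1 norms of the slices by \<open>h\<close> yields joint integrability. Young's inequality,
  translation moduli, Riemann sums and approximate identities below are all instances.\<close>

lemma
  assumes meas [measurable]: "(\<lambda>(r, t). k r t) \<in> borel_measurable (borel \<Otimes>\<^sub>M borel)"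
    and k: "\<And>r. integrable lborel (k r)"
    and h: "integrable lborel h" "\<And>r. N1 (k r) \<le> h r"
  shows kernel_integral_integrable: "integrable lborel (\<lambda>t. LINT r|lborel. k r t)"
    and kernel_Fubini: "(LINT t|lborel. LINT r|lborel. k r t) = (LINT r|lborel. LINT t|lborel. k r t)"
    and kernel_minkowski: "N1 (\<lambda>t. LINT r|lborel. k r t) \<le> (LINT r|lborel. N1 (k r))"
proof -
  have [measurable]: "(\<lambda>r. N1 (k r)) \<in> borel_measurable borel"
    unfolding N1_def by measurable
  have N: "integrable lborel (\<lambda>r. N1 (k r))"
    by (rule Bochner_Integration.integrable_bound[OF h(1)])
      (auto intro!: AE_I2 order_trans[OF h(2)] simp: N1_nonneg)
  have int: "integrable (lborel \<Otimes>\<^sub>M lborel) (\<lambda>(r, t). k r t)"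
  proof (rule lborel_pair.Fubini_integrable)
    show "integrable lborel (\<lambda>x. LINT y|lborel. norm (case (x, y) of (r, t) \<Rightarrow> k r t))"
      using N by (simp add: N1_def)
  qed (use k in \<open>auto intro!: AE_I2\<close>)
  then show int1: "integrable lborel (\<lambda>t. LINT r|lborel. k r t)"
    by (rule lborel_pair.integrable_snd)
  show "(LINT t|lborel. LINT r|lborel. k r t) = (LINT r|lborel. LINT t|lborel. k r t)"
    by (rule lborel_pair.Fubini_integral[OF int])
  have norm_int: "integrable (lborel \<Otimes>\<^sub>M lborel) (\<lambda>(r, t). cmod (k r t))"
    using Bochner_Integration.integrable_norm[OF int] by (simp add: case_prod_unfold)
  have "N1 (\<lambda>t. LINT r|lborel. k r t) \<le> (LINT t|lborel. LINT r|lborel. cmod (k r t))"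
    unfolding N1_def
    by (intro integral_mono integral_norm_bound integrable_norm int1
        lborel_pair.integrable_snd[OF norm_int])
  also have "\<dots> = (LINT r|lborel. N1 (k r))"
    unfolding N1_def by (rule lborel_pair.Fubini_integral[OF norm_int])
  finally show "N1 (\<lambda>t. LINT r|lborel. k r t) \<le> (LINT r|lborel. N1 (k r))" .
qed

lemma
  assumes f: "integrable lborel f" and g: "integrable lborel g"
  shows conv_integrable: "integrable lborel (conv f g)"
    and N1_conv: "N1 (conv f g) \<le> N1 f * N1 g"
    and fourier_conv: "fourier (conv f g) w = fourier f w * fourier g w"
proof -
  have [measurable]: "f \<in> borel_measurable borel" "g \<in> borel_measurable borel"
    using f g by auto
  have meas: "(\<lambda>(r, t). f (t - r) * g r) \<in> borel_measurable (borel \<Otimes>\<^sub>M borel)"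
    by measurable
  have f': "integrable lborel (\<lambda>t. f (t - r))" for r
    using integrable_shift[OF f, of "- r"] by simp
  have k: "integrable lborel (\<lambda>t. f (t - r) * g r)" for r
    using f' by simp
  have h: "integrable lborel (\<lambda>r. N1 f * cmod (g r))" using g by simp
  have N: "N1 (\<lambda>t. f (t - r) * g r) = N1 f * cmod (g r)" for r
    using N1_cmult[of "g r" "\<lambda>t. f (t - r)"] by (simp add: mult.commute)
  have conv: "conv f g = (\<lambda>t. LINT r|lborel. f (t - r) * g r)"
    by (simp add: conv_def fun_eq_iff)
  show "integrable lborel (conv f g)"
    unfolding conv by (rule kernel_integral_integrable[OF meas k h]) (simp add: N)
  have "N1 (conv f g) \<le> (LINT r|lborel. N1 (\<lambda>t. f (t - r) * g r))"
    unfolding conv by (rule kernel_minkowski[OF meas k h]) (simp add: N)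
  then show "N1 (conv f g) \<le> N1 f * N1 g" by (simp add: N N1_def[of g])
  have cis_meas: "(\<lambda>t. cis (- (w * t))) \<in> borel_measurable borel"
    by (intro borel_measurable_continuous_onI continuous_intros)
  note [measurable] = cis_meas
  have int_cis: "integrable lborel (\<lambda>t. cis (- (w * t)) * f t)" if "integrable lborel f" for f
    by (rule Bochner_Integration.integrable_bound[OF that]) (use that in \<open>auto simp: norm_mult\<close>)
  have "fourier (conv f g) w = (LINT t|lborel. LINT r|lborel. cis (- (w * t)) * (f (t - r) * g r))"
    by (simp add: fourier_def conv)
  also have "\<dots> = (LINT r|lborel. LINT t|lborel. cis (- (w * t)) * (f (t - r) * g r))"
  proof (rule kernel_Fubini[OF _ _ h])
    show "(\<lambda>(r, t). cis (- (w * t)) * (f (t - r) * g r)) \<in> borel_measurable (borel \<Otimes>\<^sub>M borel)"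
      by measurable
    show "integrable lborel (\<lambda>t. cis (- (w * t)) * (f (t - r) * g r))" for r
      by (rule int_cis[OF k])
    show "N1 (\<lambda>t. cis (- (w * t)) * (f (t - r) * g r)) \<le> N1 f * cmod (g r)" for r
    proof -
      have "N1 (\<lambda>t. cis (- (w * t)) * (f (t - r) * g r)) = N1 (\<lambda>t. f (t - r) * g r)"
        by (simp add: N1_def norm_mult)
      then show ?thesis by (simp add: N)
    qed
  qed
  also have "\<dots> = (LINT r|lborel. fourier f w * (cis (- (w * r)) * g r))"
  proof (intro Bochner_Integration.integral_cong refl)
    fix r
    have "(LINT t|lborel. cis (- (w * t)) * (f (t - r) * g r)) =
        (LINT t|lborel. cis (- (w * (t + r))) * (f (t + r - r) * g r))"
      by (rule integral_shift[symmetric])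
    also have "\<dots> = (LINT t|lborel. (cis (- (w * t)) * f t) * (cis (- (w * r)) * g r))"
    proof (intro Bochner_Integration.integral_cong refl)
      fix t
      have "cis (- (w * (t + r))) = cis (- (w * t)) * cis (- (w * r))"
        by (simp add: cis_mult algebra_simps)
      then show "cis (- (w * (t + r))) * (f (t + r - r) * g r) =
          (cis (- (w * t)) * f t) * (cis (- (w * r)) * g r)"
        by simp
    qed
    also have "\<dots> = fourier f w * (cis (- (w * r)) * g r)"
      by (simp add: fourier_def)
    finally show "(LINT t|lborel. cis (- (w * t)) * (f (t - r) * g r)) =
        fourier f w * (cis (- (w * r)) * g r)" .
  qed
  finally show "fourier (conv f g) w = fourier f w * fourier g w"
    by (simp add: fourier_def[of g])
qed

lemma cis_borel_measurable [measurable]: "(\<lambda>t. cis (a * t)) \<in> borel_measurable borel"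
  by (intro borel_measurable_continuous_onI continuous_intros)

lemma integrable_cis_mult:
  assumes "integrable lborel f"
  shows "integrable lborel (\<lambda>t. cis (a * t) * f t)"
proof (rule Bochner_Integration.integrable_bound[OF assms])
  have [measurable]: "f \<in> borel_measurable borel" using assms by auto
  show "(\<lambda>t. cis (a * t) * f t) \<in> borel_measurable lborel" by measurable
qed (simp add: norm_mult)

lemma integrable_fourier: "integrable lborel f \<Longrightarrow> integrable lborel (\<lambda>t. cis (- (w * t)) * f t)"
  using integrable_cis_mult[of f "- w"] by simp

lemma fourier_shift: "fourier (\<lambda>t. f (t + a)) w = cis (w * a) * fourier f w"
proof -
  have "fourier (\<lambda>t. f (t + a)) w = (LINT t|lborel. cis (w * a) * (cis (- (w * (t + a))) * f (t + a)))"
    unfolding fourier_def mult.assoc[symmetric] cis_mult by (simp add: algebra_simps)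
  also have "\<dots> = cis (w * a) * (LINT t|lborel. cis (- (w * (t + a))) * f (t + a))" by simp
  also have "(LINT t|lborel. cis (- (w * (t + a))) * f (t + a)) = fourier f w"
    unfolding fourier_def by (rule integral_shift)
  finally show ?thesis .
qed

lemma fourier_modulate: "fourier (\<lambda>t. cis (v * t) * f t) w = fourier f (w - v)"
  unfolding fourier_def mult.assoc[symmetric] cis_mult by (simp add: algebra_simps)

lemma fourier_cmult: "fourier (\<lambda>t. c * f t) w = c * fourier f w"
  by (simp add: fourier_def mult.left_commute)

lemma fourier_diff:
  "integrable lborel f \<Longrightarrow> integrable lborel g \<Longrightarrow> fourier (\<lambda>t. f t - g t) w = fourier f w - fourier g w"
  by (simp add: fourier_def right_diff_distrib integrable_fourier)

lemma isCont_fourier: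
  assumes "integrable lborel f"
  shows "isCont (fourier f) w"
  unfolding continuous_at_sequentially
proof (intro allI impI)
  fix x assume x: "x \<longlonglongrightarrow> w"
  have [measurable]: "f \<in> borel_measurable borel" using assms by auto
  have [measurable]: "(\<lambda>t. cis (- (a * t))) \<in> borel_measurable borel" for a
    by (intro borel_measurable_continuous_onI continuous_intros)
  show "(fourier f \<circ> x) \<longlonglongrightarrow> fourier f w"
    unfolding fourier_def o_def
  proof (rule integral_dominated_convergence[where w = "\<lambda>t. cmod (f t)"])
    show "AE t in lborel. (\<lambda>n. cis (- (x n * t)) * f t) \<longlonglongrightarrow> cis (- (w * t)) * f t"
    proof (intro AE_I2 tendsto_mult tendsto_const)
      fix t
      show "(\<lambda>n. cis (- (x n * t))) \<longlonglongrightarrow> cis (- (w * t))"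
        unfolding cis_conv_exp by (intro tendsto_intros x)
    qed
  qed (use assms in \<open>auto simp: norm_mult\<close>)
qed

subsection \<open>The space \<open>DL1\<close>\<close>

lemma DL1_smooth: "f \<in> DL1 \<Longrightarrow> smooth f"
  and DL1_nderiv_integrable: "f \<in> DL1 \<Longrightarrow> integrable lborel (nderiv j f)"
  by (auto simp: DL1_def)

lemma DL1_integrable: "f \<in> DL1 \<Longrightarrow> integrable lborel f"
  using DL1_nderiv_integrable[of f 0] by simp

lemma DL1_nderiv: "f \<in> DL1 \<Longrightarrow> nderiv j f \<in> DL1"
  by (auto simp: DL1_def smooth_nderiv nderiv_nderiv)

lemma DL1_zero: "(\<lambda>_. 0) \<in> DL1"
  by (auto simp: DL1_def smooth_zero nderiv_zero)

lemma DL1_add: "f \<in> DL1 \<Longrightarrow> g \<in> DL1 \<Longrightarrow> (\<lambda>t. f t + g t) \<in> DL1"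
  by (auto simp: DL1_def smooth_add nderiv_add)

lemma DL1_diff: "f \<in> DL1 \<Longrightarrow> g \<in> DL1 \<Longrightarrow> (\<lambda>t. f t - g t) \<in> DL1"
  by (auto simp: DL1_def smooth_diff nderiv_diff)

lemma DL1_cmult: "f \<in> DL1 \<Longrightarrow> (\<lambda>t. c * f t) \<in> DL1"
  by (auto simp: DL1_def smooth_cmult nderiv_cmult)

lemma DL1_shift: "f \<in> DL1 \<Longrightarrow> (\<lambda>t. f (t + a)) \<in> DL1"
  by (auto simp: DL1_def smooth_shift nderiv_shift integrable_shift)

lemma DL1_reflect: "f \<in> DL1 \<Longrightarrow> (\<lambda>t. f (a - t)) \<in> DL1"
  by (auto simp: DL1_def smooth_reflect nderiv_reflect integrable_reflect)

lemma DL1_null_iff: "DL1_null \<Phi> \<longleftrightarrow> (\<forall>j. (\<lambda>k. N1 (nderiv j (\<Phi> k))) \<longlonglongrightarrow> 0)"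
  by (simp add: DL1_null_def N1_def)

section \<open>Pointwise bounds and translation moduli from L1 norms of derivatives\<close>

lemma smooth_FTC:
  assumes "smooth f" "a \<le> b"
  shows "(LINT x|lborel. indicator {a..b} x *\<^sub>R nderiv 1 f x) = f b - f a"
  by (rule integral_FTC_Icc)
    (use assms in \<open>auto intro: smooth_continuous_on has_vector_derivative_at_within
        smooth_has_vector_derivative_1[unfolded One_nat_def]\<close>)

lemma smooth_set_integrable:
  assumes "smooth f"
  shows "integrable lborel (\<lambda>x. indicator {a..b} x * cmod (nderiv j f x))"
proof -
  have "set_integrable lborel {a..b} (\<lambda>x. cmod (nderiv j f x))"
    by (rule borel_integrable_atLeastAtMost')
      (intro continuous_intros smooth_continuous_on assms)
  then show ?thesis by (simp add: set_integrable_def)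
qed

text \<open>The one-dimensional Sobolev inequality: \<open>f t\<close> differs from any nearby value
  \<open>f s\<close> by at most the integral of the derivative, and averaging over \<open>s\<close>
  removes the point value. It is kept local so that it can be summed over unit pieces of the
  line.\<close>

lemma sobolev_local:
  assumes f: "smooth f" and t: "\<bar>t - a\<bar> \<le> 1"
  shows "cmod (f t) \<le> (LINT x|lborel. indicator {a-1..a+1} x * cmod (f x))
    + (LINT x|lborel. indicator {a-1..a+1} x * cmod (nderiv 1 f x))"
proof -
  define D where "D = (LINT x|lborel. indicator {a-1..a+1} x * cmod (nderiv 1 f x))"
  have int: "integrable lborel (\<lambda>x. indicator {a-1..a+1} x * cmod (nderiv j f x))" for j
    by (rule smooth_set_integrable[OF f])
  have osc: "cmod (f u - f v) \<le> D" if "a - 1 \<le> v" "v \<le> u" "u \<le> a + 1" for u v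
  proof -
    have "f u - f v = (LINT x|lborel. indicator {v..u} x *\<^sub>R nderiv 1 f x)"
      using smooth_FTC[OF f] that by simp
    also have "cmod \<dots> \<le> (LINT x|lborel. norm (indicator {v..u} x *\<^sub>R nderiv 1 f x))"
      by (rule integral_norm_bound)
    also have "\<dots> \<le> D"
      unfolding D_def using that
      by (intro integral_mono' int) (auto split: split_indicator)
    finally show ?thesis .
  qed
  have le: "cmod (f t) \<le> cmod (f s) + D" if "s \<in> {a-1..a+1}" for s
  proof -
    have "cmod (f t - f s) \<le> D"
      using osc[of s t] osc[of t s] that t by (cases "s \<le> t") (auto simp: norm_minus_commute)
    then show ?thesis using norm_triangle_sub[of "f t" "f s"] by linarith
  qed
  \<comment> \<open>Integrate the pointwise estimate \<open>le\<close> in \<open>s\<close> over an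
    interval of length 2.\<close>
  have "(LINT x|lborel. indicator {a-1..a+1} x * cmod (f t)) \<le>
      (LINT x|lborel. indicator {a-1..a+1} x * cmod (f x) + indicator {a-1..a+1} x * D)"
    using int[of 0] le
    by (intro integral_mono) (auto split: split_indicator simp: borel_integrable_atLeastAtMost')
  also have "\<dots> = (LINT x|lborel. indicator {a-1..a+1} x * cmod (f x)) + 2 * D"
    using int[of 0] by (subst Bochner_Integration.integral_add) auto
  finally have "2 * cmod (f t) \<le> (LINT x|lborel. indicator {a-1..a+1} x * cmod (f x)) + 2 * D"
    by simp
  moreover have "0 \<le> (LINT x|lborel. indicator {a-1..a+1} x * cmod (f x))" by simp
  ultimately show ?thesis unfolding D_def[symmetric] by linarith
qed

lemma DL1_bound:
  assumes "f \<in> DL1"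
  shows "cmod (f t) \<le> N1 f + N1 (nderiv 1 f)"
proof -
  have "(LINT x|lborel. indicator {t-1..t+1} x * cmod (nderiv j f x)) \<le> N1 (nderiv j f)" for j
    unfolding N1_def
    by (intro integral_mono' integrable_norm DL1_nderiv_integrable assms)
      (auto split: split_indicator)
  from this[of 0] this[of 1] sobolev_local[OF DL1_smooth[OF assms], of t t]
  show ?thesis by simp
qed

text \<open>Write the increment as the integral over \<open>r\<close> in [0, 1] of \<open>a\<close>
  times the derivative at \<open>t + r * a\<close> and apply Minkowski. Applied to each derivative
  of \<open>f\<close>, it makes translation continuous in \<open>DL1\<close>.\<close>

lemma N1_difference:
  assumes f: "f \<in> DL1"
  shows "N1 (\<lambda>t. f (t + a) - f t) \<le> \<bar>a\<bar> * N1 (nderiv 1 f)"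
proof -
  let ?k = "\<lambda>r t. indicator {0..1} r *\<^sub>R (of_real a * nderiv 1 f (t + r * a))"
  have eq: "(\<lambda>t. f (t + a) - f t) = (\<lambda>t. LINT r|lborel. ?k r t)"
  proof
    fix t
    have g: "smooth (\<lambda>r. f (a * r + t))" by (rule smooth_affine) (rule DL1_smooth[OF f])
    have "nderiv 1 (\<lambda>r. f (a * r + t)) = (\<lambda>r. of_real a * nderiv 1 f (t + r * a))"
      using nderiv_affine[OF DL1_smooth[OF f], of 1 a t] by (simp add: algebra_simps)
    with smooth_FTC[OF g, of 0 1] show "f (t + a) - f t = (LINT r|lborel. ?k r t)"
      by (simp add: add.commute)
  qed
  have [measurable]: "nderiv 1 f \<in> borel_measurable borel"
    by (rule smooth_borel_measurable[OF DL1_smooth[OF f]])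
  have N: "N1 (?k r) = indicator {0..1} r * (\<bar>a\<bar> * N1 (nderiv 1 f))" for r
  proof -
    have "N1 (?k r) = cmod (indicator {0..1} r *\<^sub>R of_real a) * N1 (\<lambda>t. nderiv 1 f (t + r * a))"
      unfolding N1_cmult[symmetric] by simp
    then show ?thesis
      unfolding N1_shift by (simp split: split_indicator)
  qed
  have "N1 (\<lambda>t. f (t + a) - f t) \<le> (LINT r|lborel. N1 (?k r))"
    unfolding eq
  proof (rule kernel_minkowski)
    show "integrable lborel (\<lambda>r. indicator {0..1::real} r * (\<bar>a\<bar> * N1 (nderiv 1 f)))"
      by (intro integrable_mult_left integrable_real_indicator) auto
    show "integrable lborel (?k r)" for r
      by (intro integrable_scaleR_right integrable_mult_right integrable_shift DL1_nderiv_integrable f)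
    show "N1 (?k r) \<le> indicator {0..1} r * (\<bar>a\<bar> * N1 (nderiv 1 f))" for r
      by (rule eq_refl[OF N])
  qed measurable
  also have "\<dots> = \<bar>a\<bar> * N1 (nderiv 1 f)"
    unfolding N by simp
  finally show ?thesis .
qed

section \<open>Differentiation under a convolution integral\<close>

lemma has_vector_derivative_quadratic:
  fixes F :: "real \<Rightarrow> complex"
  assumes "\<And>a. cmod (F (t + a) - F t - of_real a * D) \<le> K * a\<^sup>2"
  shows "(F has_vector_derivative D) (at t)"
  unfolding has_vector_derivative_def has_derivative_at
proof
  show "bounded_linear (\<lambda>h. h *\<^sub>R D)" by (rule bounded_linear_scaleR_left)
  show "(\<lambda>h. norm (F (t + h) - F t - h *\<^sub>R D) / norm h) \<midarrow>0\<rightarrow> 0"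
  proof (rule Lim_null_comparison)
    show "\<forall>\<^sub>F h in at 0. norm (norm (F (t + h) - F t - h *\<^sub>R D) / norm h) \<le> K * \<bar>h\<bar>"
    proof (unfold eventually_at_filter, intro always_eventually allI impI)
      fix h :: real assume "h \<noteq> 0"
      moreover have "norm (F (t + h) - F t - h *\<^sub>R D) \<le> K * \<bar>h\<bar> * \<bar>h\<bar>"
        using assms[of h] by (simp add: scaleR_conv_of_real power2_eq_square mult.assoc)
      ultimately show "norm (norm (F (t + h) - F t - h *\<^sub>R D) / norm h) \<le> K * \<bar>h\<bar>"
        by (simp add: divide_le_eq)
    qed
    show "((\<lambda>h. K * \<bar>h\<bar>) \<longlongrightarrow> 0) (at 0)" by (auto intro!: tendsto_eq_intros)
  qed
qed

lemma onorm_scaleR_le: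
  assumes "norm x \<le> K"
  shows "onorm (\<lambda>h::real. h *\<^sub>R x) \<le> K"
proof (rule onorm_le)
  fix h :: real
  show "norm (h *\<^sub>R x) \<le> K * norm h"
    using mult_right_mono[OF assms norm_ge_zero[of h]] by (simp add: mult.commute)
qed

text \<open>The mean value inequality twice, first for the derivative, then for \<open>f\<close>
  minus its linear part at \<open>x\<close>. This loses a factor 2 against the optimal constant,
  which is harmless.\<close>

lemma smooth_taylor_bound:
  assumes f: "smooth f" and K: "\<And>t. cmod (nderiv 2 f t) \<le> K"
  shows "cmod (f (x + a) - f x - of_real a * nderiv 1 f x) \<le> K * a\<^sup>2"
proof -
  have d1: "cmod (nderiv 1 f y - nderiv 1 f x) \<le> K * \<bar>a\<bar>" if "y \<in> closed_segment x (x + a)" for y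
  proof -
    have "norm (nderiv 1 f y - nderiv 1 f x) \<le> K * norm (y - x)"
    proof (rule differentiable_bound[where S = UNIV])
      show "(nderiv 1 f has_derivative (\<lambda>h. h *\<^sub>R nderiv 2 f z)) (at z within UNIV)" for z
        using smooth_has_vector_derivative[OF f, of 1 z]
        by (simp add: has_vector_derivative_def numeral_2_eq_2)
      show "onorm (\<lambda>h. h *\<^sub>R nderiv 2 f z) \<le> K" for z
        by (rule onorm_scaleR_le[OF K])
    qed auto
    also have "\<dots> \<le> K * \<bar>a\<bar>"
      using that order_trans[OF norm_ge_zero K]
      by (intro mult_left_mono) (auto simp: closed_segment_eq_real_ivl split: if_splits)
    finally show ?thesis .
  qed
  have "norm ((f (x + a) - (x + a) *\<^sub>R nderiv 1 f x) - (f x - x *\<^sub>R nderiv 1 f x)) \<le> (K * \<bar>a\<bar>) * norm ((x + a) - x)"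
  proof (rule differentiable_bound[where S = "closed_segment x (x + a)"])
    show "((\<lambda>y. f y - y *\<^sub>R nderiv 1 f x) has_derivative (\<lambda>h. h *\<^sub>R nderiv 1 f y - h *\<^sub>R nderiv 1 f x))
        (at y within closed_segment x (x + a))" for y
      using smooth_has_vector_derivative_1[OF f, of y]
      by (auto intro!: derivative_intros has_derivative_at_withinI[of f] simp: has_vector_derivative_def)
    show "onorm (\<lambda>h. h *\<^sub>R nderiv 1 f y - h *\<^sub>R nderiv 1 f x) \<le> K * \<bar>a\<bar>"
      if "y \<in> closed_segment x (x + a)" for y
      unfolding scaleR_diff_right[symmetric] by (rule onorm_scaleR_le[OF d1[OF that]])
  qed auto
  then show ?thesis
    by (simp add: algebra_simps scaleR_conv_of_real power2_eq_square abs_mult[symmetric])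
qed

lemma integrable_conv_pointwise:
  assumes f: "smooth f" "\<And>t. cmod (f t) \<le> K" and g: "integrable lborel g"
  shows "integrable lborel (\<lambda>r. f (t - r) * g r)"
proof (rule Bochner_Integration.integrable_bound)
  show "integrable lborel (\<lambda>r. K * cmod (g r))" using g by simp
  have [measurable]: "f \<in> borel_measurable borel" "g \<in> borel_measurable borel"
    using smooth_borel_measurable[OF f(1), of 0] g by auto
  show "(\<lambda>r. f (t - r) * g r) \<in> borel_measurable lborel" by measurable
  have "0 \<le> K" using f(2)[of 0] norm_ge_zero order_trans by blast
  then show "AE r in lborel. cmod (f (t - r) * g r) \<le> norm (K * cmod (g r))"
    using f(2) by (auto simp: norm_mult intro!: AE_I2 mult_right_mono)
qed

text \<open>All derivatives are placed on \<open>f\<close>, so \<open>g\<close> may be merely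
  integrable. The Taylor remainder is bounded by a multiple of \<open>a\<^sup>2\<close> uniformly on
  the line, because \<open>DL1_bound\<close> controls every derivative of \<open>f\<close>, and this
  bound survives integration against \<open>g\<close>.\<close>

lemma
  assumes f: "f \<in> DL1" and g: "integrable lborel g"
  shows nderiv_conv: "nderiv j (conv f g) = conv (nderiv j f) g"
    and DL1_conv: "conv f g \<in> DL1"
proof -
  define F where "F = (\<lambda>j. conv (nderiv j f) g)"
  have F: "(F j has_vector_derivative F (Suc j) t) (at t)" for j t
  proof -
    obtain K where K: "\<And>i t. i \<in> {j, Suc j, j + 2} \<Longrightarrow> cmod (nderiv i f t) \<le> K"
    proof -
      let ?B = "\<lambda>i. N1 (nderiv i f) + N1 (nderiv 1 (nderiv i f))"
      have "cmod (nderiv i f t) \<le> Max (?B ` {j, Suc j, j + 2})" if "i \<in> {j, Suc j, j + 2}" for i t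
        using DL1_bound[OF DL1_nderiv[OF f], of i t] that
        by (intro order_trans[OF _ Max_ge]) auto
      then show thesis by (rule that)
    qed
    have K2: "cmod (nderiv 2 (nderiv j f) t) \<le> K" for t
      unfolding nderiv_nderiv by (rule K) simp
    have int: "integrable lborel (\<lambda>r. nderiv i f (t - r) * g r)" if "i \<in> {j, Suc j, j + 2}" for i t
      by (rule integrable_conv_pointwise[OF smooth_nderiv[OF DL1_smooth[OF f]] K[OF that] g])
    show ?thesis
    proof (rule has_vector_derivative_quadratic[where K = "K * N1 g"])
      fix a
      let ?d = "\<lambda>r. nderiv j f (t + a - r) - nderiv j f (t - r) - of_real a * nderiv (Suc j) f (t - r)"
      have eq: "F j (t + a) - F j t - of_real a * F (Suc j) t = (LINT r|lborel. ?d r * g r)"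
      proof -
        have i: "integrable lborel (\<lambda>r. nderiv j f (t + a - r) * g r)"
          "integrable lborel (\<lambda>r. nderiv j f (t - r) * g r)"
          "integrable lborel (\<lambda>r. of_real a * (nderiv (Suc j) f (t - r) * g r))"
          by (auto intro!: int)
        have "(LINT r|lborel. ?d r * g r) = (LINT r|lborel. nderiv j f (t + a - r) * g r
            - nderiv j f (t - r) * g r - of_real a * (nderiv (Suc j) f (t - r) * g r))"
          by (simp add: left_diff_distrib mult.assoc)
        also have "\<dots> = F j (t + a) - F j t - of_real a * F (Suc j) t"
          unfolding Bochner_Integration.integral_diff[OF Bochner_Integration.integrable_diff[OF i(1,2)] i(3)]
            Bochner_Integration.integral_diff[OF i(1,2)] F_def conv_def
          by simp
        finally show ?thesis by simp
      qed
      have "cmod (F j (t + a) - F j t - of_real a * F (Suc j) t) \<le> (LINT r|lborel. cmod (?d r * g r))"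
        unfolding eq by (rule integral_norm_bound)
      also have "\<dots> \<le> (LINT r|lborel. K * a\<^sup>2 * cmod (g r))"
      proof (rule integral_mono')
        fix r
        have "cmod (nderiv j f ((t - r) + a) - nderiv j f (t - r) - of_real a * nderiv 1 (nderiv j f) (t - r)) \<le> K * a\<^sup>2"
          by (rule smooth_taylor_bound[OF smooth_nderiv[OF DL1_smooth[OF f]] K2])
        moreover have "(t - r) + a = t + a - r" by simp
        moreover have "nderiv 1 (nderiv j f) = nderiv (Suc j) f" by (simp add: nderiv_nderiv)
        ultimately have "cmod (?d r) \<le> K * a\<^sup>2" by (simp only:)
        then show "cmod (?d r * g r) \<le> K * a\<^sup>2 * cmod (g r)"
          unfolding norm_mult by (rule mult_right_mono) simp
      next
        show "integrable lborel (\<lambda>r. K * a\<^sup>2 * cmod (g r))" using g by simp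
      next
        show "0 \<le> K * a\<^sup>2 * cmod (g r)" for r
          using order_trans[OF norm_ge_zero K2] by simp
      qed
      also have "\<dots> = K * N1 g * a\<^sup>2" by (simp add: N1_def)
      finally show "cmod (F j (t + a) - F j t - of_real a * F (Suc j) t) \<le> K * N1 g * a\<^sup>2" .
    qed
  qed
  have nd: "nderiv j (conv f g) = conv (nderiv j f) g" for j
    using nderiv_family[of F, OF F] by (simp add: F_def)
  show "nderiv j (conv f g) = conv (nderiv j f) g" by (rule nd)
  show "conv f g \<in> DL1"
    unfolding DL1_def
  proof (intro CollectI conjI allI)
    show "smooth (conv f g)"
      using smooth_family[of F, OF F] by (simp add: F_def)
    show "integrable lborel (nderiv j (conv f g))" for j
      unfolding nd by (rule conv_integrable[OF DL1_nderiv_integrable[OF f] g])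
  qed
qed

lemma std_normal_fourier:
  "of_real (std_normal_density u) =
    of_real (1 / sqrt (2 * pi)) * (LINT s|lborel. of_real (std_normal_density s) * cis (u * s))"
proof -
  have "char std_normal_distribution u = (LINT s|lborel. std_normal_density s *\<^sub>R cis (u * s))"
    unfolding char_def cis_conv_exp
    by (subst integral_density) (auto simp: mult_ac)
  then show ?thesis
    unfolding char_std_normal_distribution
    by (simp add: std_normal_density_def scaleR_conv_of_real exp_of_real)
qed

text \<open>Averages of \<open>f\<close> against Gaussians vanish, because the Gaussian is a Fourier transform.\<close>

lemma DL1_fourier_unique:
  assumes f: "f \<in> DL1" and zero: "\<And>w. fourier f w = 0"
  shows "f t = 0"
proof -
  let ?k = "std_normal_density :: real \<Rightarrow> real"
  have [measurable]: "f \<in> borel_measurable borel"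
    using smooth_borel_measurable[OF DL1_smooth[OF f], of 0] by simp
  have f_int: "integrable lborel f" by (rule DL1_integrable[OF f])
  \<comment> \<open>Replace the Gaussian weight by its Fourier integral and exchange the integrals:
    the inner integral is then a value of \<open>fourier f\<close> up to a phase and a factor, hence
    0.\<close>
  have avg: "(LINT u|lborel. of_real (?k u) * f (t - u / n)) = 0" if "n > 0" for n :: real
  proof -
    have f': "integrable lborel (\<lambda>u. f (t - u / n))"
      using lborel_integrable_real_affine[OF f_int, of "- (1 / n)" t] that by simp
    let ?K = "\<lambda>s u. of_real (?k s) * (cis (u * s) * f (t - u / n))"
    have [measurable]: "(\<lambda>(s, u). cis (u * s)) \<in> borel_measurable (borel \<Otimes>\<^sub>M borel)"
      unfolding borel_prod by (intro borel_measurable_continuous_onI) (auto simp: case_prod_unfold intro!: continuous_intros)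
    have inner: "(LINT u|lborel. ?K s u) = 0" for s
    proof -
      have "fourier (\<lambda>v. f (t - v / n)) (- s) = 0"
      proof -
        have "(LINT u|lborel. cis (s * u) * f (t - u / n)) =
            \<bar>- n\<bar> *\<^sub>R (LINT v|lborel. cis (s * (n * t + - n * v)) * f (t - (n * t + - n * v) / n))"
          using that by (intro lborel_integral_real_affine) auto
        also have "(LINT v|lborel. cis (s * (n * t + - n * v)) * f (t - (n * t + - n * v) / n)) =
            (LINT v|lborel. cis (s * n * t) * (cis (- (s * n * v)) * f v))"
          unfolding mult.assoc[symmetric] cis_mult
          using that by (intro Bochner_Integration.integral_cong refl) (simp add: field_simps)
        also have "\<dots> = cis (s * n * t) * fourier f (s * n)"
          by (simp add: fourier_def)
        finally have "(LINT u|lborel. cis (s * u) * f (t - u / n)) = 0"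
          by (simp only: zero mult_zero_right scaleR_zero_right)
        then show ?thesis by (simp add: fourier_def)
      qed
      then show ?thesis by (simp add: fourier_def mult.commute[of s])
    qed
    have "(LINT u|lborel. LINT s|lborel. ?K s u) = (LINT s|lborel. LINT u|lborel. ?K s u)"
    proof (rule kernel_Fubini)
      show "(\<lambda>(s, u). ?K s u) \<in> borel_measurable (borel \<Otimes>\<^sub>M borel)" by measurable
      show "integrable lborel (\<lambda>s. ?k s * N1 (\<lambda>u. f (t - u / n)))" by simp
      show "integrable lborel (?K s)" for s
        using integrable_cis_mult[OF f', of s] by (simp add: mult.commute)
      show "N1 (?K s) \<le> ?k s * N1 (\<lambda>u. f (t - u / n))" for s
        by (simp add: N1_def norm_mult)
    qed
    also have "\<dots> = 0" by (simp only: inner Bochner_Integration.integral_zero)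
    finally have "0 = (LINT u|lborel. LINT s|lborel. ?K s u)" by simp
    also have "\<dots> = (LINT u|lborel. (LINT s|lborel. of_real (?k s) * cis (u * s)) * f (t - u / n))"
      by (simp add: mult.assoc[symmetric])
    also have "\<dots> = (LINT u|lborel. of_real (sqrt (2 * pi)) * (of_real (?k u) * f (t - u / n)))"
      by (subst (2) std_normal_fourier) (simp add: mult.assoc[symmetric] of_real_mult[symmetric] del: of_real_mult)
    finally show ?thesis by simp
  qed
  define B where "B = N1 f + N1 (nderiv 1 f)"
  \<comment> \<open>As the width of the weight shrinks, the averages tend to \<open>f t\<close>, the
    Gaussian having total mass 1.\<close>
  have "(\<lambda>n. LINT u|lborel. of_real (?k u) * f (t - u / real (Suc n))) \<longlonglongrightarrow>
      (LINT u|lborel. of_real (?k u) * f t)"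
  proof (rule integral_dominated_convergence[where w = "\<lambda>u. ?k u * B"])
    show "AE u in lborel. (\<lambda>n. of_real (?k u) * f (t - u / real (Suc n))) \<longlonglongrightarrow> of_real (?k u) * f t"
    proof (intro AE_I2 tendsto_mult tendsto_const)
      fix u
      have "(\<lambda>n. t - u * (1 / real (Suc n))) \<longlonglongrightarrow> t - u * 0"
        by (intro tendsto_intros LIMSEQ_Suc lim_1_over_n)
      then have lim: "(\<lambda>n. t - u / real (Suc n)) \<longlonglongrightarrow> t" by simp
      show "(\<lambda>n. f (t - u / real (Suc n))) \<longlonglongrightarrow> f t"
        using smooth_isCont[OF DL1_smooth[OF f], of t 0] by (intro isCont_tendsto_compose[OF _ lim]) simp
    qed
    show "AE u in lborel. norm (of_real (?k u) * f (t - u / real (Suc n))) \<le> ?k u * B" for n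
      using DL1_bound[OF f] by (auto simp: norm_mult B_def intro!: AE_I2 mult_left_mono)
  qed auto
  also have "(\<lambda>n. LINT u|lborel. of_real (?k u) * f (t - u / real (Suc n))) = (\<lambda>_. 0)"
    using avg by auto
  finally have "(LINT u|lborel. of_real (?k u) * f t) = 0"
    using LIMSEQ_unique tendsto_const by blast
  then show ?thesis by simp
qed

subsection \<open>Kernels with compactly supported Fourier transform\<close>

definition fej :: "real \<Rightarrow> real \<Rightarrow> real" where
  "fej a t = a\<^sup>2 / (2 * pi) * (sinc (a * t / 2))\<^sup>2"

lemma fej_eq: "t \<noteq> 0 \<Longrightarrow> fej a t = (1 - cos (a * t)) / (pi * t\<^sup>2)"
proof (cases "a = 0")
  case False
  assume "t \<noteq> 0"
  moreover have "cos (a * t) = 1 - 2 * (sin (a * t / 2))\<^sup>2"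
    using cos_double_sin[of "a * t / 2"] by simp
  ultimately show ?thesis using False
    by (simp add: fej_def power_divide power_mult_distrib field_simps)
qed (simp add: fej_def)

lemma fej_at_0: "fej a 0 = a\<^sup>2 / (2 * pi)"
  by (simp add: fej_def)

lemma fej_0 [simp]: "fej 0 t = 0"
  by (simp add: fej_def)

lemma fej_scale: "fej (e * a) t = e\<^sup>2 * fej a (e * t)"
  by (simp add: fej_def power_mult_distrib mult_ac)

lemma fej_minus: "fej a (- t) = fej a t"
  by (simp add: fej_def)

lemma continuous_on_fej: "continuous_on A (fej a)"
  unfolding fej_def
  by (intro continuous_at_imp_continuous_on ballI continuous_intros
      isCont_o2[where g = sinc, OF _ isCont_sinc]) auto

lemma fej_measurable [measurable]: "fej a \<in> borel_measurable borel"
  by (intro borel_measurable_continuous_onI continuous_on_fej)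

lemma fej_nonneg: "0 \<le> fej a t"
  by (simp add: fej_def)

lemma fej_bound: "fej a t \<le> (a\<^sup>2 + 2) * inverse (1 + t\<^sup>2)"
proof -
  have "\<bar>sinc x\<bar> \<le> 1" for x
    using abs_sin_x_le_abs_x[of x] by (auto simp: divide_le_eq)
  then have sq: "(sinc x)\<^sup>2 \<le> 1" for x
    by (metis abs_ge_zero one_power2 power2_abs power_mono)
  have "fej a t \<le> a\<^sup>2 / (2 * pi) * 1"
    unfolding fej_def by (rule mult_left_mono[OF sq]) simp
  also have "\<dots> \<le> a\<^sup>2"
    using pi_gt3 by (simp add: divide_le_eq mult_le_cancel_left1)
  finally have 1: "fej a t \<le> a\<^sup>2" .
  have "t\<^sup>2 * fej a t \<le> 2"
  proof (cases "t = 0")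
    case False
    then have "t\<^sup>2 * fej a t = (1 - cos (a * t)) / pi"
      by (simp add: fej_eq)
    also have "\<dots> \<le> 2 / pi" using cos_ge_minus_one[of "a * t"] by (intro divide_right_mono) auto
    also have "\<dots> \<le> 2" using pi_gt3 by (simp add: divide_le_eq)
    finally show ?thesis .
  qed simp
  with 1 have "(1 + t\<^sup>2) * fej a t \<le> a\<^sup>2 + 2" by (simp add: algebra_simps)
  moreover have "1 + t\<^sup>2 > 0" by (simp add: add_pos_nonneg)
  ultimately show ?thesis
    using pos_le_divide_eq[of "1 + t\<^sup>2" "fej a t" "a\<^sup>2 + 2"] by (metis divide_inverse mult.commute)
qed

lemma integrable_inverse_square: "integrable lborel (\<lambda>t::real. inverse (1 + t\<^sup>2))"
  using integrable_inverse_1_plus_square by (simp add: set_integrable_def einterval_def)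

lemma fej_integrable: "integrable lborel (fej a)"
proof (rule Bochner_Integration.integrable_bound)
  show "integrable lborel (\<lambda>t. (a\<^sup>2 + 2) * inverse (1 + t\<^sup>2))"
    using integrable_inverse_square by simp
  show "AE t in lborel. norm (fej a t) \<le> norm ((a\<^sup>2 + 2) * inverse (1 + t\<^sup>2))"
    using fej_bound fej_nonneg by (auto intro!: AE_I2 order_trans[OF _ abs_ge_self])
qed simp

lemma integral_fej_1: "(LINT t|lborel. fej 1 t) = 1"
proof -
  \<comment> \<open>Integration by parts gives a primitive in terms of the sine integral, whose
    limit \<open>pi / 2\<close> at infinity makes the half-line integral equal to 1/2.\<close>
  define G where "G t = (Si t - (1 - cos t) / t) / pi" for t :: real
  have FTC: "(LBINT t=0..\<infinity>. fej 1 t) = 1 / 2 - 0"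
  proof (rule interval_integral_FTC_nonneg[where F = G])
    fix t :: real assume "0 < ereal t"
    then have t: "t > 0" by (simp add: zero_ereal_def)
    have "(G has_real_derivative (sinc t - (sin t * t - (1 - cos t)) / (t * t)) / pi) (at t)"
      unfolding G_def using t by (auto intro!: derivative_eq_intros DERIV_Si)
    also have "(sinc t - (sin t * t - (1 - cos t)) / (t * t)) / pi = fej 1 t"
      using t by (simp add: fej_eq field_simps power2_eq_square)
    finally show "(G has_real_derivative fej 1 t) (at t)" .
    show "isCont (fej 1) t"
      using continuous_on_fej[of UNIV 1] by (simp add: continuous_on_eq_continuous_at)
  next
    have lim: "((\<lambda>t::real. (1 - cos t) / t) \<longlongrightarrow> 0) (at 0)"
      using DERIV_cos[of 0] by (auto simp: has_field_derivative_iff minus_divide_left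
        intro!: tendsto_minus_cancel[of "\<lambda>t. (1 - cos t) / t" 0])
    have "(Si \<longlongrightarrow> Si 0) (at 0)" using isCont_Si[of 0] by (simp add: isCont_def)
    moreover have "Si 0 = 0" by (simp add: Si_def zero_ereal_def[symmetric])
    ultimately have "(Si \<longlongrightarrow> 0) (at 0)" by simp
    then have "(G \<longlongrightarrow> (0 - 0) / pi) (at 0)"
      unfolding G_def by (intro tendsto_divide tendsto_diff tendsto_const lim) simp_all
    then have "(G \<longlongrightarrow> 0) (at_right 0)" by (simp add: filterlim_at_split)
    then show "((G \<circ> real_of_ereal) \<longlongrightarrow> 0) (at_right 0)"
      by (simp add: zero_ereal_def ereal_tendsto_simps)
    have "((\<lambda>t::real. (1 - cos t) / t) \<longlongrightarrow> 0) at_top"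
    proof (rule Lim_null_comparison)
      show "\<forall>\<^sub>F t::real in at_top. norm ((1 - cos t) / t) \<le> 2 * inverse t"
        using eventually_gt_at_top[of 0]
      proof eventually_elim
        case (elim t)
        have "\<bar>1 - cos t\<bar> \<le> 2" using cos_le_one[of t] cos_ge_minus_one[of t] by linarith
        with elim show ?case by (simp add: divide_inverse abs_mult mult_right_mono)
      qed
      show "((\<lambda>t::real. 2 * inverse t) \<longlongrightarrow> 0) at_top"
        by (intro tendsto_mult_right_zero tendsto_inverse_0_at_top filterlim_ident)
    qed
    then have "(G \<longlongrightarrow> (pi / 2 - 0) / pi) at_top"
      unfolding G_def by (intro tendsto_intros Si_at_top) simp_all
    then show "((G \<circ> real_of_ereal) \<longlongrightarrow> 1 / 2) (at_left \<infinity>)"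
      by (simp add: ereal_tendsto_simps)
  qed (simp_all add: fej_nonneg zero_ereal_def)
  have half: "(LINT t|lborel. indicator {0<..} t * fej 1 t) = 1 / 2"
    using FTC by (simp add: interval_lebesgue_integral_def set_lebesgue_integral_def einterval_def
        zero_ereal_def greaterThan_def)
  have int: "integrable lborel (\<lambda>t. indicator A t * fej 1 t)" if "A \<in> sets borel" for A
    by (rule Bochner_Integration.integrable_bound[OF fej_integrable[of 1]])
      (use that in \<open>auto split: split_indicator\<close>)
  have "(LINT t|lborel. fej 1 t) =
      (LINT t|lborel. indicator {0<..} t * fej 1 t + indicator {..<0} t * fej 1 t)"
  proof (rule integral_cong_AE)
    show "AE t in lborel. fej 1 t = indicator {0<..} t * fej 1 t + indicator {..<0} t * fej 1 t"
      using AE_lborel_singleton[of 0] by eventually_elim (auto split: split_indicator)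
  qed simp_all
  also have "\<dots> = (LINT t|lborel. indicator {0<..} t * fej 1 t) + (LINT t|lborel. indicator {..<0} t * fej 1 t)"
    by (intro Bochner_Integration.integral_add int) auto
  also have "(LINT t|lborel. indicator {..<0} t * fej 1 t) = (LINT t|lborel. indicator {..<0} (0 - t) * fej 1 (0 - t))"
    by (rule integral_reflect[symmetric])
  also have "(\<lambda>t. indicator {..<0} (0 - t) * fej 1 (0 - t)) = (\<lambda>t. indicator {0<..} t * fej 1 t)"
    by (auto simp: fej_minus split: split_indicator)
  finally show ?thesis using half by simp
qed

lemma integral_fej: "(LINT t|lborel. fej a t) = \<bar>a\<bar>"
proof (cases "a = 0")
  case False
  have "1 = \<bar>a\<bar> * (LINT t|lborel. fej 1 (a * t))"
    using lborel_integral_real_affine[OF False, of "fej 1" 0] integral_fej_1 by simp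
  moreover have "(LINT t|lborel. fej a t) = \<bar>a\<bar> * (\<bar>a\<bar> * (LINT t|lborel. fej 1 (a * t)))"
    using fej_scale[of a 1] by (simp add: power2_eq_square abs_mult[symmetric] mult.assoc[symmetric])
  ultimately show ?thesis by simp
qed simp

text \<open>Product-to-sum formulas turn \<open>cos (s * t) * fej a t\<close> into a combination of
  Fejer kernels with parameters \<open>a + s\<close>, \<open>a - s\<close> and \<open>s\<close>. The
  transform thus reduces to \<open>integral_fej\<close>, and the absolute values add up to the
  triangle.\<close>

lemma fourier_fej:
  assumes "0 \<le> a"
  shows "fourier (\<lambda>t. of_real (fej a t)) s = of_real (max 0 (a - \<bar>s\<bar>))"
proof -
  let ?f = "\<lambda>t. complex_of_real (fej a t)"
  have int: "integrable lborel ?f" using fej_integrable by simp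
  \<comment> \<open>The kernel is even, so the exponential may be averaged with its conjugate,
    leaving a cosine.\<close>
  have "fourier ?f s = (LINT t|lborel. cis (- (s * (0 - t))) * ?f (0 - t))"
    unfolding fourier_def by (rule integral_reflect[symmetric])
  then have "fourier ?f s = (LINT t|lborel. cis (s * t) * ?f t)" by (simp add: fej_minus)
  then have "2 * fourier ?f s = (LINT t|lborel. cis (- (s * t)) * ?f t) + (LINT t|lborel. cis (s * t) * ?f t)"
    by (simp add: fourier_def)
  also have "\<dots> = (LINT t|lborel. cis (- (s * t)) * ?f t + cis (s * t) * ?f t)"
    by (rule Bochner_Integration.integral_add[symmetric])
      (intro integrable_fourier integrable_cis_mult int)+
  also have "\<dots> = (LINT t|lborel. of_real (2 * (1/2 * fej (a + s) t + 1/2 * fej (a - s) t - fej s t)))"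
  proof (intro Bochner_Integration.integral_cong refl)
    fix t
    have "cis (- (s * t)) + cis (s * t) = of_real (2 * cos (s * t))"
      by (simp add: complex_eq_iff)
    then have "cis (- (s * t)) * ?f t + cis (s * t) * ?f t = of_real (2 * (cos (s * t) * fej a t))"
      unfolding distrib_right[symmetric] by simp
    also have "cos (s * t) * fej a t = 1/2 * fej (a + s) t + 1/2 * fej (a - s) t - fej s t"
    proof (cases "t = 0")
      case True
      then show ?thesis by (simp add: fej_at_0 field_simps power2_eq_square)
    next
      case False
      have f: "fej x t = (1 - cos (x * t)) * inverse (pi * t\<^sup>2)" for x
        using False by (simp add: fej_eq divide_inverse)
      have "cos (s * t) * (1 - cos (a * t)) =
        1/2 * (1 - cos ((a + s) * t)) + 1/2 * (1 - cos ((a - s) * t)) - (1 - cos (s * t))"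
        by (simp add: distrib_right left_diff_distrib cos_add cos_diff algebra_simps)
      then have "cos (s * t) * fej a t = (1/2 * (1 - cos ((a + s) * t)) +
          1/2 * (1 - cos ((a - s) * t)) - (1 - cos (s * t))) * inverse (pi * t\<^sup>2)"
        unfolding f mult.assoc[symmetric] by (rule arg_cong)
      also have "\<dots> = 1/2 * fej (a + s) t + 1/2 * fej (a - s) t - fej s t"
        unfolding f left_diff_distrib[of _ _ "inverse _"] distrib_right[of _ _ "inverse _"] mult.assoc ..
      finally show ?thesis .
    qed
    finally show "cis (- (s * t)) * ?f t + cis (s * t) * ?f t =
        of_real (2 * (1/2 * fej (a + s) t + 1/2 * fej (a - s) t - fej s t))" .
  qed
  also have "\<dots> = of_real (2 * (1/2 * \<bar>a + s\<bar> + 1/2 * \<bar>a - s\<bar> - \<bar>s\<bar>))"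
    unfolding integral_complex_of_real
    by (simp add: fej_integrable integral_fej)
  also have "1/2 * \<bar>a + s\<bar> + 1/2 * \<bar>a - s\<bar> - \<bar>s\<bar> = max 0 (a - \<bar>s\<bar>)"
    using assms by (auto simp: max_def abs_if field_simps)
  finally show ?thesis by simp
qed

text \<open>A de la Vallee Poussin kernel: as a difference quotient of two triangles, its transform
  is the trapezoid equal to 1 for \<open>\<bar>s\<bar> \<le> a\<close> and to 0 for
  \<open>\<bar>s\<bar> \<ge> b\<close>. For \<open>a = 0\<close> it is the normalised Fejer kernel,
  since \<open>fej 0\<close> vanishes.\<close>

definition trap :: "real \<Rightarrow> real \<Rightarrow> real \<Rightarrow> complex" where
  "trap a b t = of_real ((fej b t - fej a t) / (b - a))"

lemma trap_scale: "0 < e \<Longrightarrow> trap (e * a) (e * b) t = of_real e * trap a b (e * t)"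
  by (simp add: trap_def fej_scale right_diff_distrib[symmetric] power2_eq_square)

lemma continuous_on_trap: "continuous_on A (trap a b)"
  unfolding trap_def divide_inverse
  by (intro continuous_intros continuous_on_fej)

lemma trap_measurable [measurable]: "trap a b \<in> borel_measurable borel"
  by (intro borel_measurable_continuous_onI continuous_on_trap)

lemma trap_integrable: "integrable lborel (trap a b)"
  unfolding trap_def using fej_integrable by (intro integrable_of_real) simp

lemma fourier_trap:
  assumes "0 \<le> a" "a < b"
  shows "fourier (trap a b) s = of_real ((max 0 (b - \<bar>s\<bar>) - max 0 (a - \<bar>s\<bar>)) / (b - a))"
proof -
  have eq: "trap a b = (\<lambda>t. of_real (1 / (b - a)) * (of_real (fej b t) - of_real (fej a t)))"
    by (simp add: trap_def fun_eq_iff)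
  show ?thesis
    unfolding eq fourier_cmult
    using assms by (subst fourier_diff) (simp_all add: fej_integrable fourier_fej)
qed

text \<open>Modulation moves the trapezoid to the centre \<open>w\<close>; \<open>a\<close> and
  \<open>b\<close> are the half-widths of its top and its base.\<close>

definition plateau :: "real \<Rightarrow> real \<Rightarrow> real \<Rightarrow> real \<Rightarrow> complex" where
  "plateau w a b t = cis (w * t) * trap a b t"

lemma plateau_integrable: "integrable lborel (plateau w a b)"
  unfolding plateau_def by (intro integrable_cis_mult trap_integrable)

lemma
  assumes "0 \<le> a" "a < b"
  shows fourier_plateau_eq_1: "\<bar>s - w\<bar> \<le> a \<Longrightarrow> fourier (plateau w a b) s = 1"
    and fourier_plateau_eq_0: "b \<le> \<bar>s - w\<bar> \<Longrightarrow> fourier (plateau w a b) s = 0"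
  unfolding plateau_def fourier_modulate using assms
  by (simp_all add: fourier_trap max_def)

lemma trap_bound: "\<exists>C\<ge>0. \<forall>t. cmod (trap a b t) \<le> C * inverse (1 + t\<^sup>2)"
proof -
  let ?C = "((a\<^sup>2 + 2) + (b\<^sup>2 + 2)) / \<bar>b - a\<bar>"
  have "cmod (trap a b t) \<le> ?C * inverse (1 + t\<^sup>2)" for t
  proof -
    have "\<bar>fej b t - fej a t\<bar> \<le> (b\<^sup>2 + 2) * inverse (1 + t\<^sup>2) + (a\<^sup>2 + 2) * inverse (1 + t\<^sup>2)"
      using fej_bound[of b t] fej_bound[of a t] fej_nonneg[of a t] fej_nonneg[of b t] by linarith
    then have "\<bar>fej b t - fej a t\<bar> / \<bar>b - a\<bar> \<le>
        ((b\<^sup>2 + 2) * inverse (1 + t\<^sup>2) + (a\<^sup>2 + 2) * inverse (1 + t\<^sup>2)) / \<bar>b - a\<bar>"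
      by (rule divide_right_mono) simp
    then show ?thesis
      unfolding trap_def norm_of_real abs_divide by (simp add: algebra_simps add_divide_distrib)
  qed
  then show ?thesis by (intro exI[of _ ?C]) auto
qed

lemma trap_shift_tendsto:
  assumes "x \<longlonglongrightarrow> 0"
  shows "(\<lambda>n. N1 (\<lambda>t. trap a b (t + x n) - trap a b t)) \<longlonglongrightarrow> 0"
proof -
  obtain C where C: "C \<ge> 0" "\<And>t. cmod (trap a b t) \<le> C * inverse (1 + t\<^sup>2)"
    using trap_bound by blast
  obtain X where X: "\<And>n. \<bar>x n\<bar> \<le> X" "X \<ge> 1"
  proof -
    from convergent_imp_Bseq[of x] assms obtain K where "\<And>n. norm (x n) \<le> K"
      by (auto simp: convergent_def Bseq_def)
    then show thesis by (intro that[of "max K 1"]) (auto intro: order_trans[OF _ max.cobounded1])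
  qed
  \<comment> \<open>A majorant independent of \<open>n\<close>: under bounded shifts
    \<open>1 + (t + x n)\<^sup>2\<close> stays comparable to \<open>1 + t\<^sup>2\<close>, and
    \<open>X \<ge> 1\<close> lets the single factor \<open>3 * X\<^sup>2\<close> cover all
    constants.\<close>
  have shift: "cmod (trap a b (t + x n)) \<le> C * (3 * X\<^sup>2) * inverse (1 + t\<^sup>2)" for t n
  proof -
    have "t\<^sup>2 \<le> 2 * (t + x n)\<^sup>2 + 2 * (x n)\<^sup>2"
      using zero_le_power2[of "t + 2 * x n"] by (simp add: power2_eq_square algebra_simps)
    moreover have "(x n)\<^sup>2 \<le> X\<^sup>2" using X(1)[of n] by (rule power2_le_iff_abs_le[THEN iffD2, rotated]) (use X in simp)
    moreover have "1 \<le> X\<^sup>2" using X(2) by (simp add: one_le_power)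
    moreover have "(t + x n)\<^sup>2 * 1 \<le> (t + x n)\<^sup>2 * X\<^sup>2" using \<open>1 \<le> X\<^sup>2\<close> by (intro mult_left_mono) auto
    moreover have "0 \<le> (t + x n)\<^sup>2 * X\<^sup>2" by simp
    moreover have "3 * X\<^sup>2 * (1 + (t + x n)\<^sup>2) = 3 * X\<^sup>2 + 3 * ((t + x n)\<^sup>2 * X\<^sup>2)"
      by (simp add: algebra_simps)
    ultimately have le: "1 + t\<^sup>2 \<le> 3 * X\<^sup>2 * (1 + (t + x n)\<^sup>2)" by linarith
    have "1 + t\<^sup>2 > 0" "1 + (t + x n)\<^sup>2 > 0" by (simp_all add: add_pos_nonneg)
    with le have "inverse (1 + (t + x n)\<^sup>2) \<le> 3 * X\<^sup>2 * inverse (1 + t\<^sup>2)"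
      by (simp add: field_simps)
    then have "C * inverse (1 + (t + x n)\<^sup>2) \<le> C * (3 * X\<^sup>2 * inverse (1 + t\<^sup>2))"
      using C(1) by (rule mult_left_mono)
    with C(2)[of "t + x n"] show ?thesis by (simp add: mult.assoc)
  qed
  have "(\<lambda>n. LINT t|lborel. cmod (trap a b (t + x n) - trap a b t)) \<longlonglongrightarrow> (LINT t|(lborel :: real measure). cmod 0)"
  proof (rule integral_dominated_convergence[where w = "\<lambda>t. (C * (3 * X\<^sup>2) + C) * inverse (1 + t\<^sup>2)"])
    show "AE t in lborel. (\<lambda>n. cmod (trap a b (t + x n) - trap a b t)) \<longlonglongrightarrow> cmod 0"
    proof (intro AE_I2 tendsto_norm)
      fix t
      have "isCont (trap a b) t"
        using continuous_on_trap[of UNIV a b] by (simp add: continuous_on_eq_continuous_at)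
      moreover have "(\<lambda>n. t + x n) \<longlonglongrightarrow> t"
        using tendsto_add[OF tendsto_const assms, of t] by simp
      ultimately have "(\<lambda>n. trap a b (t + x n)) \<longlonglongrightarrow> trap a b t"
        by (rule isCont_tendsto_compose)
      then show "(\<lambda>n. trap a b (t + x n) - trap a b t) \<longlonglongrightarrow> 0"
        by (rule LIM_zero)
    qed
    show "AE t in lborel. norm (cmod (trap a b (t + x n) - trap a b t)) \<le> (C * (3 * X\<^sup>2) + C) * inverse (1 + t\<^sup>2)" for n
    proof (rule AE_I2)
      fix t
      show "norm (cmod (trap a b (t + x n) - trap a b t)) \<le> (C * (3 * X\<^sup>2) + C) * inverse (1 + t\<^sup>2)"
        using norm_triangle_ineq4[of "trap a b (t + x n)" "trap a b t"] shift[of t n] C(2)[of t]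
        by (simp add: distrib_right)
    qed
  next
    show "integrable lborel (\<lambda>t. (C * (3 * X\<^sup>2) + C) * inverse (1 + t\<^sup>2))"
      by (rule integrable_mult_right[OF integrable_inverse_square])
    show "(\<lambda>t. cmod (trap a b (t + x n) - trap a b t)) \<in> borel_measurable lborel" for n
      by measurable
  qed simp
  then show ?thesis unfolding N1_def by simp
qed

text \<open>Kernels of different scales are dilations of each other that preserve the L1 norm, so
  shifts only matter relative to the scale.\<close>

lemma trap_dilate_N1:
  assumes "0 < e"
  shows "N1 (\<lambda>t. trap e (2 * e) (t + x) - trap e (2 * e) t) =
    N1 (\<lambda>t. trap 1 2 (t + e * x) - trap 1 2 t)"
proof -
  have "N1 (\<lambda>t. trap 1 2 (t + e * x) - trap 1 2 t) =
      \<bar>e\<bar> *\<^sub>R (LINT t|lborel. cmod (trap 1 2 (0 + e * t + e * x) - trap 1 2 (0 + e * t)))"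
    unfolding N1_def using assms by (intro lborel_integral_real_affine) simp
  also have "\<dots> = (LINT t|lborel. cmod (of_real e * (trap 1 2 (e * (t + x)) - trap 1 2 (e * t))))"
    using assms by (simp add: norm_mult distrib_left)
  also have "\<dots> = N1 (\<lambda>t. trap e (2 * e) (t + x) - trap e (2 * e) t)"
    using trap_scale[OF assms, of 1 2] by (simp add: N1_def right_diff_distrib mult.commute)
  finally show ?thesis by simp
qed

text \<open>The phase cancels the effect of the shift on the carrier frequency and leaves the
  shifted trapezoid alone. Both Wiener's lemma and the treatment of the isolated frequency draw
  their smallness from this identity.\<close>

lemma plateau_shift_N1:
  assumes "0 < e"
  shows "N1 (\<lambda>t. cis (- (w * x)) * plateau w e (2 * e) (t + x) - plateau w e (2 * e) t) =
    N1 (\<lambda>t. trap 1 2 (t + e * x) - trap 1 2 t)"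
proof -
  have "cis (- (w * x)) * plateau w e (2 * e) (t + x) - plateau w e (2 * e) t =
      cis (w * t) * (trap e (2 * e) (t + x) - trap e (2 * e) t)" for t
    unfolding plateau_def mult.assoc[symmetric] cis_mult
    by (simp add: algebra_simps)
  then show ?thesis
    unfolding trap_dilate_N1[OF assms, symmetric] by (simp add: N1_def norm_mult)
qed

text \<open>Since \<open>fourier \<phi> w = 1\<close>, the plateau is the integral over
  \<open>r\<close> of its own multiples by \<open>cis (- (w * r)) * \<phi> r\<close>. Subtracting
  the convolution leaves phase-corrected shifts by \<open>- r\<close>, of norm
  \<open>D (- (e n * r))\<close>, and dominated convergence in \<open>r\<close> applies.\<close>

lemma plateau_conv_tendsto:
  assumes \<phi>: "integrable lborel \<phi>" "fourier \<phi> w = 1"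
    and e: "\<And>n. 0 < e n" "e \<longlonglongrightarrow> 0"
  shows "(\<lambda>n. N1 (\<lambda>t. plateau w (e n) (2 * e n) t - conv (plateau w (e n) (2 * e n)) \<phi> t)) \<longlonglongrightarrow> 0"
proof -
  have [measurable]: "\<phi> \<in> borel_measurable borel" using \<phi> by auto
  define D where "D x = N1 (\<lambda>t. trap 1 2 (t + x) - trap 1 2 t)" for x
  have D_bound: "D x \<le> 2 * N1 (trap 1 2)" for x
    using N1_diff[OF integrable_shift[OF trap_integrable] trap_integrable, of 1 2 x 1 2]
    by (simp add: D_def)
  have D_nonneg: "D x \<ge> 0" for x by (simp add: D_def N1_nonneg)
  have [measurable]: "D \<in> borel_measurable borel" unfolding D_def N1_def by measurable
  have le: "N1 (\<lambda>t. plateau w (e n) (2 * e n) t - conv (plateau w (e n) (2 * e n)) \<phi> t)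
      \<le> (LINT r|lborel. cmod (\<phi> r) * D (- (e n * r)))" (is "N1 ?u \<le> _") for n
  proof -
    let ?p = "plateau w (e n) (2 * e n)"
    let ?k = "\<lambda>r t. cis (- (w * r)) * \<phi> r * ?p t - ?p (t - r) * \<phi> r"
    have p_meas [measurable]: "?p \<in> borel_measurable borel" using plateau_integrable by auto
    obtain C where C: "\<And>t. cmod (?p t) \<le> C"
    proof -
      obtain C where C: "C \<ge> 0" "\<And>t. cmod (trap (e n) (2 * e n) t) \<le> C * inverse (1 + t\<^sup>2)"
        using trap_bound by blast
      have "inverse (1 + t\<^sup>2) \<le> 1" for t :: real by (simp add: inverse_le_1_iff)
      then have "C * inverse (1 + t\<^sup>2) \<le> C * 1" for t by (intro mult_left_mono C)
      with C(2) have "cmod (?p t) \<le> C" for t by (auto simp: plateau_def norm_mult intro: order_trans)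
      then show thesis by (rule that)
    qed
    have i1: "integrable lborel (\<lambda>r. ?p (t - r) * \<phi> r)" for t
    proof (rule Bochner_Integration.integrable_bound)
      show "integrable lborel (\<lambda>r. C * cmod (\<phi> r))" using \<phi> by simp
      show "AE r in lborel. norm (?p (t - r) * \<phi> r) \<le> norm (C * cmod (\<phi> r))"
        using C by (auto simp: norm_mult abs_mult intro!: AE_I2 mult_right_mono order_trans[OF _ abs_ge_self])
    qed measurable
    have i2: "integrable lborel (\<lambda>r. cis (- (w * r)) * \<phi> r * ?p t)" for t
      using integrable_fourier[OF \<phi>(1), of w] by simp
    have u: "?u = (\<lambda>t. LINT r|lborel. ?k r t)"
    proof
      fix t
      have "?p t = (LINT r|lborel. cis (- (w * r)) * \<phi> r * ?p t)"
        using \<phi>(2) by (simp add: fourier_def)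
      then show "?u t = (LINT r|lborel. ?k r t)"
        unfolding Bochner_Integration.integral_diff[OF i2 i1] by (simp add: conv_def)
    qed
    have N: "N1 (?k r) = cmod (\<phi> r) * D (- (e n * r))" for r
    proof -
      have "?k r t = - (cis (- (w * r)) * \<phi> r) * (cis (- (w * (- r))) * ?p (t + - r) - ?p t)" for t
      proof -
        have "cis (- (w * r)) * cis (- (w * (- r))) = 1" by (simp add: cis_mult)
        then have "?p (t - r) * \<phi> r = (cis (- (w * r)) * cis (- (w * (- r)))) * (?p (t - r) * \<phi> r)"
          by simp
        then show ?thesis by (simp add: algebra_simps)
      qed
      then have "N1 (?k r) = cmod (- (cis (- (w * r)) * \<phi> r)) *
          N1 (\<lambda>t. cis (- (w * (- r))) * ?p (t + - r) - ?p t)"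
        unfolding N1_cmult[symmetric] by simp
      also have "\<dots> = cmod (\<phi> r) * D (- (e n * r))"
        unfolding plateau_shift_N1[OF e(1)] D_def by (simp add: norm_mult)
      finally show ?thesis .
    qed
    have "N1 ?u \<le> (LINT r|lborel. N1 (?k r))"
      unfolding u
    proof (rule kernel_minkowski)
      have [measurable]: "(\<lambda>t. cis (- (a * t))) \<in> borel_measurable borel" for a
        by (intro borel_measurable_continuous_onI continuous_intros)
      show "(\<lambda>(r, t). ?k r t) \<in> borel_measurable (borel \<Otimes>\<^sub>M borel)" by measurable
      show "integrable lborel (?k r)" for r
        using integrable_shift[OF plateau_integrable, of w "e n" "2 * e n" "- r"] plateau_integrable
        by (intro Bochner_Integration.integrable_diff integrable_mult_right integrable_mult_left) simp_all
      show "integrable lborel (\<lambda>r. cmod (\<phi> r) * (2 * N1 (trap 1 2)))" using \<phi> by simp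
      show "N1 (?k r) \<le> cmod (\<phi> r) * (2 * N1 (trap 1 2))" for r
        unfolding N by (intro mult_left_mono D_bound) simp
    qed
    then show ?thesis unfolding N .
  qed
  have lim: "(\<lambda>n. LINT r|lborel. cmod (\<phi> r) * D (- (e n * r))) \<longlonglongrightarrow> (LINT r|lborel. cmod (\<phi> r) * 0)"
  proof (rule integral_dominated_convergence[where w = "\<lambda>r. cmod (\<phi> r) * (2 * N1 (trap 1 2))"])
    show "AE r in lborel. (\<lambda>n. cmod (\<phi> r) * D (- (e n * r))) \<longlonglongrightarrow> cmod (\<phi> r) * 0"
    proof (intro AE_I2 tendsto_mult tendsto_const)
      fix r
      have "(\<lambda>n. - (e n * r)) \<longlonglongrightarrow> - (0 * r)" by (intro tendsto_intros e)
      then show "(\<lambda>n. D (- (e n * r))) \<longlonglongrightarrow> 0"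
        unfolding D_def by (intro trap_shift_tendsto) simp
    qed
    show "AE r in lborel. norm (cmod (\<phi> r) * D (- (e n * r))) \<le> cmod (\<phi> r) * (2 * N1 (trap 1 2))" for n
      using D_bound D_nonneg by (auto intro!: AE_I2 mult_left_mono)
  qed (use \<phi> in simp_all)
  show ?thesis
    by (rule tendsto_sandwich[OF _ _ tendsto_const lim[simplified]])
      (auto intro!: always_eventually N1_nonneg le)
qed

subsection \<open>Closed translation invariant subspaces of \<open>DL1\<close>\<close>

text \<open>The axioms are separated from the function classes because two such subspaces occur: one
  for \<open>A\<close>, and one for \<open>U\<close> with a twist by a character. Closedness uses
  the L1 norms of all derivatives, that is, the topology of \<open>DL1\<close>.\<close>

locale closed_invariant =
  fixes M :: "(real \<Rightarrow> complex) set"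
  assumes sub_DL1: "f \<in> M \<Longrightarrow> f \<in> DL1"
    and zero_mem: "(\<lambda>_. 0) \<in> M"
    and add_mem: "f \<in> M \<Longrightarrow> g \<in> M \<Longrightarrow> (\<lambda>t. f t + g t) \<in> M"
    and cmult_mem: "f \<in> M \<Longrightarrow> (\<lambda>t. c * f t) \<in> M"
    and shift_mem: "f \<in> M \<Longrightarrow> (\<lambda>t. f (t + a)) \<in> M"
    and closed_mem: "(\<And>n::nat. \<Phi> n \<in> M) \<Longrightarrow> f \<in> DL1 \<Longrightarrow>
      (\<And>j. (\<lambda>n. N1 (\<lambda>t. nderiv j f t - nderiv j (\<Phi> n) t)) \<longlonglongrightarrow> 0) \<Longrightarrow> f \<in> M"
begin

definition zeros :: "real set" where
  "zeros = {w. \<forall>f\<in>M. fourier f w = 0}"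

lemma sum_mem: "finite I \<Longrightarrow> (\<And>i. i \<in> I \<Longrightarrow> f i \<in> M) \<Longrightarrow> (\<lambda>t. \<Sum>i\<in>I. f i t) \<in> M"
  by (induction I rule: finite_induct) (auto simp: zero_mem add_mem)

lemma closed_zeros: "closed zeros"
proof -
  have "zeros = (\<Inter>f\<in>M. fourier f -` {0})" by (auto simp: zeros_def)
  moreover have "closed (fourier f -` {0})" if "f \<in> M" for f
    using isCont_fourier[OF DL1_integrable[OF sub_DL1[OF that]]]
    by (intro continuous_closed_vimage closed_singleton) (simp_all add: continuous_at_imp_continuous_on)
  ultimately show ?thesis by auto
qed

text \<open>Riemann sums: a convolution is a limit of linear combinations of translates.\<close>

lemma conv_mem:
  assumes f: "f \<in> M" and g: "integrable lborel g"
  shows "conv f g \<in> M"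
proof -
  have f': "f \<in> DL1" by (rule sub_DL1[OF f])
  have [measurable]: "g \<in> borel_measurable borel" using g by auto
  have [measurable]: "nderiv j f \<in> borel_measurable borel" for j
    by (rule smooth_borel_measurable[OF DL1_smooth[OF f']])
  define N where "N n = real (Suc n)" for n
  \<comment> \<open>Mesh \<open>1 / N n\<close> on the window \<open>\<bar>r\<bar> \<le> N n\<close>
    takes \<open>N n\<close> squared nodes on each side of 0.\<close>
  define I where "I n = {- int ((Suc n)\<^sup>2)..int ((Suc n)\<^sup>2)}" for n
  define c where "c n k = (LINT r|lborel. (if \<lfloor>N n * r\<rfloor> = k then g r else 0))" for n k
  define \<Phi> where "\<Phi> n = (\<lambda>t. \<Sum>k\<in>I n. c n k * f (t + - (of_int k / N n)))" for n
  have N_pos: "N n > 0" for n by (simp add: N_def)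
  have fin: "finite (I n)" for n by (simp add: I_def)
  have mem: "\<Phi> n \<in> M" for n
    unfolding \<Phi>_def by (intro sum_mem fin cmult_mem shift_mem f)
  have nd: "nderiv j (\<Phi> n) = (\<lambda>t. \<Sum>k\<in>I n. c n k * nderiv j f (t + - (of_int k / N n)))" for n j
    unfolding \<Phi>_def
    by (simp add: nderiv_sum fin nderiv_cmult nderiv_shift smooth_cmult smooth_shift DL1_smooth[OF f']
        del: add_uminus_conv_diff)
  \<comment> \<open>\<open>d\<close> rounds down to the grid and \<open>s\<close> cuts off outside
    the window. In these terms the Riemann sum is itself an integral against \<open>g\<close> and
    can be compared with the convolution under one integral sign.\<close>
  define s where "s n r = (if \<lfloor>N n * r\<rfloor> \<in> I n then 1 else 0 :: real)" for n r
  define d where "d n r = of_int \<lfloor>N n * r\<rfloor> / N n" for n r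
  have [measurable]: "s n \<in> borel_measurable borel" "d n \<in> borel_measurable borel" for n
    unfolding s_def d_def by measurable
  let ?k = "\<lambda>j n r t. (nderiv j f (t - r) - of_real (s n r) * nderiv j f (t - d n r)) * g r"
  have eq: "(\<lambda>t. nderiv j (conv f g) t - nderiv j (\<Phi> n) t) = (\<lambda>t. LINT r|lborel. ?k j n r t)" for j n
  proof
    fix t
    have int_c: "integrable lborel (\<lambda>r. if \<lfloor>N n * r\<rfloor> = k then g r else 0)" for k
      by (rule Bochner_Integration.integrable_bound[OF g]) auto
    have B: "cmod (nderiv j f t) \<le> N1 (nderiv j f) + N1 (nderiv 1 (nderiv j f))" for t
      by (rule DL1_bound[OF DL1_nderiv[OF f']])
    have "nderiv j (\<Phi> n) t =
        (\<Sum>k\<in>I n. LINT r|lborel. (if \<lfloor>N n * r\<rfloor> = k then g r else 0) * nderiv j f (t - of_int k / N n))"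
      unfolding nd c_def using int_c by simp
    also have "\<dots> = (LINT r|lborel. (\<Sum>k\<in>I n. (if \<lfloor>N n * r\<rfloor> = k then g r else 0) * nderiv j f (t - of_int k / N n)))"
      by (rule Bochner_Integration.integral_sum[symmetric]) (simp add: int_c)
    also have "\<dots> = (LINT r|lborel. of_real (s n r) * nderiv j f (t - d n r) * g r)"
    proof (intro Bochner_Integration.integral_cong refl)
      fix r
      have "(\<Sum>k\<in>I n. (if \<lfloor>N n * r\<rfloor> = k then g r else 0) * nderiv j f (t - of_int k / N n)) =
          (\<Sum>k\<in>I n. if \<lfloor>N n * r\<rfloor> = k then g r * nderiv j f (t - of_int k / N n) else 0)"
        by (intro sum.cong refl) simp
      then show "(\<Sum>k\<in>I n. (if \<lfloor>N n * r\<rfloor> = k then g r else 0) * nderiv j f (t - of_int k / N n)) =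
          of_real (s n r) * nderiv j f (t - d n r) * g r"
        by (simp add: fin s_def d_def)
    qed
    finally have \<Phi>: "nderiv j (\<Phi> n) t = (LINT r|lborel. of_real (s n r) * nderiv j f (t - d n r) * g r)" .
    have i1: "integrable lborel (\<lambda>r. nderiv j f (t - r) * g r)"
      by (rule integrable_conv_pointwise[OF smooth_nderiv[OF DL1_smooth[OF f']] B g])
    have i2: "integrable lborel (\<lambda>r. of_real (s n r) * nderiv j f (t - d n r) * g r)"
    proof (rule Bochner_Integration.integrable_bound)
      show "integrable lborel (\<lambda>r. (N1 (nderiv j f) + N1 (nderiv 1 (nderiv j f))) * cmod (g r))"
        using g by simp
      show "AE r in lborel. norm (of_real (s n r) * nderiv j f (t - d n r) * g r) \<le>
          norm ((N1 (nderiv j f) + N1 (nderiv 1 (nderiv j f))) * cmod (g r))"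
        using B N1_nonneg[of "nderiv j f"] N1_nonneg[of "nderiv 1 (nderiv j f)"]
        by (intro AE_I2) (auto simp: norm_mult s_def intro!: mult_right_mono)
    qed measurable
    show "nderiv j (conv f g) t - nderiv j (\<Phi> n) t = (LINT r|lborel. ?k j n r t)"
      unfolding \<Phi> nderiv_conv[OF f' g] conv_def left_diff_distrib
      by (rule Bochner_Integration.integral_diff[symmetric, OF i1 i2])
  qed
  have int_shift: "integrable lborel (\<lambda>t. nderiv j f (t - r))" for j r
    using integrable_shift[OF DL1_nderiv_integrable[OF f'], of j "- r"] by simp
  have Nk: "N1 (?k j n r) = N1 (\<lambda>t. nderiv j f (t - r) - of_real (s n r) * nderiv j f (t - d n r)) * cmod (g r)" for j n r
    using N1_cmult[of "g r" "\<lambda>t. nderiv j f (t - r) - of_real (s n r) * nderiv j f (t - d n r)"]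
    by (simp add: mult.commute)
  have Nk_le: "N1 (?k j n r) \<le> 2 * N1 (nderiv j f) * cmod (g r)" for j n r
    unfolding Nk
  proof (rule mult_right_mono)
    have "N1 (\<lambda>t. nderiv j f (t - r) - of_real (s n r) * nderiv j f (t - d n r)) \<le>
        N1 (\<lambda>t. nderiv j f (t - r)) + N1 (\<lambda>t. of_real (s n r) * nderiv j f (t - d n r))"
      by (intro N1_diff int_shift integrable_mult_right)
    also have "\<dots> \<le> 2 * N1 (nderiv j f)"
      unfolding N1_cmult N1_shift_minus by (simp add: s_def N1_nonneg)
    finally show "N1 (\<lambda>t. nderiv j f (t - r) - of_real (s n r) * nderiv j f (t - d n r)) \<le> 2 * N1 (nderiv j f)" .
  qed simp
  have meas: "(\<lambda>(r, t). ?k j n r t) \<in> borel_measurable (borel \<Otimes>\<^sub>M borel)" for j n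
    by measurable
  have [measurable]: "(\<lambda>r. N1 (?k j n r)) \<in> borel_measurable borel" for j n
    using meas unfolding N1_def by measurable
  show "conv f g \<in> M"
  proof (rule closed_mem[of \<Phi>])
    fix j
    have lim: "(\<lambda>n. LINT r|lborel. N1 (?k j n r)) \<longlonglongrightarrow> (LINT r|(lborel :: real measure). 0 :: real)"
    proof (rule integral_dominated_convergence[where w = "\<lambda>r. 2 * N1 (nderiv j f) * cmod (g r)"])
      \<comment> \<open>For fixed \<open>r\<close> the window eventually contains \<open>r\<close>;
        then the rounding error, at most \<open>1 / N n\<close>, enters through
        \<open>N1_difference\<close> at the price of one derivative.\<close>
      show "AE r in lborel. (\<lambda>n. N1 (?k j n r)) \<longlonglongrightarrow> 0"
      proof (rule AE_I2, rule Lim_null_comparison)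
        fix r :: real
        obtain n0 :: nat where n0: "\<bar>r\<bar> \<le> real n0" using real_arch_simple by blast
        show "\<forall>\<^sub>F n in sequentially. norm (N1 (?k j n r)) \<le> (1 / N n) * (N1 (nderiv (Suc j) f) * cmod (g r))"
          using eventually_ge_at_top[of n0]
        proof eventually_elim
          case (elim n)
          then have r: "\<bar>r\<bar> \<le> N n" using n0 by (simp add: N_def)
          then have "\<bar>N n * r\<bar> \<le> N n * N n"
            using N_pos[of n] by (simp add: abs_mult)
          also have "N n * N n = of_int (int ((Suc n)\<^sup>2))"
            by (simp add: N_def power2_eq_square algebra_simps)
          finally have "\<lfloor>N n * r\<rfloor> \<in> I n"
            unfolding I_def by (simp add: le_floor_iff floor_le_iff abs_le_iff del: of_int_of_nat_eq)
          then have s: "s n r = 1" by (simp add: s_def)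
          let ?d = "r - d n r"
          have "\<bar>N n * r - of_int \<lfloor>N n * r\<rfloor>\<bar> \<le> 1" by linarith
          then have "\<bar>N n * r - of_int \<lfloor>N n * r\<rfloor>\<bar> / N n \<le> 1 / N n"
            using less_imp_le[OF N_pos[of n]] by (rule divide_right_mono)
          moreover have "?d = (N n * r - of_int \<lfloor>N n * r\<rfloor>) / N n"
            using N_pos[of n] by (simp add: d_def diff_divide_distrib)
          ultimately have d: "\<bar>?d\<bar> \<le> 1 / N n"
            using N_pos[of n] by (simp add: abs_divide)
          have "N1 (\<lambda>t. nderiv j f (t - r) - nderiv j f (t - d n r)) =
              N1 (\<lambda>t. nderiv j f (t + ?d - r) - nderiv j f (t - r))"
          proof -
            have "N1 (\<lambda>t. nderiv j f (t - r) - nderiv j f (t - d n r)) =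
               N1 (\<lambda>t. nderiv j f (t - d n r) - nderiv j f (t - r))"
              by (simp add: N1_def norm_minus_commute)
            then show ?thesis by simp
          qed
          also have "\<dots> = N1 (\<lambda>t. nderiv j f (t + ?d) - nderiv j f t)"
            using N1_shift_minus[of "\<lambda>t. nderiv j f (t + ?d) - nderiv j f t" r]
            by (simp add: algebra_simps)
          also have "\<dots> \<le> \<bar>?d\<bar> * N1 (nderiv 1 (nderiv j f))"
            by (rule N1_difference[OF DL1_nderiv[OF f']])
          also have "\<dots> \<le> (1 / N n) * N1 (nderiv 1 (nderiv j f))"
            using d by (rule mult_right_mono) (rule N1_nonneg)
          finally have "N1 (\<lambda>t. nderiv j f (t - r) - nderiv j f (t - d n r)) \<le>
              (1 / N n) * N1 (nderiv (Suc j) f)"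
            by (simp add: nderiv_nderiv)
          then have "N1 (\<lambda>t. nderiv j f (t - r) - nderiv j f (t - d n r)) * cmod (g r) \<le>
              (1 / N n) * N1 (nderiv (Suc j) f) * cmod (g r)"
            by (rule mult_right_mono) simp
          then show ?case
            unfolding real_norm_def abs_of_nonneg[OF N1_nonneg] unfolding Nk unfolding s by (simp add: mult.assoc)
        qed
        have "(\<lambda>n. 1 / N n) \<longlonglongrightarrow> 0"
          unfolding N_def by (rule LIMSEQ_Suc[OF lim_1_over_n])
        then show "(\<lambda>n. (1 / N n) * (N1 (nderiv (Suc j) f) * cmod (g r))) \<longlonglongrightarrow> 0"
          by (rule tendsto_mult_left_zero)
      qed
      show "integrable lborel (\<lambda>r. 2 * N1 (nderiv j f) * cmod (g r))" using g by simp
      show "AE r in lborel. norm (N1 (?k j n r)) \<le> 2 * N1 (nderiv j f) * cmod (g r)" for n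
        unfolding real_norm_def abs_of_nonneg[OF N1_nonneg] by (rule AE_I2[OF Nk_le])
      show "(\<lambda>r. N1 (?k j n r)) \<in> borel_measurable lborel" for n by measurable
    qed simp
    have le: "N1 (\<lambda>t. nderiv j (conv f g) t - nderiv j (\<Phi> n) t) \<le> (LINT r|lborel. N1 (?k j n r))" for n
      unfolding eq
    proof (rule kernel_minkowski[OF meas])
      show "integrable lborel (?k j n r)" for r
        by (intro integrable_mult_left Bochner_Integration.integrable_diff integrable_mult_right int_shift)
      show "integrable lborel (\<lambda>r. 2 * N1 (nderiv j f) * cmod (g r))" using g by simp
    qed (rule Nk_le)
    show "(\<lambda>n. N1 (\<lambda>t. nderiv j (conv f g) t - nderiv j (\<Phi> n) t)) \<longlonglongrightarrow> 0"
      by (rule tendsto_sandwich[OF _ _ tendsto_const lim[unfolded Bochner_Integration.integral_zero]])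
        (auto intro!: always_eventually N1_nonneg le)
  qed (rule mem, rule DL1_conv[OF f' g])
qed

section \<open>From Fourier support to membership: Wiener's lemma and its globalisation\<close>

lemma DL1_eq_by_fourier:
  assumes "f \<in> DL1" "g \<in> DL1" "\<And>w. fourier f w = fourier g w"
  shows "f = g"
proof
  fix t
  have "f t - g t = 0"
    by (rule DL1_fourier_unique[OF DL1_diff[OF assms(1,2)]])
      (simp add: fourier_diff assms DL1_integrable)
  then show "f t = g t" by simp
qed

text \<open>Wiener's lemma: \<open>\<eta>\<close> is recovered from \<open>\<phi> * \<eta>\<close> by a Neumann series, where
  \<open>\<phi>\<close> has Fourier transform \<open>1\<close> at \<open>w\<close>.\<close>

lemma local_mem:
  assumes "\<phi> \<in> M" "fourier \<phi> w \<noteq> 0"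
  shows "\<exists>e>0. \<forall>\<eta>\<in>DL1. (\<forall>s. e < \<bar>s - w\<bar> \<longrightarrow> fourier \<eta> s = 0) \<longrightarrow> \<eta> \<in> M"
proof -
  define \<psi> where "\<psi> = (\<lambda>t. inverse (fourier \<phi> w) * \<phi> t)"
  have \<psi>: "\<psi> \<in> M" "fourier \<psi> w = 1"
    unfolding \<psi>_def fourier_cmult using assms by (auto intro: cmult_mem)
  have \<psi>_int: "integrable lborel \<psi>" by (rule DL1_integrable[OF sub_DL1[OF \<psi>(1)]])
  define p where "p n = plateau w (1 / real (Suc n)) (2 * (1 / real (Suc n)))" for n
  define u where "u n = (\<lambda>t. p n t - conv (p n) \<psi> t)" for n
  have "(\<lambda>n. N1 (u n)) \<longlonglongrightarrow> 0"
    unfolding u_def p_def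
    by (rule plateau_conv_tendsto[OF \<psi>_int \<psi>(2)]) (simp, rule LIMSEQ_Suc[OF lim_1_over_n])
  \<comment> \<open>Norm below 1 makes the Neumann series converge. The scale of this kernel becomes
    the radius \<open>e\<close>, because within it \<open>fourier (p n)\<close> equals 1.\<close>
  from order_tendstoD(2)[OF this, of 1] obtain n where n: "N1 (u n) < 1"
    by (auto simp: eventually_sequentially)
  define e where "e = 1 / real (Suc n)"
  have e: "e > 0" by (simp add: e_def)
  have p_int: "integrable lborel (p n)" unfolding p_def by (rule plateau_integrable)
  have u_int: "integrable lborel (u n)"
    unfolding u_def by (intro Bochner_Integration.integrable_diff p_int conv_integrable \<psi>_int)
  have u_fourier: "fourier (u n) s = 1 - fourier \<psi> s" if "\<bar>s - w\<bar> \<le> e" for s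
  proof -
    have "fourier (p n) s = 1"
      unfolding p_def e_def[symmetric] by (rule fourier_plateau_eq_1) (use that e in auto)
    then show ?thesis
      unfolding u_def by (simp add: fourier_diff p_int conv_integrable \<psi>_int fourier_conv)
  qed
  have "\<eta> \<in> M" if \<eta>: "\<eta> \<in> DL1" "\<And>s. e < \<bar>s - w\<bar> \<Longrightarrow> fourier \<eta> s = 0" for \<eta>
  proof -
    \<comment> \<open>\<open>H k\<close> is \<open>\<eta>\<close> convolved \<open>k\<close> times
      with \<open>u n\<close>. The series telescopes through \<open>H k - H (Suc k)\<close>, and
      \<open>H k\<close> decays geometrically in every seminorm.\<close>
    define H where "H k = ((\<lambda>f. conv f (u n)) ^^ k) \<eta>" for k
    have H_Suc: "H (Suc k) = conv (H k) (u n)" for k by (simp add: H_def)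
    have H: "H k \<in> DL1" "\<And>s. e < \<bar>s - w\<bar> \<Longrightarrow> fourier (H k) s = 0" for k
    proof (induction k)
      case (Suc k)
      { case 1 show ?case unfolding H_Suc by (rule DL1_conv[OF Suc(1) u_int]) }
      { case 2 then show ?case
          unfolding H_Suc fourier_conv[OF DL1_integrable[OF Suc(1)] u_int] by (simp add: Suc) }
    qed (simp_all add: H_def \<eta>)
    \<comment> \<open>Checked on the Fourier side: within distance \<open>e\<close> of
      \<open>w\<close> the transform of \<open>u n\<close> is \<open>1 - fourier \<psi> s\<close>,
      and elsewhere both sides vanish together with \<open>fourier (H k)\<close>.\<close>
    have step: "(\<lambda>t. H k t - H (Suc k) t) = conv \<psi> (H k)" for k
    proof (rule DL1_eq_by_fourier)
      show "(\<lambda>t. H k t - H (Suc k) t) \<in> DL1" by (intro DL1_diff H)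
      show "conv \<psi> (H k) \<in> DL1" by (intro DL1_conv sub_DL1 \<psi> DL1_integrable H)
      fix s
      have "fourier (\<lambda>t. H k t - H (Suc k) t) s = fourier (H k) s - fourier (H k) s * fourier (u n) s"
        by (simp add: fourier_diff DL1_integrable H H_Suc[symmetric])
          (simp add: H_Suc fourier_conv DL1_integrable H u_int)
      also have "\<dots> = fourier \<psi> s * fourier (H k) s"
      proof (cases "\<bar>s - w\<bar> \<le> e")
        case True
        then show ?thesis by (simp add: u_fourier algebra_simps)
      qed (simp add: H(2))
      finally show "fourier (\<lambda>t. H k t - H (Suc k) t) s = fourier (conv \<psi> (H k)) s"
        by (simp add: fourier_conv \<psi>_int DL1_integrable H)
    qed
    have part: "(\<lambda>t. \<eta> t - H k t) \<in> M" for k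
    proof (induction k)
      case (Suc k)
      have "(\<lambda>t. H k t - H (Suc k) t) \<in> M"
        unfolding step by (intro conv_mem \<psi> DL1_integrable H)
      from add_mem[OF Suc this] show ?case by simp
    qed (simp add: H_def zero_mem)
    have N: "N1 (nderiv j (H k)) \<le> N1 (nderiv j \<eta>) * N1 (u n) ^ k" for j k
    proof (induction k)
      case (Suc k)
      have "N1 (nderiv j (H (Suc k))) \<le> N1 (nderiv j (H k)) * N1 (u n)"
        unfolding H_Suc nderiv_conv[OF H(1) u_int]
        by (rule N1_conv[OF DL1_nderiv_integrable[OF H(1)] u_int])
      also have "\<dots> \<le> N1 (nderiv j \<eta>) * N1 (u n) ^ k * N1 (u n)"
        by (intro mult_right_mono Suc N1_nonneg)
      finally show ?case by (simp add: mult_ac)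
    qed (simp add: H_def)
    show ?thesis
    proof (rule closed_mem[OF part \<eta>(1)])
      fix j
      have eq: "(\<lambda>t. nderiv j \<eta> t - nderiv j (\<lambda>t. \<eta> t - H k t) t) = nderiv j (H k)" for k
        by (subst nderiv_diff) (simp_all add: DL1_smooth \<eta> H)
      have lim: "(\<lambda>k. N1 (nderiv j \<eta>) * N1 (u n) ^ k) \<longlonglongrightarrow> 0"
        by (intro tendsto_mult_right_zero LIMSEQ_realpow_zero N1_nonneg n)
      show "(\<lambda>k. N1 (\<lambda>t. nderiv j \<eta> t - nderiv j (\<lambda>t. \<eta> t - H k t) t)) \<longlonglongrightarrow> 0"
        unfolding eq
        by (rule tendsto_sandwich[OF _ _ tendsto_const lim])
          (auto intro!: always_eventually N1_nonneg N)
    qed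
  qed
  with e show ?thesis by blast
qed

text \<open>Bisection of the frequency axis plays the part of a finite subcover with a partition of
  unity. Membership for transforms living over short intervals is a local property, and a plateau
  kernel splits a function living over two adjacent intervals.\<close>

lemma compact_mem:
  assumes Z: "compact Z" "Z \<inter> zeros = {}"
    and \<eta>: "\<eta> \<in> DL1" "\<And>s. s \<notin> Z \<Longrightarrow> fourier \<eta> s = 0"
  shows "\<eta> \<in> M"
proof -
  obtain R where R: "R \<ge> 0" "\<And>s. s \<in> Z \<Longrightarrow> \<bar>s\<bar> \<le> R"
    using compact_imp_bounded[OF Z(1)] by (auto simp: bounded_pos intro: less_imp_le)
  \<comment> \<open>The margin \<open>d\<close> gives a trapezoid room to fall from 1 to 0, so that
    the two pieces of a split may overlap.\<close>
  define P where "P a b \<longleftrightarrow> (\<exists>d>0. \<forall>\<eta>\<in>DL1. (\<forall>s. s \<notin> Z \<inter> {a - d..b + d} \<longrightarrow> fourier \<eta> s = 0) \<longrightarrow> \<eta> \<in> M)"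
    for a b
  have "- R \<le> R" using R by simp
  then have "P (- R) R"
  proof (induction rule: Bolzano)
    case (trans a b c)
    from trans(1,2) obtain d1 d2 where d: "d1 > 0" "d2 > 0"
      and d1: "\<And>\<eta>. \<eta> \<in> DL1 \<Longrightarrow> (\<And>s. s \<notin> Z \<inter> {a - d1..b + d1} \<Longrightarrow> fourier \<eta> s = 0) \<Longrightarrow> \<eta> \<in> M"
      and d2: "\<And>\<eta>. \<eta> \<in> DL1 \<Longrightarrow> (\<And>s. s \<notin> Z \<inter> {b - d2..c + d2} \<Longrightarrow> fourier \<eta> s = 0) \<Longrightarrow> \<eta> \<in> M"
      unfolding P_def by blast
    define d where "d = min d1 d2"
    have d: "d > 0" "d \<le> d1" "d \<le> d2" using d by (auto simp: d_def)
    have "\<eta> \<in> M" if \<eta>: "\<eta> \<in> DL1" "\<And>s. s \<notin> Z \<inter> {a - d..c + d} \<Longrightarrow> fourier \<eta> s = 0" for \<eta>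
    proof -
      \<comment> \<open>The transform of \<open>g\<close> is 1 on \<open>{a - d..b}\<close> and 0
        beyond \<open>b + d\<close>. Hence the transform of \<open>conv \<eta> g\<close> lives over
        \<open>{a - d..b + d}\<close>, that of the remainder over \<open>{b..c + d}\<close>.\<close>
      define g where "g = plateau ((a - d + b) / 2) ((b - a + d) / 2) ((b - a + d) / 2 + d)"
      have g: "integrable lborel g" unfolding g_def by (rule plateau_integrable)
      have g1: "fourier g s = 1" if "a - d \<le> s" "s \<le> b" for s
        unfolding g_def by (rule fourier_plateau_eq_1) (use that d trans in \<open>auto simp: abs_le_iff field_simps\<close>)
      have g0: "fourier g s = 0" if "b + d < s" for s
        unfolding g_def by (rule fourier_plateau_eq_0) (use that d trans in \<open>auto simp: abs_if field_simps\<close>)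
      have int: "integrable lborel \<eta>" by (rule DL1_integrable[OF \<eta>(1)])
      have 1: "conv \<eta> g \<in> M"
      proof (rule d1)
        show "conv \<eta> g \<in> DL1" by (rule DL1_conv[OF \<eta>(1) g])
        fix s assume s: "s \<notin> Z \<inter> {a - d1..b + d1}"
        show "fourier (conv \<eta> g) s = 0"
          unfolding fourier_conv[OF int g]
          using s \<eta>(2)[of s] g0[of s] d by (cases "b + d < s") auto
      qed
      have 2: "(\<lambda>t. \<eta> t - conv \<eta> g t) \<in> M"
      proof (rule d2)
        show "(\<lambda>t. \<eta> t - conv \<eta> g t) \<in> DL1" by (intro DL1_diff DL1_conv \<eta> g)
        fix s assume s: "s \<notin> Z \<inter> {b - d2..c + d2}"
        have "fourier \<eta> s = 0 \<or> fourier g s = 1"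
          using s \<eta>(2)[of s] g1[of s] d trans(3,4) by (cases "s \<le> b"; cases "a - d \<le> s") auto
        then show "fourier (\<lambda>t. \<eta> t - conv \<eta> g t) s = 0"
          by (auto simp: fourier_diff int conv_integrable g fourier_conv)
      qed
      from add_mem[OF 1 2] show ?thesis by simp
    qed
    with d(1) show ?case unfolding P_def by blast
  next
    \<comment> \<open>At points of \<open>Z\<close> Wiener's lemma applies. Near other points the
      interval misses \<open>Z\<close>, so the transform vanishes identically and uniqueness gives
      the zero function.\<close>
    case (local x)
    show ?case
    proof (cases "x \<in> Z")
      case True
      with Z obtain \<phi> where "\<phi> \<in> M" "fourier \<phi> x \<noteq> 0" unfolding zeros_def by blast
      from local_mem[OF this] obtain e where e: "e > 0"
        "\<And>\<eta>. \<eta> \<in> DL1 \<Longrightarrow> (\<And>s. e < \<bar>s - x\<bar> \<Longrightarrow> fourier \<eta> s = 0) \<Longrightarrow> \<eta> \<in> M" by blast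
      have "P a b" if ab: "a \<le> x" "x \<le> b" "b - a < e / 2" for a b
        unfolding P_def
      proof (intro exI[of _ "e / 2"] conjI ballI impI)
        fix \<eta> assume "\<eta> \<in> DL1" "\<forall>s. s \<notin> Z \<inter> {a - e / 2..b + e / 2} \<longrightarrow> fourier \<eta> s = 0"
        then show "\<eta> \<in> M"
          using ab by (intro e(2)) (auto simp: abs_if split: if_splits)
      qed (use e in simp)
      with e(1) show ?thesis by (intro exI[of _ "e / 2"]) auto
    next
      case False
      have "open (- Z)" using compact_imp_closed[OF Z(1)] by auto
      with False obtain e where e: "e > 0" "\<And>y. \<bar>y - x\<bar> < e \<Longrightarrow> y \<notin> Z"
        unfolding open_dist dist_real_def by blast
      have "P a b" if ab: "a \<le> x" "x \<le> b" "b - a < e / 2" for a b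
        unfolding P_def
      proof (intro exI[of _ "e / 4"] conjI ballI impI)
        fix \<eta> assume \<eta>: "\<eta> \<in> DL1" "\<forall>s. s \<notin> Z \<inter> {a - e / 4..b + e / 4} \<longrightarrow> fourier \<eta> s = 0"
        have "s \<notin> Z \<inter> {a - e / 4..b + e / 4}" for s
        proof
          assume s: "s \<in> Z \<inter> {a - e / 4..b + e / 4}"
          then have "a - e / 4 \<le> s" "s \<le> b + e / 4" by auto
          then have "\<bar>s - x\<bar> < e" using ab e(1) by linarith
          with e(2) s show False by blast
        qed
        with \<eta> have "\<eta> = (\<lambda>_. 0)"
          by (intro DL1_eq_by_fourier DL1_zero) (simp_all add: fourier_def)
        then show "\<eta> \<in> M" by (simp add: zero_mem)
      qed (use e in simp)
      with e(1) show ?thesis by (intro exI[of _ "e / 2"]) auto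
    qed
  qed
  then obtain d where d: "d > 0"
    "\<And>\<eta>. \<eta> \<in> DL1 \<Longrightarrow> (\<And>s. s \<notin> Z \<inter> {- R - d..R + d} \<Longrightarrow> fourier \<eta> s = 0) \<Longrightarrow> \<eta> \<in> M"
    unfolding P_def by blast
  show ?thesis
  proof (rule d(2)[OF \<eta>(1)])
    fix s assume "s \<notin> Z \<inter> {- R - d..R + d}"
    then have "s \<notin> Z" using R(2)[of s] d(1) by auto
    then show "fourier \<eta> s = 0" by (rule \<eta>(2))
  qed
qed

text \<open>Single points are sets of spectral synthesis. Removing from \<open>?\<zeta>\<close> its
  convolution with a narrow plateau at \<open>w\<close> leaves a transform supported off the zeros,
  and the removed part is small because the twisted difference can be moved from
  \<open>\<eta>\<close> to the plateau.\<close>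

lemma isolated_difference_mem:
  assumes r: "r > 0" "\<And>s. s \<in> zeros \<Longrightarrow> \<bar>s - w\<bar> \<le> r \<Longrightarrow> s = w"
    and \<eta>: "\<eta> \<in> DL1" "\<And>s. r \<le> \<bar>s - w\<bar> \<Longrightarrow> fourier \<eta> s = 0"
  shows "(\<lambda>t. cis (- (w * h)) * \<eta> (t + h) - \<eta> t) \<in> M" (is "?\<zeta> \<in> M")
proof -
  define e where "e n = 1 / real (Suc n)" for n
  have e: "e n > 0" for n by (simp add: e_def)
  define p where "p n = plateau w (e n) (2 * e n)" for n
  have p_int: "integrable lborel (p n)" for n unfolding p_def by (rule plateau_integrable)
  define v where "v n = (\<lambda>t. cis (- (w * h)) * p n (t + h) - p n t)" for n
  have v_int: "integrable lborel (v n)" for n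
    unfolding v_def by (intro Bochner_Integration.integrable_diff integrable_mult_right integrable_shift p_int)
  have \<zeta>: "?\<zeta> \<in> DL1" by (intro DL1_diff DL1_cmult DL1_shift \<eta>)
  have twist: "fourier (\<lambda>t. cis (- (w * h)) * f (t + h) - f t) s = (cis (- (w * h)) * cis (s * h) - 1) * fourier f s"
    if "integrable lborel f" for f s
  proof -
    have "fourier (\<lambda>t. cis (- (w * h)) * f (t + h) - f t) s =
        fourier (\<lambda>t. cis (- (w * h)) * f (t + h)) s - fourier f s"
      by (intro fourier_diff integrable_mult_right integrable_shift that)
    then show ?thesis by (simp add: fourier_cmult fourier_shift left_diff_distrib)
  qed
  have v_fourier: "fourier (v n) s = (cis (- (w * h)) * cis (s * h) - 1) * fourier (p n) s" for n s
    unfolding v_def by (rule twist[OF p_int])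
  \<comment> \<open>A twisted difference multiplies the transform by a factor depending only on
    \<open>s\<close>, so it may act on either member of the convolution.\<close>
  have conv_eq: "conv ?\<zeta> (p n) = conv \<eta> (v n)" for n
  proof (rule DL1_eq_by_fourier)
    show "conv ?\<zeta> (p n) \<in> DL1" by (rule DL1_conv[OF \<zeta> p_int])
    show "conv \<eta> (v n) \<in> DL1" by (rule DL1_conv[OF \<eta>(1) v_int])
    fix s
    show "fourier (conv ?\<zeta> (p n)) s = fourier (conv \<eta> (v n)) s"
      unfolding fourier_conv[OF DL1_integrable[OF \<zeta>] p_int] fourier_conv[OF DL1_integrable[OF \<eta>(1)] v_int]
        v_fourier twist[OF DL1_integrable[OF \<eta>(1)]] by simp
  qed
  define \<Phi> where "\<Phi> n = (\<lambda>t. ?\<zeta> t - conv ?\<zeta> (p n) t)" for n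
  have mem: "\<Phi> n \<in> M" for n
  proof (rule compact_mem)
    \<comment> \<open>An annulus: the inner radius excludes \<open>w\<close>, the outer one stays
      within the range where \<open>w\<close> is the only possible zero.\<close>
    let ?Z = "{s. e n \<le> \<bar>s - w\<bar>} \<inter> {s. \<bar>s - w\<bar> \<le> r}"
    have "closed ?Z"
      by (intro closed_Int closed_Collect_le continuous_intros)
    moreover have "bounded ?Z"
      by (rule bounded_subset[OF bounded_cball[of w r]]) (auto simp: dist_real_def abs_minus_commute)
    ultimately show "compact ?Z" by (simp add: compact_eq_bounded_closed)
    have "s \<notin> zeros" if "e n \<le> \<bar>s - w\<bar>" "\<bar>s - w\<bar> \<le> r" for s
      using r(2)[of s] that e[of n] by auto
    then show "?Z \<inter> zeros = {}" by blast
    show "\<Phi> n \<in> DL1"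
      unfolding \<Phi>_def by (rule DL1_diff[OF \<zeta> DL1_conv[OF \<zeta> p_int]])
    fix s assume s: "s \<notin> ?Z"
    have F: "fourier (\<Phi> n) s = (cis (- (w * h)) * cis (s * h) - 1) * fourier \<eta> s * (1 - fourier (p n) s)"
      unfolding \<Phi>_def fourier_diff[OF DL1_integrable[OF \<zeta>] conv_integrable[OF DL1_integrable[OF \<zeta>] p_int]]
        fourier_conv[OF DL1_integrable[OF \<zeta>] p_int] twist[OF DL1_integrable[OF \<eta>(1)]]
      by (simp add: right_diff_distrib)
    show "fourier (\<Phi> n) s = 0"
    proof (cases "\<bar>s - w\<bar> \<le> e n")
      case True
      then have "fourier (p n) s = 1"
        unfolding p_def by (intro fourier_plateau_eq_1) (use e[of n] in auto)
      then show ?thesis unfolding F by simp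
    next
      case False
      then have "fourier \<eta> s = 0" using s by (intro \<eta>(2)) auto
      then show ?thesis unfolding F by simp
    qed
  qed
  show ?thesis
  proof (rule closed_mem[OF mem \<zeta>])
    fix j
    have eq: "(\<lambda>t. nderiv j ?\<zeta> t - nderiv j (\<Phi> n) t) = conv (nderiv j \<eta>) (v n)" for n
      unfolding \<Phi>_def nderiv_diff[OF DL1_smooth[OF \<zeta>] DL1_smooth[OF DL1_conv[OF \<zeta> p_int]]]
      unfolding conv_eq nderiv_conv[OF \<eta>(1) v_int] by simp
    have N: "N1 (conv (nderiv j \<eta>) (v n)) \<le> N1 (nderiv j \<eta>) * N1 (v n)" for n
      by (rule N1_conv[OF DL1_nderiv_integrable[OF \<eta>(1)] v_int])
    have Nv: "N1 (v n) = N1 (\<lambda>t. trap 1 2 (t + e n * h) - trap 1 2 t)" for n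
      unfolding v_def p_def by (rule plateau_shift_N1[OF e])
    have "(\<lambda>n. e n * h) \<longlonglongrightarrow> 0"
      unfolding e_def by (intro tendsto_mult_left_zero LIMSEQ_Suc[OF lim_1_over_n])
    then have "(\<lambda>n. N1 (v n)) \<longlonglongrightarrow> 0"
      unfolding Nv by (rule trap_shift_tendsto)
    then have lim: "(\<lambda>n. N1 (nderiv j \<eta>) * N1 (v n)) \<longlonglongrightarrow> 0"
      by (rule tendsto_mult_right_zero)
    show "(\<lambda>n. N1 (\<lambda>t. nderiv j ?\<zeta> t - nderiv j (\<Phi> n) t)) \<longlonglongrightarrow> 0"
      unfolding eq
      by (rule tendsto_sandwich[OF _ _ tendsto_const lim])
        (auto intro!: always_eventually N1_nonneg N)
  qed
qed

text \<open>Without zeros every compact frequency set is admissible, so convolutions of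
  \<open>f\<close> with Fejer kernels lie in \<open>M\<close>; with growing scale these kernels form
  an approximate identity.\<close>

lemma all_mem:
  assumes "zeros = {}" and f: "f \<in> DL1"
  shows "f \<in> M"
proof -
  define N where "N n = real (Suc n)" for n
  have N_pos: "N n > 0" for n by (simp add: N_def)
  define p where "p n = plateau 0 0 (N n)" for n
  have p_int: "integrable lborel (p n)" for n unfolding p_def by (rule plateau_integrable)
  have p_eq: "p n t = of_real (N n) * trap 0 1 (N n * t)" for n t
    using trap_scale[OF N_pos, of n 0 1 t] by (simp add: p_def plateau_def)
  have mem: "conv f (p n) \<in> M" for n
  proof (rule compact_mem)
    show "conv f (p n) \<in> DL1" by (rule DL1_conv[OF f p_int])
    fix s assume "s \<notin> {- N n..N n}"
    then have "fourier (p n) s = 0"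
      unfolding p_def by (intro fourier_plateau_eq_0) (use N_pos[of n] in \<open>auto simp: abs_if\<close>)
    then show "fourier (conv f (p n)) s = 0"
      by (simp add: fourier_conv DL1_integrable[OF f] p_int)
  qed (simp_all add: assms)
  show ?thesis
  proof (rule closed_mem[OF mem f])
    fix j
    let ?f = "nderiv j f"
    have f': "?f \<in> DL1" by (rule DL1_nderiv[OF f])
    have [measurable]: "?f \<in> borel_measurable borel"
      by (rule smooth_borel_measurable[OF DL1_smooth[OF f]])
    let ?k = "\<lambda>n u t. (?f t - ?f (t + - (u / N n))) * trap 0 1 u"
    have eq: "(\<lambda>t. ?f t - nderiv j (conv f (p n)) t) = (\<lambda>t. LINT u|lborel. ?k n u t)" for n
    proof
      fix t
      have "nderiv j (conv f (p n)) t = (LINT r|lborel. ?f (t - r) * p n r)"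
        unfolding nderiv_conv[OF f p_int] conv_def ..
      also have "\<dots> = \<bar>1 / N n\<bar> *\<^sub>R (LINT u|lborel. ?f (t - (0 + 1 / N n * u)) * p n (0 + 1 / N n * u))"
        using N_pos[of n] by (intro lborel_integral_real_affine) simp
      also have "\<dots> = \<bar>1 / N n\<bar> *\<^sub>R (LINT u|lborel. of_real (N n) * (?f (t + - (u / N n)) * trap 0 1 u))"
        using N_pos[of n] unfolding p_eq by (simp add: mult_ac)
      also have "\<dots> = (LINT u|lborel. ?f (t + - (u / N n)) * trap 0 1 u)"
        using N_pos[of n] by (simp add: scaleR_conv_of_real)
      finally have nd: "nderiv j (conv f (p n)) t = (LINT u|lborel. ?f (t + - (u / N n)) * trap 0 1 u)" .
      have "fourier (trap 0 1) 0 = 1" by (subst fourier_trap) auto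
      then have one: "(LINT u|lborel. trap 0 1 u) = 1" by (simp add: fourier_def)
      have i1: "integrable lborel (\<lambda>u. ?f t * trap 0 1 u)" by (intro integrable_mult_right trap_integrable)
      have i2: "integrable lborel (\<lambda>u. ?f (t + - (u / N n)) * trap 0 1 u)"
      proof (rule Bochner_Integration.integrable_bound)
        show "integrable lborel (\<lambda>u. (N1 ?f + N1 (nderiv 1 ?f)) * cmod (trap 0 1 u))"
          by (intro integrable_mult_right integrable_norm trap_integrable)
        show "AE u in lborel. norm (?f (t + - (u / N n)) * trap 0 1 u) \<le>
            norm ((N1 ?f + N1 (nderiv 1 ?f)) * cmod (trap 0 1 u))"
          using DL1_bound[OF f']
          by (intro AE_I2) (simp add: norm_mult mult_right_mono N1_nonneg abs_mult)
      qed measurable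
      show "?f t - nderiv j (conv f (p n)) t = (LINT u|lborel. ?k n u t)"
        unfolding nd left_diff_distrib Bochner_Integration.integral_diff[OF i1 i2] by (simp add: one)
    qed
    have Nk: "N1 (?k n u) = N1 (\<lambda>t. ?f (t + - (u / N n)) - ?f t) * cmod (trap 0 1 u)" for n u
    proof -
      have "N1 (?k n u) = N1 (\<lambda>t. trap 0 1 u * (?f (t + - (u / N n)) - ?f t))"
        by (simp add: N1_def norm_mult norm_minus_commute mult.commute)
      then show ?thesis unfolding N1_cmult by (simp add: mult.commute)
    qed
    have int_shift: "integrable lborel (\<lambda>t. ?f (t + a))" for a
      by (rule integrable_shift[OF DL1_integrable[OF f']])
    have Nk_le: "N1 (?k n u) \<le> 2 * N1 ?f * cmod (trap 0 1 u)" for n u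
      unfolding Nk
      using N1_diff[OF int_shift[of "- (u / N n)"] DL1_integrable[OF f']]
      by (intro mult_right_mono) (simp_all only: N1_shift norm_ge_zero)
    have meas: "(\<lambda>(u, t). ?k n u t) \<in> borel_measurable (borel \<Otimes>\<^sub>M borel)" for n
      by measurable
    have [measurable]: "(\<lambda>u. N1 (?k n u)) \<in> borel_measurable borel" for n
      using meas unfolding N1_def by measurable
    \<comment> \<open>The bound by \<open>\<bar>u\<bar> / N n\<close> serves only for pointwise
      convergence: \<open>\<bar>u\<bar>\<close> times the Fejer kernel is not integrable, so the
      majorant comes from the triangle inequality instead.\<close>
    have lim: "(\<lambda>n. LINT u|lborel. N1 (?k n u)) \<longlonglongrightarrow> (LINT u|(lborel :: real measure). 0 :: real)"
    proof (rule integral_dominated_convergence[where w = "\<lambda>u. 2 * N1 ?f * cmod (trap 0 1 u)"])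
      show "AE u in lborel. (\<lambda>n. N1 (?k n u)) \<longlonglongrightarrow> 0"
      proof (rule AE_I2, rule Lim_null_comparison)
        fix u :: real
        show "\<forall>\<^sub>F n in sequentially. norm (N1 (?k n u)) \<le>
            (1 / N n) * (\<bar>u\<bar> * N1 (nderiv 1 ?f) * cmod (trap 0 1 u))"
        proof (rule always_eventually, rule allI)
          fix n
          have "N1 (\<lambda>t. ?f (t + - (u / N n)) - ?f t) \<le> \<bar>- (u / N n)\<bar> * N1 (nderiv 1 ?f)"
            by (rule N1_difference[OF f'])
          then have "N1 (?k n u) \<le> \<bar>- (u / N n)\<bar> * N1 (nderiv 1 ?f) * cmod (trap 0 1 u)"
            unfolding Nk by (rule mult_right_mono) simp
          then show "norm (N1 (?k n u)) \<le> (1 / N n) * (\<bar>u\<bar> * N1 (nderiv 1 ?f) * cmod (trap 0 1 u))"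
            unfolding real_norm_def abs_of_nonneg[OF N1_nonneg] using N_pos[of n] by (simp add: abs_divide)
        qed
        have "(\<lambda>n. 1 / N n) \<longlonglongrightarrow> 0"
          unfolding N_def by (rule LIMSEQ_Suc[OF lim_1_over_n])
        then show "(\<lambda>n. (1 / N n) * (\<bar>u\<bar> * N1 (nderiv 1 ?f) * cmod (trap 0 1 u))) \<longlonglongrightarrow> 0"
          by (rule tendsto_mult_left_zero)
      qed
      show "integrable lborel (\<lambda>u. 2 * N1 ?f * cmod (trap 0 1 u))"
        by (intro integrable_mult_right integrable_norm trap_integrable)
      show "AE u in lborel. norm (N1 (?k n u)) \<le> 2 * N1 ?f * cmod (trap 0 1 u)" for n
        unfolding real_norm_def abs_of_nonneg[OF N1_nonneg] by (rule AE_I2[OF Nk_le])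
      show "(\<lambda>u. N1 (?k n u)) \<in> borel_measurable lborel" for n by measurable
    qed simp
    have le: "N1 (\<lambda>t. ?f t - nderiv j (conv f (p n)) t) \<le> (LINT u|lborel. N1 (?k n u))" for n
      unfolding eq
    proof (rule kernel_minkowski[OF meas])
      show "integrable lborel (?k n u)" for u
        by (intro integrable_mult_left Bochner_Integration.integrable_diff int_shift DL1_integrable[OF f'])
      show "integrable lborel (\<lambda>u. 2 * N1 ?f * cmod (trap 0 1 u))"
        by (intro integrable_mult_right integrable_norm trap_integrable)
    qed (rule Nk_le)
    show "(\<lambda>n. N1 (\<lambda>t. ?f t - nderiv j (conv f (p n)) t)) \<longlonglongrightarrow> 0"
      by (rule tendsto_sandwich[OF _ _ tendsto_const lim[unfolded Bochner_Integration.integral_zero]])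
        (intro always_eventually allI N1_nonneg le)+
  qed
qed

end

subsection \<open>Bounded distributions\<close>

lemma scaleC_one [simp]: "1 *\<^sub>C x = (x :: 'a::complex_banach)"
  using scaleR_eq_scaleC[of 1 x] by simp

lemma scaleC_zero_right [simp]: "c *\<^sub>C 0 = (0 :: 'a::complex_banach)"
  using scaleC_add_right[of c "0 :: 'a" 0] by simp

lemma scaleC_0_left [simp]: "0 *\<^sub>C x = (0 :: 'a::complex_banach)"
  using scaleR_eq_scaleC[of 0 x] by simp

lemma scaleC_minus_one [simp]: "(- 1) *\<^sub>C x = - (x :: 'a::complex_banach)"
  using scaleR_eq_scaleC[of "- 1" x] by simp

lemma bounded_linear_scaleC: "bounded_linear (\<lambda>x :: 'a::complex_banach. c *\<^sub>C x)"
proof (rule bounded_linear_intro[where K = "cmod c"])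
  show "c *\<^sub>C (r *\<^sub>R x) = r *\<^sub>R (c *\<^sub>C x)" for r and x :: 'a
    by (simp add: scaleR_eq_scaleC scaleC_scaleC mult.commute)
qed (simp_all add: scaleC_add_right norm_scaleC mult.commute)

lemma scaleC_diff_right: "c *\<^sub>C (x - y) = c *\<^sub>C x - c *\<^sub>C (y :: 'a::complex_banach)"
  by (rule linear_diff[OF bounded_linear.linear[OF bounded_linear_scaleC]])

lemma test_smooth: "\<phi> \<in> test_functions \<Longrightarrow> smooth \<phi>"
  by (simp add: test_functions_def)

lemma test_support:
  assumes "\<phi> \<in> test_functions"
  shows "\<exists>R>0. \<forall>t. R < \<bar>t\<bar> \<longrightarrow> \<phi> t = 0"
proof -
  from assms obtain K where K: "compact K" "\<And>t. t \<notin> K \<Longrightarrow> \<phi> t = 0"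
    by (auto simp: test_functions_def)
  obtain R where R: "R > 0" "\<And>t. t \<in> K \<Longrightarrow> norm t \<le> R"
    using compact_imp_bounded[OF K(1)] by (auto simp: bounded_pos)
  have "\<phi> t = 0" if "R < \<bar>t\<bar>" for t
    using R(2)[of t] that by (intro K(2)) auto
  with R(1) show ?thesis by blast
qed

lemma test_supportE:
  assumes "\<phi> \<in> test_functions"
  obtains R where "R > 0" "\<And>t. R < \<bar>t\<bar> \<Longrightarrow> \<phi> t = 0"
  using test_support[OF assms] that by (elim exE conjE) simp

lemma testI:
  assumes "smooth \<phi>" "\<And>t. R < \<bar>t\<bar> \<Longrightarrow> \<phi> t = 0"
  shows "\<phi> \<in> test_functions"
proof -
  have "\<phi> t = 0" if "t \<notin> {- R..R}" for t
    using assms(2)[of t] that by auto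
  with assms(1) show ?thesis
    unfolding test_functions_def by (auto intro!: exI[of _ "{- R..R}"])
qed

lemma test_nderiv_support:
  assumes "smooth \<phi>" "\<And>t. R < \<bar>t\<bar> \<Longrightarrow> \<phi> t = 0" "R < \<bar>t\<bar>"
  shows "nderiv j \<phi> t = 0"
proof (rule nderiv_eq_0[OF assms(1)])
  show "\<phi> s = 0" if "s \<notin> {- R..R}" for s
    using assms(2)[of s] that by auto
  show "t \<notin> {- R..R}" using assms(3) by auto
qed simp

lemma test_zero: "(\<lambda>_. 0) \<in> test_functions"
  by (rule testI[of _ 0]) (simp_all add: smooth_zero)

lemma test_add:
  assumes "\<phi> \<in> test_functions" "\<psi> \<in> test_functions"
  shows "(\<lambda>t. \<phi> t + \<psi> t) \<in> test_functions"
proof -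
  obtain R where R: "R > 0" "\<And>t. R < \<bar>t\<bar> \<Longrightarrow> \<phi> t = 0"
    by (rule test_supportE[OF assms(1)]) (rule that)
  obtain R' where R': "R' > 0" "\<And>t. R' < \<bar>t\<bar> \<Longrightarrow> \<psi> t = 0"
    by (rule test_supportE[OF assms(2)]) (rule that)
  from R(2) R'(2) show ?thesis
    by (intro testI[OF smooth_add[OF test_smooth[OF assms(1)] test_smooth[OF assms(2)]], of "max R R'"]) simp
qed

lemma test_mult:
  assumes "\<phi> \<in> test_functions" "smooth \<psi>"
  shows "(\<lambda>t. \<psi> t * \<phi> t) \<in> test_functions" "(\<lambda>t. \<phi> t * \<psi> t) \<in> test_functions"
proof -
  obtain R where R: "R > 0" "\<And>t. R < \<bar>t\<bar> \<Longrightarrow> \<phi> t = 0"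
    by (rule test_supportE[OF assms(1)]) (rule that)
  from R(2) show "(\<lambda>t. \<psi> t * \<phi> t) \<in> test_functions" "(\<lambda>t. \<phi> t * \<psi> t) \<in> test_functions"
    using smooth_mult[OF assms(2) test_smooth[OF assms(1)]] smooth_mult[OF test_smooth[OF assms(1)] assms(2)]
    by (auto intro!: testI[of _ R])
qed

lemma test_cmult:
  assumes "\<phi> \<in> test_functions"
  shows "(\<lambda>t. c * \<phi> t) \<in> test_functions"
proof -
  obtain R where R: "R > 0" "\<And>t. R < \<bar>t\<bar> \<Longrightarrow> \<phi> t = 0"
    by (rule test_supportE[OF assms]) (rule that)
  from R(2) show ?thesis
    by (intro testI[OF smooth_cmult[OF test_smooth[OF assms]], of R]) simp
qed

lemma test_diff:
  "\<phi> \<in> test_functions \<Longrightarrow> \<psi> \<in> test_functions \<Longrightarrow> (\<lambda>t. \<phi> t - \<psi> t) \<in> test_functions"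
  using test_add[of \<phi> "\<lambda>t. (- 1) * \<psi> t"] test_cmult[of \<psi> "- 1"] by simp

lemma test_sum:
  "finite I \<Longrightarrow> (\<And>i. i \<in> I \<Longrightarrow> \<phi> i \<in> test_functions) \<Longrightarrow> (\<lambda>t. \<Sum>i\<in>I. \<phi> i t) \<in> test_functions"
  by (induction I rule: finite_induct) (auto simp: test_zero test_add)

lemma test_reflect:
  assumes "\<phi> \<in> test_functions"
  shows "(\<lambda>t. \<phi> (a - t)) \<in> test_functions"
proof -
  obtain R where R: "R > 0" "\<And>t. R < \<bar>t\<bar> \<Longrightarrow> \<phi> t = 0"
    by (rule test_supportE[OF assms]) (rule that)
  have "\<phi> (a - t) = 0" if "R + \<bar>a\<bar> < \<bar>t\<bar>" for t
    using that by (intro R(2)) linarith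
  then show ?thesis
    by (rule testI[OF smooth_reflect[OF test_smooth[OF assms]]])
qed

lemma test_bounded:
  assumes "\<phi> \<in> test_functions"
  shows "\<exists>C\<ge>0. \<forall>t. cmod (nderiv j \<phi> t) \<le> C"
proof -
  obtain R where R: "R > 0" "\<And>t. R < \<bar>t\<bar> \<Longrightarrow> \<phi> t = 0"
    by (rule test_supportE[OF assms]) (rule that)
  have "bounded (nderiv j \<phi> ` {- R..R})"
    by (intro compact_imp_bounded compact_continuous_image smooth_continuous_on test_smooth assms) simp
  then obtain C where C: "C > 0" "\<And>t. t \<in> {- R..R} \<Longrightarrow> cmod (nderiv j \<phi> t) \<le> C"
    by (auto simp: bounded_pos)
  have "cmod (nderiv j \<phi> t) \<le> C" for t
  proof (cases "R < \<bar>t\<bar>")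
    case True
    then show ?thesis using C(1) by (simp add: test_nderiv_support[OF test_smooth[OF assms] R(2)])
  next
    case False
    then have "t \<in> {- R..R}" by auto
    then show ?thesis by (rule C(2))
  qed
  with C(1) show ?thesis by (intro exI[of _ C]) auto
qed

lemma test_DL1:
  assumes "\<phi> \<in> test_functions"
  shows "\<phi> \<in> DL1"
proof -
  obtain R where R: "R > 0" "\<And>t. R < \<bar>t\<bar> \<Longrightarrow> \<phi> t = 0"
    by (rule test_supportE[OF assms]) (rule that)
  have "integrable lborel (nderiv j \<phi>)" for j
  proof -
    have "set_integrable lborel {- R..R} (nderiv j \<phi>)"
      by (intro borel_integrable_atLeastAtMost' smooth_continuous_on test_smooth assms)
    moreover have "indicator {- R..R} t *\<^sub>R nderiv j \<phi> t = nderiv j \<phi> t" for t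
    proof (cases "t \<in> {- R..R}")
      case False
      then have "R < \<bar>t\<bar>" by auto
      from test_nderiv_support[OF test_smooth[OF assms] R(2) this] show ?thesis by simp
    qed simp
    ultimately show ?thesis by (simp add: set_integrable_def)
  qed
  with assms show ?thesis by (auto simp: DL1_def test_smooth)
qed

lemma smooth_lipschitz:
  assumes "smooth f" "\<And>t. cmod (nderiv 1 f t) \<le> K"
  shows "cmod (f a - f b) \<le> K * \<bar>a - b\<bar>"
proof -
  have "norm (f a - f b) \<le> K * norm (a - b)"
  proof (rule differentiable_bound[where S = UNIV])
    show "(f has_derivative (\<lambda>h. h *\<^sub>R nderiv 1 f z)) (at z within UNIV)" for z
      using smooth_has_vector_derivative_1[OF assms(1), of z]
      by (simp add: has_vector_derivative_def)
    show "onorm (\<lambda>h. h *\<^sub>R nderiv 1 f z) \<le> K" for z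
      by (rule onorm_scaleR_le[OF assms(2)])
  qed auto
  then show ?thesis by simp
qed

lemma test_null_reflect:
  assumes "test_null \<Phi>" "\<And>n. smooth (\<Phi> n)"
  shows "test_null (\<lambda>n t. \<Phi> n (a - t))"
proof -
  from assms(1) obtain K where K: "compact K" "\<And>k t. t \<notin> K \<Longrightarrow> \<Phi> k t = 0"
    and lim: "\<And>j. uniform_limit UNIV (\<lambda>k. nderiv j (\<Phi> k)) (\<lambda>_. 0) sequentially"
    unfolding test_null_def by blast
  have "compact ((\<lambda>t. a - t) ` K)"
    by (intro compact_continuous_image continuous_intros K)
  moreover have "\<Phi> k (a - t) = 0" if "t \<notin> (\<lambda>t. a - t) ` K" for k t
    using that by (intro K(2)) force
  moreover have "uniform_limit UNIV (\<lambda>k. nderiv j (\<lambda>t. \<Phi> k (a - t))) (\<lambda>_. 0) sequentially" for j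
  proof (rule uniform_limitI)
    fix e :: real assume "e > 0"
    from uniform_limitD[OF lim this, of j]
    show "\<forall>\<^sub>F k in sequentially. \<forall>t\<in>UNIV. dist (nderiv j (\<lambda>t. \<Phi> k (a - t)) t) 0 < e"
      by eventually_elim (simp add: nderiv_reflect assms(2) norm_mult norm_power)
  qed
  ultimately show ?thesis unfolding test_null_def by blast
qed

lemma linear_continuous_onD:
  assumes "linear_continuous_on V nul T"
  shows "\<phi> \<in> V \<Longrightarrow> \<psi> \<in> V \<Longrightarrow> T (\<lambda>t. \<phi> t + \<psi> t) = T \<phi> + T \<psi>"
    and "\<phi> \<in> V \<Longrightarrow> T (\<lambda>t. c * \<phi> t) = c *\<^sub>C T \<phi>"
    and "(\<And>k. \<Phi> k \<in> V) \<Longrightarrow> nul \<Phi> \<Longrightarrow> (\<lambda>k. T (\<Phi> k)) \<longlonglongrightarrow> 0"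
  using assms unfolding linear_continuous_on_def by blast+

section \<open>Vector-valued distributions and their convolutions with test functions\<close>

locale distribution =
  fixes T :: "(real \<Rightarrow> complex) \<Rightarrow> 'a::complex_banach"
  assumes T: "linear_continuous_on test_functions test_null T"
begin

lemmas T_add = linear_continuous_onD(1)[OF T]
lemmas T_cmult = linear_continuous_onD(2)[OF T]
lemmas T_null = linear_continuous_onD(3)[OF T]

lemma T_zero: "T (\<lambda>_. 0) = 0"
  using T_cmult[OF test_zero, of 0] by simp

lemma T_diff: "\<phi> \<in> test_functions \<Longrightarrow> \<psi> \<in> test_functions \<Longrightarrow> T (\<lambda>t. \<phi> t - \<psi> t) = T \<phi> - T \<psi>"
  using T_add[of \<phi> "\<lambda>t. (- 1) * \<psi> t"] T_cmult[of \<psi> "- 1"] test_cmult[of \<psi> "- 1"] by simp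

lemma T_sum:
  "finite I \<Longrightarrow> (\<And>i. i \<in> I \<Longrightarrow> \<phi> i \<in> test_functions) \<Longrightarrow> T (\<lambda>t. \<Sum>i\<in>I. \<phi> i t) = (\<Sum>i\<in>I. T (\<phi> i))"
  by (induction I rule: finite_induct) (auto simp: T_zero T_add test_sum)

lemma convolve_cmult: "\<phi> \<in> test_functions \<Longrightarrow> convolve T (\<lambda>t. c * \<phi> t) x = c *\<^sub>C convolve T \<phi> x"
  unfolding convolve_def by (intro T_cmult test_reflect)

lemma convolve_diff: "\<phi> \<in> test_functions \<Longrightarrow> \<psi> \<in> test_functions \<Longrightarrow>
    convolve T (\<lambda>t. \<phi> t - \<psi> t) x = convolve T \<phi> x - convolve T \<psi> x"
  unfolding convolve_def by (intro T_diff test_reflect)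

lemma convolve_sum: "finite I \<Longrightarrow> (\<And>i. i \<in> I \<Longrightarrow> \<phi> i \<in> test_functions) \<Longrightarrow>
    convolve T (\<lambda>t. \<Sum>i\<in>I. \<phi> i t) x = (\<Sum>i\<in>I. convolve T (\<phi> i) x)"
  unfolding convolve_def by (intro T_sum test_reflect)

lemma convolve_null:
  assumes "\<And>k. \<Phi> k \<in> test_functions" "test_null \<Phi>"
  shows "(\<lambda>k. convolve T (\<Phi> k) x) \<longlonglongrightarrow> 0"
  unfolding convolve_def
  by (intro T_null test_reflect test_null_reflect assms test_smooth)

text \<open>Translated test functions converge in the test topology: bounded shifts keep a common
  compact support, and every derivative is Lipschitz. Continuity later turns an almost everywhere
  bound into a bound everywhere.\<close>

lemma isCont_convolve:
  assumes \<phi>: "\<phi> \<in> test_functions"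
  shows "isCont (convolve T \<phi>) x"
  unfolding continuous_at_sequentially
proof (intro allI impI)
  fix u assume u: "u \<longlonglongrightarrow> x"
  obtain R where R: "R > 0" "\<And>t. R < \<bar>t\<bar> \<Longrightarrow> \<phi> t = 0"
    by (rule test_supportE[OF \<phi>]) (rule that)
  have sm: "smooth \<phi>" by (rule test_smooth[OF \<phi>])
  obtain B where B: "\<And>n. \<bar>u n\<bar> \<le> B"
    using convergent_imp_Bseq[of u] u by (auto simp: convergent_def Bseq_def)
  have Bx: "\<bar>x\<bar> \<le> B"
    by (rule LIMSEQ_le_const2[OF tendsto_rabs[OF u]]) (use B in auto)
  let ?\<Phi> = "\<lambda>n y. \<phi> (u n - y) - \<phi> (x - y)"
  have "test_null ?\<Phi>"
    unfolding test_null_def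
  proof (intro conjI allI exI[of _ "{- (R + B)..R + B}"] impI)
    show "compact {- (R + B)..R + B}" by simp
    fix k t assume "t \<notin> {- (R + B)..R + B}"
    then show "?\<Phi> k t = 0" using R(2)[of "u k - t"] R(2)[of "x - t"] B[of k] Bx by auto
  next
    fix j
    obtain K where K: "K \<ge> 0" "\<And>t. cmod (nderiv (Suc j) \<phi> t) \<le> K"
      using test_bounded[OF \<phi>] by blast
    have le: "cmod (nderiv j (?\<Phi> n) y) \<le> K * \<bar>u n - x\<bar>" for n y
    proof -
      have "cmod (nderiv j (?\<Phi> n) y) = cmod (nderiv j \<phi> (u n - y) - nderiv j \<phi> (x - y))"
        unfolding nderiv_diff[OF smooth_reflect[OF sm] smooth_reflect[OF sm]] nderiv_reflect[OF sm]
          right_diff_distrib[symmetric] by (simp add: norm_mult norm_power)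
      also have "\<dots> \<le> K * \<bar>(u n - y) - (x - y)\<bar>"
        by (rule smooth_lipschitz[OF smooth_nderiv[OF sm]]) (use K(2) in \<open>simp add: nderiv_nderiv\<close>)
      finally show ?thesis by simp
    qed
    show "uniform_limit UNIV (\<lambda>k. nderiv j (?\<Phi> k)) (\<lambda>_. 0) sequentially"
    proof (rule uniform_limitI)
      fix e :: real assume "e > 0"
      have "(\<lambda>n. K * \<bar>u n - x\<bar>) \<longlonglongrightarrow> K * 0"
        using u by (intro tendsto_mult tendsto_const tendsto_rabs_zero) (rule LIM_zero)
      then have "\<forall>\<^sub>F n in sequentially. K * \<bar>u n - x\<bar> < e"
        using \<open>e > 0\<close> by (intro order_tendstoD(2)) auto
      then show "\<forall>\<^sub>F n in sequentially. \<forall>y\<in>UNIV. dist (nderiv j (?\<Phi> n) y) 0 < e"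
        by eventually_elim (use le in \<open>auto intro: le_less_trans\<close>)
    qed
  qed
  then have "(\<lambda>n. T (?\<Phi> n)) \<longlonglongrightarrow> 0"
    by (intro T_null test_diff test_reflect \<phi>)
  then have "(\<lambda>n. convolve T \<phi> (u n) - convolve T \<phi> x) \<longlonglongrightarrow> 0"
    unfolding convolve_def by (simp add: T_diff test_reflect \<phi>)
  then show "(convolve T \<phi> \<circ> u) \<longlonglongrightarrow> convolve T \<phi> x"
    unfolding o_def by (rule LIM_zero_cancel)
qed

end

locale bounded_distribution = distribution +
  assumes Linfty: "\<phi> \<in> test_functions \<Longrightarrow> convolve T \<phi> \<in> Linfty"
begin

text \<open>\<open>Linfty\<close> gives a bound only almost everywhere; by continuity the
  exceptional set is open, and an open negligible set is empty.\<close>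

lemma convolve_bounded:
  assumes \<phi>: "\<phi> \<in> test_functions"
  shows "\<exists>C. \<forall>x. norm (convolve T \<phi> x) \<le> C"
proof -
  from Linfty[OF \<phi>] obtain C where C: "AE x in lebesgue. norm (convolve T \<phi> x) \<le> C"
    by (auto simp: Linfty_def)
  let ?E = "{x. C < norm (convolve T \<phi> x)}"
  have "?E = (\<lambda>x. norm (convolve T \<phi> x)) -` {C<..}" by auto
  moreover have "open \<dots>"
    by (intro continuous_open_vimage) (auto intro: isCont_norm isCont_convolve[OF \<phi>])
  ultimately have "open ?E" by simp
  moreover have "negligible ?E"
  proof -
    from C obtain N where N: "{x \<in> space lebesgue. \<not> norm (convolve T \<phi> x) \<le> C} \<subseteq> N" "N \<in> null_sets lebesgue"
      unfolding eventually_ae_filter by blast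
    then have "negligible N" by (simp add: negligible_iff_null_sets)
    with N(1) show ?thesis by (elim negligible_subset) auto
  qed
  ultimately have "?E = {}" using open_not_negligible by blast
  then show ?thesis by (intro exI[of _ C]) (auto simp: not_less)
qed

text \<open>A gliding hump argument in place of the Banach-Steinhaus theorem on the Frechet space of test
  functions supported in a fixed interval.\<close>

lemma convolve_uniform_bound:
  "\<exists>C\<ge>0. \<exists>m::nat. \<forall>\<phi>\<in>test_functions. (\<forall>t. 1 < \<bar>t\<bar> \<longrightarrow> \<phi> t = 0) \<longrightarrow>
    (\<forall>P. (\<forall>j\<le>m. \<forall>t. cmod (nderiv j \<phi> t) \<le> P) \<longrightarrow> (\<forall>x. norm (convolve T \<phi> x) \<le> C * P))"
proof (rule ccontr)
  assume neg: "\<not> ?thesis"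
  have "\<exists>\<psi> x. \<psi> \<in> test_functions \<and> (\<forall>t. 1 < \<bar>t\<bar> \<longrightarrow> \<psi> t = 0) \<and>
      (\<forall>j\<le>m. \<forall>t. cmod (nderiv j \<psi> t) \<le> (1/2) ^ m) \<and> 2 ^ m \<le> norm (convolve T \<psi> x)" for m :: nat
  proof -
    \<comment> \<open>Negating with constant \<open>4 ^ m\<close> leaves room to rescale so that the
      derivatives are at most 2^-m while the convolution still reaches 2^m.\<close>
    have "\<not> (\<forall>\<phi>\<in>test_functions. (\<forall>t. 1 < \<bar>t\<bar> \<longrightarrow> \<phi> t = 0) \<longrightarrow>
      (\<forall>P. (\<forall>j\<le>m. \<forall>t. cmod (nderiv j \<phi> t) \<le> P) \<longrightarrow> (\<forall>x. norm (convolve T \<phi> x) \<le> 4 ^ m * P)))"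
      using neg by (metis zero_le_numeral zero_le_power)
    then obtain \<phi> P x where \<phi>0: "\<phi> \<in> test_functions" "\<forall>t. 1 < \<bar>t\<bar> \<longrightarrow> \<phi> t = 0"
      and P0: "\<forall>j\<le>m. \<forall>t. cmod (nderiv j \<phi> t) \<le> P"
      and x: "4 ^ m * P < norm (convolve T \<phi> x)"
      by (metis not_le)
    have \<phi>: "\<phi> \<in> test_functions" "\<And>t. 1 < \<bar>t\<bar> \<Longrightarrow> \<phi> t = 0"
      using \<phi>0 by simp_all
    have P: "\<And>j t. j \<le> m \<Longrightarrow> cmod (nderiv j \<phi> t) \<le> P" using P0 by simp
    have "P \<ge> 0" using P[of 0 0] norm_ge_zero order_trans by blast
    have "P \<noteq> 0"
    proof
      assume "P = 0"
      with P[of 0] have "\<phi> = (\<lambda>_. 0)" by auto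
      with x \<open>P = 0\<close> show False by (simp add: convolve_def T_zero)
    qed
    with \<open>P \<ge> 0\<close> have "P > 0" by simp
    define c where "c = (1/2) ^ m / P"
    have c: "c > 0" "c * P = (1/2) ^ m" using \<open>P > 0\<close> by (simp_all add: c_def)
    show ?thesis
    proof (intro exI[of _ "\<lambda>t. of_real c * \<phi> t"] exI[of _ x] conjI allI impI)
      show "(\<lambda>t. of_real c * \<phi> t) \<in> test_functions" by (rule test_cmult[OF \<phi>(1)])
      show "of_real c * \<phi> t = 0" if "1 < \<bar>t\<bar>" for t using \<phi>(2)[OF that] by simp
      show "cmod (nderiv j (\<lambda>t. of_real c * \<phi> t) t) \<le> (1/2) ^ m" if "j \<le> m" for j t
        using mult_left_mono[OF P[OF that, of t], of c] c
        by (simp add: nderiv_cmult[OF test_smooth[OF \<phi>(1)]] norm_mult)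
      have "2 ^ m = (1/2) ^ m * (4 ^ m :: real)" by (simp add: power_mult_distrib[symmetric])
      also have "\<dots> = c * (4 ^ m * P)" using c(2) by (simp add: mult_ac)
      also have "\<dots> \<le> c * norm (convolve T \<phi> x)" using x c(1) by (intro mult_left_mono) auto
      also have "\<dots> = norm (convolve T (\<lambda>t. of_real c * \<phi> t) x)"
        using c(1) by (simp add: convolve_cmult[OF \<phi>(1)] norm_scaleC)
      finally show "2 ^ m \<le> norm (convolve T (\<lambda>t. of_real c * \<phi> t) x)" .
    qed
  qed
  then obtain \<psi> x where \<psi>: "\<And>m. \<psi> m \<in> test_functions" "\<And>m t. 1 < \<bar>t\<bar> \<Longrightarrow> \<psi> m t = 0"
    and small: "\<And>m j t. j \<le> m \<Longrightarrow> cmod (nderiv j (\<psi> m) t) \<le> (1/2) ^ m"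
    and big: "\<And>m. 2 ^ m \<le> norm (convolve T (\<psi> m) (x m))"
    by metis
  have half: "(\<lambda>m. (1/2) ^ m :: real) \<longlonglongrightarrow> 0" by (rule LIMSEQ_power_zero) simp
  have "test_null \<psi>"
    unfolding test_null_def
  proof (intro conjI allI exI[of _ "{-1..1}"] impI)
    fix j
    show "uniform_limit UNIV (\<lambda>k. nderiv j (\<psi> k)) (\<lambda>_. 0) sequentially"
    proof (rule uniform_limitI)
      fix e :: real assume "e > 0"
      then have "\<forall>\<^sub>F m in sequentially. (1/2) ^ m < e" by (rule order_tendstoD(2)[OF half])
      then show "\<forall>\<^sub>F m in sequentially. \<forall>t\<in>UNIV. dist (nderiv j (\<psi> m) t) 0 < e"
        using eventually_ge_at_top[of j]
        by eventually_elim (use small in \<open>auto intro: le_less_trans\<close>)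
    qed
  qed (use \<psi> in \<open>auto simp: abs_if split: if_splits\<close>)
  then have to0: "(\<lambda>m. norm (convolve T (\<psi> m) y)) \<longlonglongrightarrow> 0" for y
    by (intro tendsto_norm_zero convolve_null \<psi>)
  obtain B where B: "\<And>m y. norm (convolve T (\<psi> m) y) \<le> B m"
    using convolve_bounded[OF \<psi>(1)] by metis
  have B0: "B m \<ge> 0" for m using B[of m 0] norm_ge_zero order_trans by blast
  \<comment> \<open>How far to go after index \<open>N\<close>: from there on all humps are tiny at
    the points used so far, and their peaks exceed the sum of the suprema \<open>B i\<close> of the
    earlier ones.\<close>
  have "\<exists>N'>N. \<forall>m\<ge>N'. (\<forall>i\<le>N. norm (convolve T (\<psi> m) (x i)) \<le> (1/2) ^ N) \<and>
      real N + 2 + (\<Sum>i\<le>N. B i) \<le> 2 ^ m" for N :: nat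
  proof -
    have "\<forall>\<^sub>F m in sequentially. \<forall>i\<in>{..N}. norm (convolve T (\<psi> m) (x i)) < (1/2) ^ N"
      by (intro eventually_ball_finite ballI order_tendstoD(2)[OF to0]) auto
    moreover have "\<forall>\<^sub>F m in sequentially. real N + 2 + (\<Sum>i\<le>N. B i) \<le> 2 ^ m"
    proof -
      obtain n where "real N + 2 + (\<Sum>i\<le>N. B i) < 2 ^ n"
        using real_arch_pow[of 2 "real N + 2 + (\<Sum>i\<le>N. B i)"] by auto
      moreover have "(2::real) ^ n \<le> 2 ^ m" if "n \<le> m" for m
        using that by (intro power_increasing) auto
      ultimately show ?thesis
        by (intro eventually_sequentiallyI[of n]) (auto intro: order_trans[OF less_imp_le])
    qed
    ultimately have "\<forall>\<^sub>F m in sequentially. (\<forall>i\<le>N. norm (convolve T (\<psi> m) (x i)) \<le> (1/2) ^ N) \<and>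
        real N + 2 + (\<Sum>i\<le>N. B i) \<le> 2 ^ m"
      by eventually_elim (auto intro: less_imp_le)
    then obtain N' where "\<forall>m\<ge>N'. (\<forall>i\<le>N. norm (convolve T (\<psi> m) (x i)) \<le> (1/2) ^ N) \<and>
        real N + 2 + (\<Sum>i\<le>N. B i) \<le> 2 ^ m"
      unfolding eventually_sequentially by blast
    then show ?thesis by (intro exI[of _ "max N' (Suc N)"]) auto
  qed
  then obtain nx where nx: "\<And>N. N < nx N"
    and nx1: "\<And>N m i. nx N \<le> m \<Longrightarrow> i \<le> N \<Longrightarrow> norm (convolve T (\<psi> m) (x i)) \<le> (1/2) ^ N"
    and nx2: "\<And>N m. nx N \<le> m \<Longrightarrow> real N + 2 + (\<Sum>i\<le>N. B i) \<le> 2 ^ m"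
    by metis
  define k where "k l = (nx ^^ l) 0" for l
  have k_Suc: "k (Suc l) = nx (k l)" for l by (simp add: k_def)
  have k_mono: "strict_mono k" unfolding strict_mono_Suc_iff k_Suc using nx by blast
  then have k_ge: "l \<le> k l" for l by (rule strict_mono_imp_increasing)
  \<comment> \<open>The factor 2 pays for the index shift from \<open>l\<close> to its
    predecessor.\<close>
  have off: "norm (convolve T (\<psi> (k l)) (x (k i))) \<le> 2 * (1/2) ^ l" if "i < l" for i l
  proof (cases l)
    case (Suc l')
    then have "norm (convolve T (\<psi> (k l)) (x (k i))) \<le> (1/2) ^ k l'"
      using that k_mono by (intro nx1) (simp_all add: k_Suc strict_mono_less_eq)
    also have "\<dots> \<le> (1/2) ^ l'" by (rule power_decreasing[OF k_ge]) auto
    finally show ?thesis using Suc by simp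
  qed (use that in simp)
  \<comment> \<open>Peak number \<open>l\<close> outweighs the combined suprema of the earlier humps
    by \<open>l + 1\<close>; the summand 2 in \<open>nx2\<close> covers the step from
    \<open>l'\<close> to \<open>l\<close>.\<close>
  have diag: "real l + 1 + (\<Sum>i<l. B (k i)) \<le> norm (convolve T (\<psi> (k l)) (x (k l)))" for l
  proof (cases l)
    case 0
    have "(1::real) \<le> 2 ^ k 0" by (rule one_le_power) simp
    also have "\<dots> \<le> norm (convolve T (\<psi> (k 0)) (x (k 0)))" by (rule big)
    finally show ?thesis using 0 by simp
  next
    case (Suc l')
    have "(\<Sum>i<l. B (k i)) = sum B (k ` {..<l})"
      using k_mono by (subst sum.reindex) (auto simp: strict_mono_imp_inj_on o_def)
    also have "\<dots> \<le> (\<Sum>i\<le>k l'. B i)"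
      using k_mono B0 Suc by (intro sum_mono2) (auto simp: strict_mono_less_eq)
    finally have "(\<Sum>i<l. B (k i)) \<le> (\<Sum>i\<le>k l'. B i)" .
    moreover have "real (k l') + 2 + (\<Sum>i\<le>k l'. B i) \<le> 2 ^ k l"
      by (rule nx2) (simp add: Suc k_Suc)
    moreover have "real l' \<le> real (k l')" using k_ge[of l'] by simp
    ultimately show ?thesis using big[of "k l"] Suc by simp
  qed
  define \<Psi> where "\<Psi> t = (\<Sum>l. \<psi> (k l) t)" for t
  have le: "cmod (nderiv j (\<psi> (k l)) t) \<le> (1/2) ^ l" if "j \<le> l" for l j t
  proof -
    have "cmod (nderiv j (\<psi> (k l)) t) \<le> (1/2) ^ k l"
      using that k_ge[of l] by (intro small) simp
    also have "\<dots> \<le> (1/2) ^ l" by (rule power_decreasing[OF k_ge]) auto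
    finally show ?thesis .
  qed
  have sm: "smooth (\<psi> (k l))" for l by (rule test_smooth[OF \<psi>(1)])
  have sum_half: "summable (\<lambda>l. (1/2) ^ l :: real)" by (rule summable_geometric) simp
  have \<Psi>_eq: "\<Psi> = (\<lambda>t. \<Sum>l. \<psi> (k l) t)" by (simp add: \<Psi>_def fun_eq_iff)
  have lim: "uniform_limit UNIV (\<lambda>n. nderiv j (\<lambda>t. \<Sum>l<n. \<psi> (k l) t)) (nderiv j \<Psi>) sequentially" for j
    unfolding \<Psi>_eq by (rule uniform_limit_nderiv_suminf[OF sm sum_half le])
  have sm\<Psi>: "smooth \<Psi>"
    unfolding \<Psi>_eq by (rule smooth_suminf[OF sm sum_half le])
  have supp: "\<Psi> t = 0" if "1 < \<bar>t\<bar>" for t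
    using that by (simp add: \<Psi>_def \<psi>(2))
  have \<Psi>: "\<Psi> \<in> test_functions" by (rule testI[OF sm\<Psi> supp])
  let ?P = "\<lambda>n t. \<Sum>l<n. \<psi> (k l) t"
  have P: "?P n \<in> test_functions" for n by (intro test_sum \<psi>) auto
  have "test_null (\<lambda>n t. ?P n t - \<Psi> t)"
    unfolding test_null_def
  proof (intro conjI allI exI[of _ "{-1..1}"] impI)
    show "(\<Sum>l<n. \<psi> (k l) t) - \<Psi> t = 0" if "t \<notin> {- 1..1}" for n t
    proof -
      have "1 < \<bar>t\<bar>" using that by auto
      then show ?thesis by (simp add: \<psi>(2) supp)
    qed
    fix j
    show "uniform_limit UNIV (\<lambda>n. nderiv j (\<lambda>t. ?P n t - \<Psi> t)) (\<lambda>_. 0) sequentially"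
    proof (rule uniform_limitI)
      fix e :: real assume "e > 0"
      from uniform_limitD[OF lim this, of j]
      show "\<forall>\<^sub>F n in sequentially. \<forall>t\<in>UNIV. dist (nderiv j (\<lambda>t. ?P n t - \<Psi> t) t) 0 < e"
      proof eventually_elim
        case (elim n)
        then show ?case
          unfolding nderiv_diff[OF test_smooth[OF P] sm\<Psi>] by (simp add: dist_norm)
      qed
    qed
  qed simp
  then have conv: "(\<lambda>n. \<Sum>l<n. convolve T (\<psi> (k l)) y) \<longlonglongrightarrow> convolve T \<Psi> y" for y
  proof -
    have "(\<lambda>n. convolve T (\<lambda>t. ?P n t - \<Psi> t) y) \<longlonglongrightarrow> 0"
      by (intro convolve_null test_diff P \<Psi>) fact
    then show ?thesis
      unfolding convolve_diff[OF P \<Psi>] by (subst (asm) convolve_sum) (auto intro: \<psi> dest: LIM_zero_cancel)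
  qed
  \<comment> \<open>At \<open>x (k i)\<close> the earlier humps can cancel at most their suprema,
    leaving \<open>i + 1\<close> of the peak, and the later humps take away at most 4, twice the sum
    of the geometric series. This contradicts boundedness as \<open>i\<close> grows.\<close>
  have ge: "real i - 3 \<le> norm (convolve T \<Psi> (x (k i)))" for i
  proof (rule LIMSEQ_le_const[OF tendsto_norm[OF conv]], intro exI[of _ "Suc i"] allI impI)
    fix n assume n: "Suc i \<le> n"
    let ?a = "\<lambda>l. convolve T (\<psi> (k l)) (x (k i))"
    have split: "{..<n} = {..<i} \<union> {i} \<union> {Suc i..<n}" using n by auto
    have "(\<Sum>l<n. ?a l) = (\<Sum>l<i. ?a l) + ?a i + (\<Sum>l=Suc i..<n. ?a l)"
      unfolding split by (subst sum.union_disjoint; (subst sum.union_disjoint)?; auto)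
    moreover have "norm (\<Sum>l<i. ?a l) \<le> (\<Sum>l<i. B (k l))"
      by (rule sum_norm_le) (rule B)
    moreover have "norm (\<Sum>l=Suc i..<n. ?a l) \<le> 4"
    proof -
      have "norm (\<Sum>l=Suc i..<n. ?a l) \<le> (\<Sum>l=Suc i..<n. 2 * (1/2) ^ l)"
        by (rule sum_norm_le) (auto intro: off)
      also have "\<dots> \<le> (\<Sum>l<n. 2 * (1/2) ^ l)"
        by (rule sum_mono2) auto
      also have "\<dots> = 2 * (\<Sum>l<n. (1/2) ^ l)" by (rule sum_distrib_left[symmetric])
      also have "\<dots> \<le> 2 * (\<Sum>l. (1/2) ^ l)"
        by (intro mult_left_mono sum_le_suminf sum_half) auto
      also have "(\<Sum>l. (1/2) ^ l :: real) = 2" by (subst suminf_geometric) auto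
      finally show ?thesis by simp
    qed
    moreover have "norm (?a i) \<le> norm (\<Sum>l<n. ?a l) + norm (\<Sum>l<i. ?a l) + norm (\<Sum>l=Suc i..<n. ?a l)"
      if "(\<Sum>l<n. ?a l) = (\<Sum>l<i. ?a l) + ?a i + (\<Sum>l=Suc i..<n. ?a l)"
    proof -
      have "?a i = (\<Sum>l<n. ?a l) - (\<Sum>l<i. ?a l) - (\<Sum>l=Suc i..<n. ?a l)" using that by simp
      then show ?thesis
        by (metis (no_types, lifting) add_mono_thms_linordered_semiring(3) norm_triangle_ineq4 order_trans)
    qed
    ultimately show "real i - 3 \<le> norm (\<Sum>l<n. ?a l)"
      using diag[of i] by linarith
  qed
  obtain C where C: "\<And>y. norm (convolve T \<Psi> y) \<le> C"
    using convolve_bounded[OF \<Psi>] by blast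
  obtain i :: nat where "C + 3 < real i" using reals_Archimedean2 by blast
  with ge[of i] C[of "x (k i)"] show False by linarith
qed

end

subsection \<open>Extension to \<open>DL1\<close>\<close>

text \<open>\<open>\<kappa>\<close> is the increment of a smooth step over a unit shift, so sums of
  its translates telescope. The finite form suits test functions, whose supports meet finitely many
  pieces.\<close>

lemma ex_smooth_partition:
  "\<exists>\<kappa>. smooth \<kappa> \<and> (\<forall>t. 1 < \<bar>t\<bar> \<longrightarrow> \<kappa> t = 0) \<and>
    (\<forall>N::nat. \<forall>t. \<bar>t\<bar> \<le> real N \<longrightarrow> (\<Sum>n\<in>{- int N..int N}. \<kappa> (t - of_int n)) = 1)"
proof -
  obtain \<theta> where \<theta>: "smooth \<theta>" "\<forall>t\<le>0. \<theta> t = 0" "\<forall>t\<ge>1. \<theta> t = 1"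
    using ex_smooth_step by blast
  define \<kappa> where "\<kappa> t = \<theta> (t + 1) - \<theta> t" for t
  have "smooth \<kappa>"
    using smooth_diff[OF smooth_shift[OF \<theta>(1), of 1] \<theta>(1)] by (simp add: \<kappa>_def[abs_def])
  moreover have "\<kappa> t = 0" if "1 < \<bar>t\<bar>" for t
  proof (cases "t \<le> 0")
    case True
    then have "t + 1 \<le> 0" using that by simp
    then show ?thesis using True \<theta>(2) by (simp add: \<kappa>_def)
  next
    case False
    then have "1 \<le> t" "1 \<le> t + 1" using that by simp_all
    then show ?thesis using \<theta>(3) by (simp add: \<kappa>_def)
  qed
  moreover have "(\<Sum>n\<in>{- int N..int N}. \<kappa> (t - of_int n)) = 1" if "\<bar>t\<bar> \<le> real N" for N t
  proof -
    have tele: "(\<Sum>n\<in>{- int N..int N}. \<kappa> (t - of_int n)) = \<theta> (t + real N + 1) - \<theta> (t - real N)" for N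
    proof (induction N)
      case (Suc N)
      have "{- int (Suc N)..int (Suc N)} = insert (- int (Suc N)) (insert (int (Suc N)) {- int N..int N})"
        by auto
      then have "(\<Sum>n\<in>{- int (Suc N)..int (Suc N)}. \<kappa> (t - of_int n)) =
          \<kappa> (t + real (Suc N)) + (\<kappa> (t - real (Suc N)) + (\<Sum>n\<in>{- int N..int N}. \<kappa> (t - of_int n)))"
        by (simp add: algebra_simps)
      also have "\<dots> = \<theta> (t + real (Suc N) + 1) - \<theta> (t - real (Suc N))"
        unfolding Suc.IH unfolding \<kappa>_def by (simp add: algebra_simps)
      finally show ?case .
    qed (simp add: \<kappa>_def)
    have "t + real N + 1 \<ge> 1" "t - real N \<le> 0" using that by linarith+
    then show ?thesis unfolding tele using \<theta> by simp
  qed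
  ultimately show ?thesis by (intro exI[of _ \<kappa>]) simp
qed

definition local_norm :: "(real \<Rightarrow> complex) \<Rightarrow> nat \<Rightarrow> int \<Rightarrow> real" where
  "local_norm f i n = (LINT x|lborel. indicator {of_int n - 1..of_int n + 1} x * cmod (nderiv i f x))"

lemma local_norm_nonneg: "0 \<le> local_norm f i n"
  by (simp add: local_norm_def)

text \<open>A point lies in at most three of the intervals of length 2 centred at integers.\<close>

lemma sum_local_norm_le:
  assumes f: "f \<in> DL1" and F: "finite F"
  shows "(\<Sum>n\<in>F. local_norm f i n) \<le> 3 * N1 (nderiv i f)"
proof -
  let ?I = "\<lambda>n::int. {of_int n - 1..of_int n + 1} :: real set"
  have int: "integrable lborel (\<lambda>x. indicator (?I n) x * cmod (nderiv i f x))" for n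
    by (rule smooth_set_integrable[OF DL1_smooth[OF f]])
  have le: "(\<Sum>n\<in>F. indicator (?I n) x) \<le> (3 :: real)" for x
  proof -
    have "(\<Sum>n\<in>F. indicator (?I n) x) = (\<Sum>n\<in>F. if n \<in> {n. x \<in> ?I n} then 1 else 0 :: real)"
      by (intro sum.cong) (auto simp: indicator_def)
    also have "\<dots> = real (card (F \<inter> {n. x \<in> ?I n}))"
      using F by (simp add: sum.If_cases)
    also have "card (F \<inter> {n. x \<in> ?I n}) \<le> card {\<lfloor>x\<rfloor> - 1..\<lfloor>x\<rfloor> + 1}"
    proof (rule card_mono)
      show "F \<inter> {n. x \<in> ?I n} \<subseteq> {\<lfloor>x\<rfloor> - 1..\<lfloor>x\<rfloor> + 1}"
      proof
        fix n assume "n \<in> F \<inter> {n. x \<in> ?I n}"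
        then have "of_int n - 1 \<le> x" "x \<le> of_int n + 1" by auto
        then show "n \<in> {\<lfloor>x\<rfloor> - 1..\<lfloor>x\<rfloor> + 1}" unfolding atLeastAtMost_iff by linarith
      qed
    qed simp
    finally show ?thesis by simp
  qed
  have "(\<Sum>n\<in>F. local_norm f i n) = (LINT x|lborel. (\<Sum>n\<in>F. indicator (?I n) x * cmod (nderiv i f x)))"
    unfolding local_norm_def by (rule Bochner_Integration.integral_sum[symmetric]) (rule int)
  also have "\<dots> \<le> (LINT x|lborel. 3 * cmod (nderiv i f x))"
  proof (rule integral_mono)
    show "integrable lborel (\<lambda>x. (\<Sum>n\<in>F. indicator (?I n) x * cmod (nderiv i f x)))"
      by (intro Bochner_Integration.integrable_sum int)
    show "integrable lborel (\<lambda>x. 3 * cmod (nderiv i f x))"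
      by (intro integrable_mult_right integrable_norm DL1_nderiv_integrable f)
    show "(\<Sum>n\<in>F. indicator (?I n) x * cmod (nderiv i f x)) \<le> 3 * cmod (nderiv i f x)" for x
      unfolding sum_distrib_right[symmetric] by (rule mult_right_mono[OF le]) simp
  qed
  finally show ?thesis by (simp add: N1_def)
qed

lemma cmod_nderiv_le_local_norm:
  assumes "smooth f" "\<bar>t - of_int n\<bar> \<le> 1"
  shows "cmod (nderiv i f t) \<le> local_norm f i n + local_norm f (Suc i) n"
  using sobolev_local[OF smooth_nderiv[OF assms(1)] assms(2), of i]
  by (simp add: local_norm_def nderiv_nderiv)

context bounded_distribution
begin

text \<open>Reflection about \<open>n\<close> turns the value of \<open>T\<close> into a convolution
  at the point \<open>n\<close> with a function supported in [-1, 1], so a bound uniform in the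
  point is uniform in \<open>n\<close>. Sobolev's inequality converts sup norms into local L1 norms,
  which raises the order by one.\<close>

lemma localized_bound:
  assumes \<kappa>: "smooth \<kappa>" "\<forall>t. 1 < \<bar>t\<bar> \<longrightarrow> \<kappa> t = 0"
  shows "\<exists>K\<ge>0. \<exists>m::nat. \<forall>f n. smooth f \<longrightarrow>
    norm (T (\<lambda>y. f y * \<kappa> (y - of_int n))) \<le> K * (\<Sum>i\<le>m. local_norm f i n)"
proof -
  obtain C m where C: "C \<ge> 0" and bound: "\<And>\<phi> P x. \<phi> \<in> test_functions \<Longrightarrow> (\<forall>t. 1 < \<bar>t\<bar> \<longrightarrow> \<phi> t = 0) \<Longrightarrow>
    (\<forall>j\<le>m. \<forall>t. cmod (nderiv j \<phi> t) \<le> P) \<Longrightarrow> norm (convolve T \<phi> x) \<le> C * P"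
    using convolve_uniform_bound by blast
  let ?\<kappa> = "\<lambda>t. \<kappa> (0 - t)"
  have \<kappa>0: "\<kappa> t = 0" if "1 < \<bar>t\<bar>" for t using \<kappa>(2) that by simp
  have \<kappa>_test: "?\<kappa> \<in> test_functions" by (rule test_reflect[OF testI[OF \<kappa>(1) \<kappa>0]])
  have "\<exists>D\<ge>0. \<forall>f t. smooth f \<longrightarrow>
    cmod (nderiv j (\<lambda>t. f t * ?\<kappa> t) t) \<le> D * (\<Sum>i\<le>j. cmod (nderiv i f t))" for j
    by (rule nderiv_mult_bound[OF test_smooth[OF \<kappa>_test]]) (use test_bounded[OF \<kappa>_test] in blast)
  then obtain D where D: "\<And>j. D j \<ge> 0" and mult: "\<And>j f t. smooth f \<Longrightarrow>
    cmod (nderiv j (\<lambda>t. f t * ?\<kappa> t) t) \<le> D j * (\<Sum>i\<le>j. cmod (nderiv i f t))"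
    by metis
  \<comment> \<open>\<open>real (Suc m)\<close> counts the derivatives in the Leibniz estimate; 2
    comes from the two local norms in the Sobolev bound.\<close>
  define E where "E = (\<Sum>j\<le>m. D j) * (real (Suc m) * 2)"
  have E: "E \<ge> 0" unfolding E_def by (intro mult_nonneg_nonneg sum_nonneg D) auto
  have "norm (T (\<lambda>y. f y * \<kappa> (y - of_int n))) \<le> (C * E) * (\<Sum>i\<le>Suc m. local_norm f i n)"
    if f: "smooth f" for f n
  proof -
    define L where "L = (\<Sum>i\<le>Suc m. local_norm f i n)"
    have L: "L \<ge> 0" unfolding L_def by (intro sum_nonneg local_norm_nonneg)
    let ?f = "\<lambda>z. f (of_int n - z)"
    define g where "g z = ?f z * ?\<kappa> z" for z
    have sm: "smooth ?f" by (rule smooth_reflect[OF f])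
    have g: "g \<in> test_functions" unfolding g_def by (rule test_mult(2)[OF \<kappa>_test sm, THEN rev_iffD1])
       (simp add: mult.commute)
    have g0: "g z = 0" if "1 < \<bar>z\<bar>" for z using \<kappa>0[of "0 - z"] that by (simp add: g_def)
    have "cmod (nderiv j g z) \<le> E * L" if j: "j \<le> m" for j z
    proof (cases "1 < \<bar>z\<bar>")
      case True
      then show ?thesis using E L test_nderiv_support[OF test_smooth[OF g] g0] by simp
    next
      case False
      have "cmod (nderiv i ?f z) \<le> 2 * L" if i: "i \<le> j" for i
      proof -
        have "cmod (nderiv i ?f z) = cmod (nderiv i f (of_int n - z))"
          by (simp add: nderiv_reflect[OF f] norm_mult norm_power)
        also have "\<dots> \<le> local_norm f i n + local_norm f (Suc i) n"
          by (rule cmod_nderiv_le_local_norm[OF f]) (use False in simp)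
        also have "local_norm f i n \<le> L"
          unfolding L_def by (rule member_le_sum) (use i j local_norm_nonneg in auto)
        also have "local_norm f (Suc i) n \<le> L"
          unfolding L_def by (rule member_le_sum) (use i j local_norm_nonneg in auto)
        finally show ?thesis by simp
      qed
      then have "(\<Sum>i\<le>j. cmod (nderiv i ?f z)) \<le> (\<Sum>i\<le>j. 2 * L)"
        by (intro sum_mono) simp
      also have "\<dots> = real (Suc j) * (2 * L)" by simp
      also have "\<dots> \<le> real (Suc m) * (2 * L)"
        by (rule mult_right_mono) (use j L in auto)
      also have "\<dots> = real (Suc m) * 2 * L" by simp
      finally have s: "(\<Sum>i\<le>j. cmod (nderiv i ?f z)) \<le> real (Suc m) * 2 * L" .
      have "cmod (nderiv j g z) \<le> D j * (\<Sum>i\<le>j. cmod (nderiv i ?f z))"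
        unfolding g_def[abs_def] by (rule mult[OF sm])
      also have "\<dots> \<le> (\<Sum>j\<le>m. D j) * (real (Suc m) * 2 * L)"
        by (intro mult_mono s sum_nonneg D member_le_sum) (use j in auto)
      finally show ?thesis by (simp add: E_def mult.assoc)
    qed
    then have "norm (convolve T g (of_int n)) \<le> C * (E * L)"
      by (intro bound[OF g]) (use g0 in auto)
    then show ?thesis by (simp add: convolve_def g_def L_def mult.assoc)
  qed
  then show ?thesis using C E by (intro exI[of _ "C * E"] conjI exI[of _ "Suc m"]) auto
qed

text \<open>Cut \<open>f\<close> by the smooth partition and add up the values of \<open>T\<close>
  on the pieces. By \<open>localized_bound\<close> the series converges absolutely, and its sum is
  controlled by finitely many seminorms of \<open>DL1\<close>, which yields continuity.\<close>

lemma ex_DL1_extension: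
  "\<exists>S. linear_continuous_on DL1 DL1_null S \<and> (\<forall>\<phi>\<in>test_functions. S \<phi> = T \<phi>)"
proof -
  obtain \<kappa> where \<kappa>: "smooth \<kappa>" "\<forall>t. 1 < \<bar>t\<bar> \<longrightarrow> \<kappa> t = 0"
    and part: "\<forall>N::nat. \<forall>t. \<bar>t\<bar> \<le> real N \<longrightarrow> (\<Sum>n\<in>{- int N..int N}. \<kappa> (t - of_int n)) = 1"
    using ex_smooth_partition by metis
  define a where "a f n = T (\<lambda>y. f y * \<kappa> (y - of_int n))" for f and n :: int
  obtain K m where K: "K \<ge> 0" and bound: "\<And>f n. smooth f \<Longrightarrow> norm (a f n) \<le> K * (\<Sum>i\<le>m. local_norm f i n)"
    using localized_bound[OF \<kappa>] unfolding a_def by blast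
  define S where "S f = infsum (a f) UNIV" for f
  define p where "p f = 3 * (\<Sum>i\<le>m. N1 (nderiv i f))" for f
  have fin: "(\<Sum>n\<in>F. norm (a f n)) \<le> K * p f" if f: "f \<in> DL1" and F: "finite F" for f F
  proof -
    have "(\<Sum>n\<in>F. norm (a f n)) \<le> (\<Sum>n\<in>F. K * (\<Sum>i\<le>m. local_norm f i n))"
      by (intro sum_mono bound DL1_smooth f)
    also have "\<dots> = K * (\<Sum>i\<le>m. \<Sum>n\<in>F. local_norm f i n)"
      unfolding sum_distrib_left[symmetric] by (subst sum.swap) (rule refl)
    also have "\<dots> \<le> K * (\<Sum>i\<le>m. 3 * N1 (nderiv i f))"
      by (intro mult_left_mono sum_mono sum_local_norm_le K f F)
    finally show ?thesis by (simp add: p_def sum_distrib_left)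
  qed
  have abs: "(\<lambda>n. norm (a f n)) summable_on UNIV" if f: "f \<in> DL1" for f
    by (rule nonneg_bdd_above_summable_on) (use fin[OF f] in \<open>auto simp: bdd_above_def intro!: exI[of _ "K * p f"]\<close>)
  have summ: "a f summable_on UNIV" if f: "f \<in> DL1" for f
    by (rule abs_summable_summable[OF abs[OF f]])
  have S_le: "norm (S f) \<le> K * p f" if f: "f \<in> DL1" for f
  proof -
    have "norm (S f) \<le> infsum (\<lambda>n. norm (a f n)) UNIV"
      unfolding S_def by (rule norm_infsum_bound[OF abs[OF f]])
    also have "\<dots> \<le> K * p f"
      by (rule infsum_le_finite_sums[OF abs[OF f]]) (rule fin[OF f])
    finally show ?thesis .
  qed
  have \<kappa>_test: "(\<lambda>y. \<kappa> (y - of_int n)) \<in> test_functions" for n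
  proof (rule testI)
    show "smooth (\<lambda>y. \<kappa> (y - of_int n))" using smooth_shift[OF \<kappa>(1), of "- of_int n"] by simp
    show "\<kappa> (t - of_int n) = 0" if "1 + \<bar>of_int n\<bar> < \<bar>t\<bar>" for t
    proof -
      have "1 < \<bar>t - of_int n\<bar>" using that by linarith
      then show ?thesis using \<kappa>(2) by simp
    qed
  qed
  have f_test: "(\<lambda>y. f y * \<kappa> (y - of_int n)) \<in> test_functions" if "smooth f" for f n
    by (rule test_mult(1)[OF \<kappa>_test that])
  have "linear_continuous_on DL1 DL1_null S"
    unfolding linear_continuous_on_def
  proof (intro conjI ballI allI impI)
    fix f g assume fg: "f \<in> DL1" "g \<in> DL1"
    have "a (\<lambda>t. f t + g t) n = a f n + a g n" for n
      unfolding a_def distrib_right by (intro T_add f_test DL1_smooth fg)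
    then have "a (\<lambda>t. f t + g t) = (\<lambda>n. a f n + a g n)" by (rule ext)
    then show "S (\<lambda>t. f t + g t) = S f + S g"
      unfolding S_def by (simp only: infsum_add[OF summ[OF fg(1)] summ[OF fg(2)]])
  next
    fix c f assume f: "f \<in> DL1"
    have "a (\<lambda>t. c * f t) n = c *\<^sub>C a f n" for n
      unfolding a_def mult.assoc by (intro T_cmult f_test DL1_smooth f)
    then have eq: "a (\<lambda>t. c * f t) = (\<lambda>n. c *\<^sub>C a f n)" by (rule ext)
    show "S (\<lambda>t. c * f t) = c *\<^sub>C S f"
      unfolding S_def eq
      by (rule infsum_bounded_linear_strong[OF _ bounded_linear_scaleC])
        (use summ[OF f] summ[OF DL1_cmult[OF f, of c]] eq in simp)
  next
    fix \<Phi> :: "nat \<Rightarrow> real \<Rightarrow> complex"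
    assume \<Phi>: "(\<forall>k. \<Phi> k \<in> DL1) \<and> DL1_null \<Phi>"
    have "(\<lambda>k. K * p (\<Phi> k)) \<longlonglongrightarrow> K * (3 * (\<Sum>i\<le>m. 0))"
      unfolding p_def using \<Phi> by (intro tendsto_mult tendsto_const tendsto_sum) (simp add: DL1_null_iff)
    then have lim: "(\<lambda>k. K * p (\<Phi> k)) \<longlonglongrightarrow> 0" by simp
    show "(\<lambda>k. S (\<Phi> k)) \<longlonglongrightarrow> 0"
      by (rule Lim_null_comparison[OF _ lim]) (use S_le \<Phi> in \<open>auto intro!: always_eventually\<close>)
  qed
  moreover have "S \<phi> = T \<phi>" if \<phi>: "\<phi> \<in> test_functions" for \<phi>
  proof -
    obtain R where R: "R > 0" "\<And>t. R < \<bar>t\<bar> \<Longrightarrow> \<phi> t = 0"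
      by (rule test_supportE[OF \<phi>]) (rule that)
    obtain N :: nat where N: "R + 1 \<le> real N" using real_arch_simple by blast
    let ?I = "{- int N..int N}"
    have zero: "a \<phi> n = 0" if "n \<notin> ?I" for n
    proof -
      have "\<phi> y * \<kappa> (y - of_int n) = 0" for y
      proof (cases "R < \<bar>y\<bar>")
        case False
        have "int N + 1 \<le> \<bar>n\<bar>" using that by auto
        then have "real N + 1 \<le> \<bar>of_int n\<bar>" by linarith
        then have "1 < \<bar>y - of_int n\<bar>" using False N by linarith
        then show ?thesis using \<kappa>(2) by simp
      qed (simp add: R)
      then have "(\<lambda>y. \<phi> y * \<kappa> (y - of_int n)) = (\<lambda>_. 0)" by (rule ext)
      then show ?thesis unfolding a_def by (simp only: T_zero)
    qed
    \<comment> \<open>Only finitely many pieces of a test function are nonzero, so linearity of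
      \<open>T\<close> reassembles them.\<close>
    have "S \<phi> = infsum (a \<phi>) ?I"
      unfolding S_def by (rule infsum_cong_neutral) (use zero in auto)
    also have "\<dots> = (\<Sum>n\<in>?I. a \<phi> n)" by (rule infsum_finite) simp
    also have "\<dots> = T (\<lambda>y. \<Sum>n\<in>?I. \<phi> y * \<kappa> (y - of_int n))"
      unfolding a_def by (rule T_sum[symmetric]) (auto intro: f_test test_smooth \<phi>)
    also have "(\<lambda>y. \<Sum>n\<in>?I. \<phi> y * \<kappa> (y - of_int n)) = \<phi>"
    proof
      fix y
      show "(\<Sum>n\<in>?I. \<phi> y * \<kappa> (y - of_int n)) = \<phi> y"
      proof (cases "R < \<bar>y\<bar>")
        case False
        then have "\<bar>y\<bar> \<le> real N" using N by linarith
        then have "(\<Sum>n\<in>?I. \<kappa> (y - of_int n)) = 1" using part by simp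
        then show ?thesis unfolding sum_distrib_left[symmetric] by simp
      qed (simp add: R)
    qed
    finally show ?thesis .
  qed
  ultimately show ?thesis by blast
qed

lemma
  shows DL1_extension_continuous: "linear_continuous_on DL1 DL1_null (DL1_extension T)"
    and DL1_extension_eq: "\<phi> \<in> test_functions \<Longrightarrow> DL1_extension T \<phi> = T \<phi>"
  using someI_ex[OF ex_DL1_extension, folded DL1_extension_def] by blast+

end

section \<open>Convolution with the extended functional and the ideals of a class\<close>

locale DL1_functional =
  fixes S :: "(real \<Rightarrow> complex) \<Rightarrow> 'a::complex_banach"
  assumes S: "linear_continuous_on DL1 DL1_null S"
begin

lemmas S_add = linear_continuous_onD(1)[OF S]
lemmas S_cmult = linear_continuous_onD(2)[OF S]
lemmas S_null = linear_continuous_onD(3)[OF S]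

lemma convolve_add: "f \<in> DL1 \<Longrightarrow> g \<in> DL1 \<Longrightarrow>
    convolve S (\<lambda>t. f t + g t) x = convolve S f x + convolve S g x"
  unfolding convolve_def by (intro S_add DL1_reflect)

lemma convolve_cmult: "f \<in> DL1 \<Longrightarrow> convolve S (\<lambda>t. c * f t) x = c *\<^sub>C convolve S f x"
  unfolding convolve_def by (intro S_cmult DL1_reflect)

lemma convolve_diff: "f \<in> DL1 \<Longrightarrow> g \<in> DL1 \<Longrightarrow>
    convolve S (\<lambda>t. f t - g t) x = convolve S f x - convolve S g x"
  using convolve_add[of f "\<lambda>t. (- 1) * g t" x] convolve_cmult[of g "- 1" x] DL1_cmult[of g "- 1"] by simp

lemma convolve_shift: "convolve S (\<lambda>t. f (t + a)) x = convolve S f (x + a)"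
  by (simp add: convolve_def algebra_simps)

lemma convolve_zero: "convolve S (\<lambda>_. 0) x = 0"
  using convolve_cmult[OF DL1_zero, of 0 x] by simp

text \<open>The seminorms of \<open>DL1\<close> are invariant under reflection and translation. If
  uniform smallness failed, the bad points \<open>x n\<close> could be built into the null sequence
  itself, against the continuity of \<open>S\<close>.\<close>

lemma convolve_uniform_null:
  assumes \<Phi>: "\<And>n. \<Phi> n \<in> DL1" "DL1_null \<Phi>" and e: "e > 0"
  shows "\<forall>\<^sub>F n in sequentially. \<forall>x. norm (convolve S (\<Phi> n) x) < e"
proof -
  define x where "x n = (SOME x. \<not> norm (convolve S (\<Phi> n) x) < e)" for n
  have "N1 (nderiv j (\<lambda>t. \<Phi> n (x n - t))) = N1 (nderiv j (\<Phi> n))" for j n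
    by (simp add: nderiv_reflect[OF DL1_smooth[OF \<Phi>(1)]] norm_power)
  with \<Phi>(2) have "DL1_null (\<lambda>n t. \<Phi> n (x n - t))" by (simp add: DL1_null_iff)
  then have "(\<lambda>n. S (\<lambda>t. \<Phi> n (x n - t))) \<longlonglongrightarrow> 0"
    by (intro S_null DL1_reflect \<Phi>)
  then have "(\<lambda>n. norm (convolve S (\<Phi> n) (x n))) \<longlonglongrightarrow> 0"
    unfolding convolve_def by (rule tendsto_norm_zero)
  from order_tendstoD(2)[OF this e] show ?thesis
  proof eventually_elim
    case (elim n)
    show ?case
    proof (rule ccontr)
      assume "\<not> ?thesis"
      then have "\<exists>x. \<not> norm (convolve S (\<Phi> n) x) < e" by blast
      from someI_ex[OF this] elim show False by (simp add: x_def)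
    qed
  qed
qed

text \<open>Both properties follow from \<open>convolve_uniform_null\<close>: boundedness from
  shrinking multiples of \<open>f\<close>, uniform continuity from increments of \<open>f\<close>
  along shifts tending to 0.\<close>

lemma convolve_Cub:
  assumes f: "f \<in> DL1"
  shows "convolve S f \<in> Cub"
proof -
  let ?\<Phi> = "\<lambda>n t. of_real (1 / real (Suc n)) * f t"
  have "(\<lambda>n. 1 / real (Suc n) * N1 (nderiv j f)) \<longlonglongrightarrow> 0" for j
    by (rule tendsto_mult_left_zero[OF LIMSEQ_Suc[OF lim_1_over_n]])
  then have "DL1_null ?\<Phi>"
    unfolding DL1_null_iff nderiv_cmult[OF DL1_smooth[OF f]] N1_cmult norm_of_real by simp
  from convolve_uniform_null[OF DL1_cmult[OF f] this, of 1]
  obtain n where n: "\<And>x. norm (convolve S (?\<Phi> n) x) < 1"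
    by (auto simp: eventually_sequentially)
  have "norm (convolve S f x) \<le> real (Suc n)" for x
  proof -
    have "1 / real (Suc n) * norm (convolve S f x) < 1"
      using n[of x] unfolding convolve_cmult[OF f] norm_scaleC norm_of_real by simp
    then show ?thesis by (simp add: divide_less_eq)
  qed
  then have "bounded (range (convolve S f))" unfolding bounded_iff by blast
  moreover have "uniformly_continuous_on UNIV (convolve S f)"
    unfolding uniformly_continuous_on_sequentially
  proof (intro allI impI, elim conjE)
    fix x y :: "nat \<Rightarrow> real" assume xy: "(\<lambda>n. dist (x n) (y n)) \<longlonglongrightarrow> 0"
    let ?\<Psi> = "\<lambda>n t. f (t + (x n - y n)) - f t"
    have \<Psi>: "?\<Psi> n \<in> DL1" for n by (intro DL1_diff DL1_shift f)
    have null: "DL1_null ?\<Psi>"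
      unfolding DL1_null_iff
    proof
      fix j
      have le: "N1 (nderiv j (?\<Psi> n)) \<le> dist (x n) (y n) * N1 (nderiv 1 (nderiv j f))" for n
        using N1_difference[OF DL1_nderiv[OF f], of j "x n - y n"]
        unfolding nderiv_diff[OF smooth_shift[OF DL1_smooth[OF f]] DL1_smooth[OF f]] nderiv_shift[OF DL1_smooth[OF f]]
        by (simp add: dist_real_def)
      show "(\<lambda>n. N1 (nderiv j (?\<Psi> n))) \<longlonglongrightarrow> 0"
        by (rule tendsto_sandwich[OF _ _ tendsto_const tendsto_mult_left_zero[OF xy, of "N1 (nderiv 1 (nderiv j f))"]])
          (intro always_eventually allI N1_nonneg le)+
    qed
    show "(\<lambda>n. dist (convolve S f (x n)) (convolve S f (y n))) \<longlonglongrightarrow> 0"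
    proof (rule metric_LIMSEQ_I)
      fix e :: real assume "e > 0"
      from convolve_uniform_null[OF \<Psi> null this]
      obtain N where N: "\<And>n z. n \<ge> N \<Longrightarrow> norm (convolve S (?\<Psi> n) z) < e"
        by (auto simp: eventually_sequentially)
      have "convolve S (?\<Psi> n) (y n) = convolve S f (x n) - convolve S f (y n)" for n
        unfolding convolve_diff[OF DL1_shift[OF f] f] convolve_shift by simp
      then have "dist (dist (convolve S f (x n)) (convolve S f (y n))) 0 = norm (convolve S (?\<Psi> n) (y n))" for n
        by (simp only: dist_norm) simp
      then show "\<exists>N. \<forall>n\<ge>N. dist (dist (convolve S f (x n)) (convolve S f (y n))) 0 < e"
        by (intro exI[of _ N] allI impI) (simp only: N)
    qed
  qed
  ultimately show ?thesis by (simp add: Cub_def)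
qed

end

text \<open>Translation invariance of a class will be applied to the twisted convolution, which
  therefore has to lie in \<open>Cub\<close> as well.\<close>

lemma mult_character_Cub:
  assumes f: "f \<in> Cub"
  shows "mult_character v f \<in> Cub"
proof -
  from f obtain B where B: "\<And>t. norm (f t) \<le> B" by (auto simp: Cub_def bounded_iff)
  have "bounded (range (mult_character v f))"
    unfolding bounded_iff using B by (auto simp: mult_character_def character_def norm_scaleC)
  moreover have "uniformly_continuous_on UNIV (mult_character v f)"
    unfolding uniformly_continuous_on_sequentially
  proof (intro allI impI, elim conjE)
    fix x y :: "nat \<Rightarrow> real" assume xy: "(\<lambda>n. dist (x n) (y n)) \<longlonglongrightarrow> 0"
    have fxy: "(\<lambda>n. dist (f (x n)) (f (y n))) \<longlonglongrightarrow> 0"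
      using f xy unfolding Cub_def uniformly_continuous_on_sequentially by simp
    have cis_le: "cmod (cis (v * a) - cis (v * b)) \<le> \<bar>v\<bar> * \<bar>a - b\<bar>" for a b
    proof -
      have "norm (cis (v * a) - cis (v * b)) \<le> \<bar>v\<bar> * norm (a - b)"
      proof (rule differentiable_bound[where S = UNIV])
        show "((\<lambda>t. cis (v * t)) has_derivative (\<lambda>h. h *\<^sub>R (\<i> * of_real v * cis (v * z)))) (at z within UNIV)" for z
          using has_vector_derivative_cis[of v z] by (simp add: has_vector_derivative_def)
        show "onorm (\<lambda>h. h *\<^sub>R (\<i> * of_real v * cis (v * z))) \<le> \<bar>v\<bar>" for z
          by (rule onorm_scaleR_le) (simp add: norm_mult)
      qed auto
      then show ?thesis by simp
    qed
    have le: "dist (mult_character v f (x n)) (mult_character v f (y n)) \<le>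
        dist (f (x n)) (f (y n)) + dist (x n) (y n) * (\<bar>v\<bar> * B)" for n
    proof -
      have "(cis (v * x n) - cis (v * y n)) *\<^sub>C f (y n) = cis (v * x n) *\<^sub>C f (y n) - cis (v * y n) *\<^sub>C f (y n)"
        using scaleC_add_left[of "cis (v * x n) - cis (v * y n)" "cis (v * y n)" "f (y n)"] by simp
      then have "mult_character v f (x n) - mult_character v f (y n) =
          cis (v * x n) *\<^sub>C (f (x n) - f (y n)) + (cis (v * x n) - cis (v * y n)) *\<^sub>C f (y n)"
        by (simp add: mult_character_def character_def scaleC_diff_right)
      then have "norm (mult_character v f (x n) - mult_character v f (y n)) \<le>
          norm (f (x n) - f (y n)) + cmod (cis (v * x n) - cis (v * y n)) * norm (f (y n))"
        using norm_triangle_ineq[of "cis (v * x n) *\<^sub>C (f (x n) - f (y n))"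
            "(cis (v * x n) - cis (v * y n)) *\<^sub>C f (y n)"]
        by (simp add: norm_scaleC)
      also have "cmod (cis (v * x n) - cis (v * y n)) * norm (f (y n)) \<le> (\<bar>v\<bar> * \<bar>x n - y n\<bar>) * B"
        by (intro mult_mono cis_le B) simp_all
      finally show ?thesis by (simp add: dist_norm mult_ac)
    qed
    have lim: "(\<lambda>n. dist (f (x n)) (f (y n)) + dist (x n) (y n) * (\<bar>v\<bar> * B)) \<longlonglongrightarrow> 0"
      using tendsto_add[OF fxy tendsto_mult_left_zero[OF xy, of "\<bar>v\<bar> * B"]] by simp
    show "(\<lambda>n. dist (mult_character v f (x n)) (mult_character v f (y n))) \<longlonglongrightarrow> 0"
      by (rule tendsto_sandwich[OF _ _ tendsto_const lim])
        (intro always_eventually allI zero_le_dist le)+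
  qed
  ultimately show ?thesis by (simp add: Cub_def)
qed

text \<open>\<open>v = 0\<close> gives the ideal of \<open>A\<close>, \<open>v = - w\<close> the one
  for \<open>U\<close>. Convergence in \<open>DL1\<close> makes the convolutions converge uniformly,
  so closedness of the ideal is uniform closedness of the class.\<close>

lemma (in DL1_functional) closed_invariant_class:
  assumes A: "linear_class A" "uniformly_closed J A" "Cub_invariant A"
  shows "closed_invariant {f \<in> DL1. mult_character v (convolve S f) \<in> A}"
proof
  have lin0: "(\<lambda>_. 0) \<in> A" and lin1: "\<And>f g. f \<in> A \<Longrightarrow> g \<in> A \<Longrightarrow> (\<lambda>t. f t + g t) \<in> A"
    and lin2: "\<And>c f. f \<in> A \<Longrightarrow> (\<lambda>t. c *\<^sub>C f t) \<in> A"
    using A(1) by (auto simp: linear_class_def)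
  let ?M = "{f \<in> DL1. mult_character v (convolve S f) \<in> A}"
  show "f \<in> DL1" if "f \<in> ?M" for f using that by simp
  show "(\<lambda>_. 0) \<in> ?M"
    using lin0 by (simp add: DL1_zero mult_character_def convolve_zero)
  show "(\<lambda>t. f t + g t) \<in> ?M" if fg: "f \<in> ?M" "g \<in> ?M" for f g
  proof -
    have "mult_character v (convolve S (\<lambda>t. f t + g t)) =
        (\<lambda>t. mult_character v (convolve S f) t + mult_character v (convolve S g) t)"
      using fg by (simp add: mult_character_def convolve_add scaleC_add_right fun_eq_iff)
    with lin1 fg show ?thesis by (simp add: DL1_add)
  qed
  show "(\<lambda>t. c * f t) \<in> ?M" if f: "f \<in> ?M" for c f
  proof -
    have "mult_character v (convolve S (\<lambda>t. c * f t)) = (\<lambda>t. c *\<^sub>C mult_character v (convolve S f) t)"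
      using f by (simp add: mult_character_def convolve_cmult scaleC_scaleC mult.commute fun_eq_iff)
    with lin2 f show ?thesis by (simp add: DL1_cmult)
  qed
  show "(\<lambda>t. f (t + a)) \<in> ?M" if f: "f \<in> ?M" for f a
  proof -
    have "translate a (mult_character v (convolve S f)) \<in> A"
      using A(3) f mult_character_Cub[OF convolve_Cub] unfolding Cub_invariant_def by blast
    \<comment> \<open>Translating by \<open>a\<close> multiplies the character by the phase
      \<open>cis (v * a)\<close>; linearity removes it.\<close>
    from lin2[OF this, of "cis (- (v * a))"]
    have "(\<lambda>t. cis (- (v * a)) *\<^sub>C translate a (mult_character v (convolve S f)) t) \<in> A" .
    moreover have "(\<lambda>t. cis (- (v * a)) *\<^sub>C translate a (mult_character v (convolve S f)) t) =
        mult_character v (convolve S (\<lambda>t. f (t + a)))"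
      by (simp add: fun_eq_iff translate_def mult_character_def character_def scaleC_scaleC cis_mult
          convolve_shift algebra_simps)
    ultimately show ?thesis using f by (simp add: DL1_shift)
  qed
  fix \<Phi> :: "nat \<Rightarrow> real \<Rightarrow> complex" and f
  assume \<Phi>: "\<And>n. \<Phi> n \<in> ?M" and f: "f \<in> DL1"
    and lim: "\<And>j. (\<lambda>n. N1 (\<lambda>t. nderiv j f t - nderiv j (\<Phi> n) t)) \<longlonglongrightarrow> 0"
  have \<Phi>': "\<Phi> n \<in> DL1" for n using \<Phi>[of n] by simp
  have null: "DL1_null (\<lambda>n t. f t - \<Phi> n t)"
    unfolding DL1_null_iff nderiv_diff[OF DL1_smooth[OF f] DL1_smooth[OF \<Phi>']] using lim by blast
  have "uniform_limit J (\<lambda>n. mult_character v (convolve S (\<Phi> n))) (mult_character v (convolve S f)) sequentially"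
  proof (rule uniform_limitI)
    fix e :: real assume "e > 0"
    from convolve_uniform_null[OF DL1_diff[OF f \<Phi>'] null this]
    show "\<forall>\<^sub>F n in sequentially. \<forall>x\<in>J. dist (mult_character v (convolve S (\<Phi> n)) x) (mult_character v (convolve S f) x) < e"
    proof eventually_elim
      case (elim n)
      have "dist (mult_character v (convolve S (\<Phi> n)) x) (mult_character v (convolve S f) x) =
          norm (convolve S (\<lambda>t. f t - \<Phi> n t) x)" for x
      proof -
        have "mult_character v (convolve S f) x - mult_character v (convolve S (\<Phi> n)) x =
            character v x *\<^sub>C convolve S (\<lambda>t. f t - \<Phi> n t) x"
          by (simp add: mult_character_def convolve_diff[OF f \<Phi>'] scaleC_diff_right)
        then show ?thesis by (simp add: dist_norm norm_minus_commute norm_scaleC character_def)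
      qed
      with elim show ?case by simp
    qed
  qed
  moreover have "\<forall>n. mult_character v (convolve S (\<Phi> n)) \<in> A" using \<Phi> by simp
  ultimately have "mult_character v (convolve S f) \<in> A"
    by (intro A(2)[unfolded uniformly_closed_def, THEN spec, THEN spec, THEN mp, OF conjI])
  with f show "f \<in> ?M" by simp
qed

text \<open>Baire: without isolated points, removing one point leaves a relatively open dense subset
  of \<open>Z\<close>, yet countably many removals exhaust \<open>Z\<close>.\<close>

lemma countable_closed_isolated:
  fixes Z :: "real set"
  assumes "closed Z" "countable Z" "Z \<noteq> {}"
  shows "\<exists>w\<in>Z. \<exists>r>0. \<forall>s\<in>Z. \<bar>s - w\<bar> \<le> r \<longrightarrow> s = w"
proof (rule ccontr)
  assume neg: "\<not> ?thesis"
  have "Z \<subseteq> closure (\<Inter>((\<lambda>x. Z - {x}) ` Z))"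
  proof (rule Baire[OF assms(1)])
    show "countable ((\<lambda>x. Z - {x}) ` Z)" using assms(2) by simp
    fix V assume "V \<in> (\<lambda>x. Z - {x}) ` Z"
    then obtain x where x: "x \<in> Z" "V = Z - {x}" by blast
    have "openin (top_of_set Z) V"
      unfolding x(2) Diff_eq by (intro openin_open_Int) auto
    moreover have "x \<in> closure V"
      unfolding closure_approachable
    proof (intro allI impI)
      fix e :: real assume "e > 0"
      with neg x(1) obtain s where "s \<in> Z" "\<bar>s - x\<bar> \<le> e / 2" "s \<noteq> x"
        by (meson half_gt_zero)
      with \<open>e > 0\<close> show "\<exists>y\<in>V. dist y x < e"
        unfolding x(2) by (intro bexI[of _ s]) (auto simp: dist_real_def)
    qed
    then have "Z \<subseteq> closure V"
      using closure_subset[of V] unfolding x(2) by blast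
    ultimately show "openin (top_of_set Z) V \<and> Z \<subseteq> closure V" by blast
  qed
  moreover have "\<Inter>((\<lambda>x. Z - {x}) ` Z) = {}" using assms(3) by blast
  ultimately show False using assms(3) by simp
qed

text \<open>The bump has positive integral, that is, a transform not vanishing at 0; modulation
  carries this to \<open>w\<close>.\<close>

lemma ex_test_fourier: "\<exists>\<phi>\<in>test_functions. fourier \<phi> w \<noteq> 0"
proof -
  let ?b = "\<lambda>t. complex_of_real (bump t)"
  have b: "?b \<in> test_functions"
  proof (rule testI[OF smooth_bump])
    show "of_real (bump t) = (0 :: complex)" if "1 < \<bar>t\<bar>" for t
    proof -
      have "t \<notin> {0<..<1}" using that by auto
      then show ?thesis by (simp add: bump_eq_0)
    qed
  qed
  have "fourier ?b 0 = of_real (LINT t|lborel. bump t)" by (simp add: fourier_def)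
  also have "(LINT t|lborel. bump t) = (LINT t|lborel. indicator {0..1} t *\<^sub>R bump t)"
  proof (intro Bochner_Integration.integral_cong refl)
    show "bump t = indicator {0..1} t *\<^sub>R bump t" for t
      using bump_eq_0[of t] by (cases "t \<in> {0..1}") auto
  qed
  also have "\<dots> = integral {0..1} bump"
    using set_borel_integral_eq_integral(2)[OF borel_integrable_atLeastAtMost'[OF continuous_on_bump]]
    by (simp add: set_lebesgue_integral_def)
  finally have "fourier ?b 0 \<noteq> 0" using integral_bump_pos by simp
  moreover have "(\<lambda>t. cis (w * t) * ?b t) \<in> test_functions"
    by (rule test_mult(1)[OF b smooth_character])
  ultimately show ?thesis
    by (intro bexI[of _ "\<lambda>t. cis (w * t) * ?b t"]) (simp_all add: fourier_modulate)
qed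

theorem corollary9p8:
  fixes J :: "real set"
    and A U :: "(real \<Rightarrow> 'a::complex_banach) set"
    and S :: "(real \<Rightarrow> complex) \<Rightarrow> 'a"
  assumes "admissible_interval J"
    and "L1loc_class J A" and "linear_class A" and "uniformly_closed J A" and "Cub_invariant A"
    and "L1loc_class J U" and "linear_class U" and "uniformly_closed J U" and "Cub_invariant U"
    and "satisfies_L U A"
    and "S \<in> bounded_distributions"
    and "countable (sp_DL1 A S)"
    and "\<And>\<omega>. \<omega> \<in> sp_DL1 A S \<Longrightarrow> mult_character \<omega> ` A \<subseteq> A"
    and "\<And>\<omega>. \<omega> \<in> sp_DL1 A S \<Longrightarrow> mult_character (- \<omega>) ` A \<subseteq> A"
    and "\<And>\<omega>. \<omega> \<in> sp_DL1 A S \<Longrightarrow> in_distr_class (modulate (- \<omega>) S) U"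
  shows "in_distr_class S A"
proof -
  interpret bounded_distribution S
    using assms(11) by unfold_locales (auto simp: bounded_distributions_def distributions_def)
  define S' where "S' = DL1_extension S"
  have S'_eq: "S' \<phi> = S \<phi>" if "\<phi> \<in> test_functions" for \<phi>
    unfolding S'_def by (rule DL1_extension_eq[OF that])
  interpret E: DL1_functional S'
    unfolding S'_def by unfold_locales (rule DL1_extension_continuous)
  have conv_eq: "convolve S' \<phi> = convolve S \<phi>" if "\<phi> \<in> test_functions" for \<phi>
    unfolding convolve_def by (intro ext S'_eq test_reflect that)
  have char0: "mult_character 0 f = f" for f :: "real \<Rightarrow> 'a"
    by (simp add: mult_character_def character_def)
  define M where "M = {f \<in> DL1. convolve S' f \<in> A}"
  interpret M: closed_invariant M
    using E.closed_invariant_class[OF assms(3-5), of 0] unfolding char0 M_def .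
  have sp: "sp_DL1 A S = M.zeros"
    unfolding sp_DL1_def M.zeros_def S'_def[symmetric] by (auto simp: M_def)
  have "M.zeros = {}"
  proof (rule ccontr)
    assume "M.zeros \<noteq> {}"
    from countable_closed_isolated[OF M.closed_zeros _ this] assms(12) sp
    obtain w r where w: "w \<in> M.zeros" and r: "r > 0" "\<And>s. s \<in> M.zeros \<Longrightarrow> \<bar>s - w\<bar> \<le> r \<Longrightarrow> s = w"
      by auto
    have w': "w \<in> sp_DL1 A S" using w sp by simp
    define N where "N = {f \<in> DL1. mult_character (- w) (convolve S' f) \<in> U}"
    interpret N: closed_invariant N
      unfolding N_def by (rule E.closed_invariant_class[OF assms(7-9)])
    have test_N: "\<phi> \<in> N" if \<phi>: "\<phi> \<in> test_functions" for \<phi>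
    proof -
      let ?\<psi> = "\<lambda>t. cis (- w * t) * \<phi> t"
      have "?\<psi> \<in> test_functions" by (rule test_mult(1)[OF \<phi> smooth_character])
      then have "convolve (modulate (- w) S) ?\<psi> \<in> U"
        using assms(15)[OF w'] unfolding in_distr_class_def by blast
      \<comment> \<open>Characters distribute over convolution: twisting
        \<open>convolve S' \<phi>\<close> amounts to convolving the twisted distribution with the
        twisted test function.\<close>
      moreover have "convolve (modulate (- w) S) ?\<psi> x = mult_character (- w) (convolve S' \<phi>) x" for x
      proof -
        have "(\<lambda>t. character (- w) t * (cis (- w * (x - t)) * \<phi> (x - t))) =
            (\<lambda>t. cis (- w * x) * \<phi> (x - t))"
        proof
          fix t
          have "cis (- w * t) * cis (- w * (x - t)) = cis (- w * x)"
            by (simp add: cis_mult algebra_simps)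
          then show "character (- w) t * (cis (- w * (x - t)) * \<phi> (x - t)) = cis (- w * x) * \<phi> (x - t)"
            unfolding character_def mult.assoc[symmetric] by (rule arg_cong)
        qed
        then have "convolve (modulate (- w) S) ?\<psi> x = S (\<lambda>t. cis (- w * x) * \<phi> (x - t))"
          unfolding convolve_def modulate_def by simp
        also have "\<dots> = cis (- w * x) *\<^sub>C S (\<lambda>t. \<phi> (x - t))"
          by (rule T_cmult[OF test_reflect[OF \<phi>]])
        finally show ?thesis
          unfolding mult_character_def character_def conv_eq[OF \<phi>] by (simp add: convolve_def)
      qed
      ultimately have "mult_character (- w) (convolve S' \<phi>) \<in> U" by (metis ext)
      with test_DL1[OF \<phi>] show ?thesis by (simp add: N_def)
    qed
    obtain \<phi> where \<phi>: "\<phi> \<in> test_functions" "fourier \<phi> w \<noteq> 0"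
      using ex_test_fourier by blast
    \<comment> \<open>The factor \<open>\<phi>\<close> puts \<open>\<eta>\<close> into
      \<open>N\<close>; the plateau confines the transform to distances below \<open>r\<close> from
      \<open>w\<close> while keeping its value at \<open>w\<close>.\<close>
    define \<eta> where "\<eta> = conv \<phi> (plateau w (r / 2) r)"
    have \<eta>_N: "\<eta> \<in> N" unfolding \<eta>_def by (rule N.conv_mem[OF test_N[OF \<phi>(1)] plateau_integrable])
    have \<eta>: "\<eta> \<in> DL1" by (rule N.sub_DL1[OF \<eta>_N])
    have \<eta>_fourier: "fourier \<eta> s = fourier \<phi> s * fourier (plateau w (r / 2) r) s" for s
      unfolding \<eta>_def by (rule fourier_conv[OF DL1_integrable[OF test_DL1[OF \<phi>(1)]] plateau_integrable])
    have \<eta>0: "fourier \<eta> s = 0" if "r \<le> \<bar>s - w\<bar>" for s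
      unfolding \<eta>_fourier using fourier_plateau_eq_0[OF _ _ that, of "r / 2"] r(1) by simp
    have \<eta>1: "fourier \<eta> w \<noteq> 0"
      unfolding \<eta>_fourier using fourier_plateau_eq_1[of "r / 2" r w w] r(1) \<phi>(2) by simp
    define \<psi> where "\<psi> = mult_character (- w) (convolve S' \<eta>)"
    have "\<psi> \<in> U" using \<eta>_N by (simp add: N_def \<psi>_def)
    moreover have "difference h \<psi> \<in> A" for h
    proof -
      \<comment> \<open>The phase is chosen so that twisting \<open>convolve S' ?\<zeta>\<close> by
        frequency \<open>- w\<close> produces the difference of \<open>\<psi>\<close>. Invariance of
        \<open>A\<close> under the character of \<open>- w\<close> is used here, that of
        \<open>w\<close> to return from \<open>\<psi>\<close> to the convolution.\<close>
      let ?\<zeta> = "\<lambda>t. cis (- (w * h)) * \<eta> (t + h) - \<eta> t"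
      have "?\<zeta> \<in> M" by (rule M.isolated_difference_mem[OF r \<eta> \<eta>0])
      then have "mult_character (- w) (convolve S' ?\<zeta>) \<in> A"
        using assms(14)[OF w'] by (auto simp: M_def)
      moreover have "mult_character (- w) (convolve S' ?\<zeta>) = difference h \<psi>"
      proof
        fix t
        have "convolve S' ?\<zeta> t = cis (- (w * h)) *\<^sub>C convolve S' \<eta> (t + h) - convolve S' \<eta> t"
          by (simp add: E.convolve_diff E.convolve_cmult E.convolve_shift DL1_cmult DL1_shift \<eta>)
        moreover have "cis (- w * t) * cis (- (w * h)) = cis (- w * (t + h))"
          by (simp add: cis_mult algebra_simps)
        ultimately show "mult_character (- w) (convolve S' ?\<zeta>) t = difference h \<psi> t"
          unfolding \<psi>_def difference_def translate_def mult_character_def character_def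
          by (simp only: scaleC_diff_right scaleC_scaleC)
      qed
      ultimately show ?thesis by simp
    qed
    ultimately have "\<psi> \<in> A" using assms(10) unfolding satisfies_L_def by blast
    then have "mult_character w \<psi> \<in> A" using assms(13)[OF w'] by blast
    moreover have "mult_character w \<psi> = convolve S' \<eta>"
      by (simp add: \<psi>_def mult_character_def character_def scaleC_scaleC cis_mult fun_eq_iff)
    ultimately have "\<eta> \<in> M" using \<eta> by (simp add: M_def)
    with w \<eta>1 show False by (auto simp: M.zeros_def)
  qed
  then have "\<phi> \<in> M" if "\<phi> \<in> test_functions" for \<phi>
    using M.all_mem test_DL1[OF that] by blast
  then show ?thesis
    unfolding in_distr_class_def M_def using conv_eq by auto
qed

end
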